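(* Let $p=p(n)\in(0,1)$ be a probability parameter which may depend on $n$. If for some integer $k\ge 1$ one has $p\ll n^{-1-\frac{2}{k+1}}$, then for a random 2-complex $Y\in G(\Delta_n^{(2)},p)$ the fundamental group $\pi_1(Y)$ is free and $H_2(Y;\mathbb{Z})=0$, asymptotically almost surely.
   Context: Random 2-complexes (Linial--Meshulam model): $\Delta_n$ is the $(n-1)$-dimensional simplex with vertex set $\{1,\dots,n\}$ and $\Delta_n^{(i)}$ is its $i$-skeleton. $G(\Delta_n^{(2)},p)$ is the set of all simplicial complexes $Y$ with $\Delta_n^{(1)}\subset Y\subset \Delta_n^{(2)}$, equipped with the probability function $\mathbb{P}(Y)=p^{f(Y)}(1-p)^{\binom n3-f(Y)}$, where $f(Y)$ is the number of 2-simplexes of $Y$ (each 2-simplex is included independently with probability $p$). "Asymptotically almost surely" means with probability tending to $1$ as $n\to\infty$. The symbol $a_n\ll b_n$ means $a_n>0$ and $a_n/b_n\to 0$ as $n\to\infty$. *)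

theory Defs
  imports "HOL-Analysis.Analysis" "HOL-Homology.Homology"
begin

section \<open>Free groups\<close>

text \<open>A word over \<open>S\<close> is a list of letters; \<open>(s, True)\<close> stands for \<open>s\<close> and \<open>(s, False)\<close> for its
  formal inverse.\<close>

definition reduced_words :: "'a set \<Rightarrow> ('a \<times> bool) list set" where
  "reduced_words S =
     {w. set w \<subseteq> S \<times> UNIV \<and> successively (\<lambda>x y. \<not> (fst x = fst y \<and> snd x \<noteq> snd y)) w}"

definition word_value :: "('a, 'b) monoid_scheme \<Rightarrow> ('a \<times> bool) list \<Rightarrow> 'a" where
  "word_value G w =
     foldr (\<lambda>(s, e) y. (if e then s else inv\<^bsub>G\<^esub> s) \<otimes>\<^bsub>G\<^esub> y) w \<one>\<^bsub>G\<^esub>"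

text \<open>The reduced words over \<open>S\<close> are the elements of the free group on \<open>S\<close>, and \<open>word_value G\<close> is
  its canonical homomorphism to \<open>G\<close>. Hence \<open>G\<close> is free on \<open>S\<close> iff \<open>word_value G\<close> is bijective. No
  other index set for the generators is needed, as a free basis embeds into the group.\<close>

definition free_group_on :: "'a set \<Rightarrow> ('a, 'b) monoid_scheme \<Rightarrow> bool" where
  "free_group_on S G \<longleftrightarrow>
     group G \<and> S \<subseteq> carrier G \<and> bij_betw (word_value G) (reduced_words S) (carrier G)"

definition free_group :: "('a, 'b) monoid_scheme \<Rightarrow> bool" where
  "free_group G \<longleftrightarrow> (\<exists>S. free_group_on S G)"


section \<open>The fundamental group\<close>

text \<open>Paths are functions on all of \<^typ>\<open>real\<close> of which only the values on \<open>{0..1}\<close> matter;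
  \<^const>\<open>homotopic_paths\<close> identifies any two that agree there.\<close>

definition path_class :: "'a::topological_space set \<Rightarrow> (real \<Rightarrow> 'a) \<Rightarrow> (real \<Rightarrow> 'a) set" where
  "path_class X g = {h. homotopic_paths X g h}"

definition loops_at :: "'a::topological_space set \<Rightarrow> 'a \<Rightarrow> (real \<Rightarrow> 'a) set" where
  "loops_at X x = {g. path g \<and> path_image g \<subseteq> X \<and> pathstart g = x \<and> pathfinish g = x}"

definition fundamental_group :: "'a::topological_space set \<Rightarrow> 'a \<Rightarrow> (real \<Rightarrow> 'a) set monoid" where
  "fundamental_group X x =
     \<lparr> carrier = path_class X ` loops_at X x,
       mult = (\<lambda>A B. \<Union>f\<in>A. \<Union>g\<in>B. path_class X (f +++ g)),
       one = path_class X (\<lambda>_. x) \<rparr>"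


section \<open>Simplicial complexes\<close>

text \<open>The constant of the library called \<open>simplicial_complex\<close> describes geometric complexes in a
  fixed Euclidean space; here complexes are abstract, with nonempty simplices.\<close>

definition abstract_complex :: "'a set set \<Rightarrow> bool" where
  "abstract_complex K \<longleftrightarrow>
     (\<forall>\<sigma>\<in>K. finite \<sigma> \<and> \<sigma> \<noteq> {}) \<and> (\<forall>\<sigma>\<in>K. \<forall>\<tau>. \<tau> \<subseteq> \<sigma> \<and> \<tau> \<noteq> {} \<longrightarrow> \<tau> \<in> K)"

text \<open>Barycentric coordinates. The points lie in \<^typ>\<open>'a \<Rightarrow> real\<close> with the product topology; for
  complexes with finitely many vertices this gives the usual topology of the realization.\<close>

definition realization :: "'a set set \<Rightarrow> ('a \<Rightarrow> real) set" where
  "realization K =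
     {x. {v. x v \<noteq> 0} \<in> K \<and> (\<forall>v. 0 \<le> x v) \<and> (\<Sum>v | x v \<noteq> 0. x v) = 1}"


section \<open>The Linial--Meshulam model\<close>

definition simplex_skeleton :: "nat \<Rightarrow> nat \<Rightarrow> nat set set" where
  "simplex_skeleton n i = {\<sigma>. \<sigma> \<subseteq> {1..n} \<and> \<sigma> \<noteq> {} \<and> card \<sigma> \<le> i + 1}"

definition LM_complexes :: "nat \<Rightarrow> nat set set set" where
  "LM_complexes n =
     {Y. abstract_complex Y \<and> simplex_skeleton n 1 \<subseteq> Y \<and> Y \<subseteq> simplex_skeleton n 2}"

definition num_triangles :: "nat set set \<Rightarrow> nat" where
  "num_triangles Y = card {\<sigma>\<in>Y. card \<sigma> = 3}"

definition LM_measure :: "nat \<Rightarrow> real \<Rightarrow> nat set set measure" where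
  "LM_measure n p = point_measure (LM_complexes n)
     (\<lambda>Y. ennreal (p ^ num_triangles Y * (1 - p) ^ ((n choose 3) - num_triangles Y)))"

end

theory Submission
  imports Defs
begin

text \<open>
  First moments show that asymptotically almost surely \<open>Y\<close> contains neither \<open>k + 1\<close> triangles on
  at most \<open>k + 3\<close> vertices nor, for \<open>1 \<le> t \<le> k\<close>, \<open>t\<close> triangles on at most \<open>t\<close> vertices. A nonempty set
  of triangles without free edges contains one of the two: growing it from a single triangle through
  shared edges adds at most one vertex per triangle, and if this stops early, every vertex lies in
  at least three triangles. Hence \<open>Y\<close> collapses to a connected graph, and collapses are
  deformation retractions.

  For a graph, the second homology vanishes by excision: the complement of the edge midpoints, the
  complement of the vertices, and their intersection are disjoint unions of star-shaped sets. The
  fundamental group is generated by the edges outside a spanning tree, because a path inside the open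
  star of a vertex is homotopic to two segments. These generators are free, because parallel
  transport along them acts on reduced words by left multiplication, homotopic paths have the same
  transport, and the loop of a reduced word carries the empty word to the reversed word.
\<close>

section \<open>The fundamental groupoid\<close>

text \<open>The exponent comes from the first kind of configuration: \<open>k + 1\<close> triangles
  on \<open>k + 3\<close> vertices have probability at most a constant times
  \<open>n^(k+3) p^(k+1)\<close>, and the root of order \<open>k + 1\<close> of
  \<open>n^(-(k+3))\<close> is \<open>n^(-1-2/(k+1))\<close>. The second kind costs
  \<open>(n p)^t\<close>, so there \<open>p\<close> much smaller than \<open>1/n\<close> is enough.
  Base points are the obstacle on the topological side. A collapse moves the base point, possibly
  into the interior of an edge, so freeness has to be proved at every point of the realization, and
  classes of paths that are not loops are indispensable. Hence the groupoid of path classes, and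
  \<open>rebase\<close>, which turns it into loops. To tell reduced words apart, an invariant of
  path classes is needed. Transport supplies the monodromy of a covering without building a covering
  space: the fibre is a bare type without topology, and the only datum is a rule comparing the
  fibres over two nearby points. Its law is checked on open stars of vertices, and a graph satisfies
  it because no simplex has three vertices.\<close>

definition paths_between :: "'a::topological_space set \<Rightarrow> 'a \<Rightarrow> 'a \<Rightarrow> (real \<Rightarrow> 'a) set" where
  "paths_between X a b = {g. path g \<and> path_image g \<subseteq> X \<and> pathstart g = a \<and> pathfinish g = b}"

text \<open>The product of \<open>fundamental_group\<close> freed from the base point, so that one
  operation serves the groupoid and all its vertex groups.\<close>

definition path_mult ::
    "'a::topological_space set \<Rightarrow> (real \<Rightarrow> 'a) set \<Rightarrow> (real \<Rightarrow> 'a) set \<Rightarrow> (real \<Rightarrow> 'a) set" where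
  "path_mult X A B = (\<Union>f\<in>A. \<Union>g\<in>B. path_class X (f +++ g))"

lemma loops_at_eq: "loops_at X x = paths_between X x x"
  by (auto simp: loops_at_def paths_between_def)

lemma carrier_fundamental_group:
  "carrier (fundamental_group X x) = path_class X ` paths_between X x x"
  by (simp add: fundamental_group_def loops_at_eq)

lemma mult_fundamental_group [simp]: "mult (fundamental_group X x) = path_mult X"
  by (simp add: fundamental_group_def path_mult_def fun_eq_iff)

lemma one_fundamental_group [simp]: "one (fundamental_group X x) = path_class X (\<lambda>_. x)"
  by (simp add: fundamental_group_def)

lemma paths_betweenD:
  assumes "f \<in> paths_between X a b"
  shows "path f" "path_image f \<subseteq> X" "pathstart f = a" "pathfinish f = b"
    "\<And>t. 0 \<le> t \<Longrightarrow> t \<le> 1 \<Longrightarrow> f t \<in> X" "f 0 = a" "f 1 = b" "continuous_on {0..1} f" "a \<in> X" "b \<in> X"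
  using assms by (auto simp: paths_between_def path_image_def pathstart_def pathfinish_def path_def)

lemma paths_betweenI:
  assumes "continuous_on {0..1} f" "\<And>t. 0 \<le> t \<Longrightarrow> t \<le> 1 \<Longrightarrow> f t \<in> X" "f 0 = a" "f 1 = b"
  shows "f \<in> paths_between X a b"
  using assms by (auto simp: paths_between_def path_image_def pathstart_def pathfinish_def path_def)

lemma paths_between_const: "x \<in> X \<Longrightarrow> (\<lambda>_. x) \<in> paths_between X x x"
  by (auto intro!: paths_betweenI)

lemma paths_between_join:
  "f \<in> paths_between X a b \<Longrightarrow> g \<in> paths_between X b c \<Longrightarrow> f +++ g \<in> paths_between X a c"
  by (simp add: paths_between_def subset_path_image_join)

lemma paths_between_reverse:
  "f \<in> paths_between X a b \<Longrightarrow> reversepath f \<in> paths_between X b a"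
  by (auto simp: paths_between_def)

lemma paths_between_image:
  assumes "f \<in> paths_between X a b" "continuous_on X r" "r ` X \<subseteq> Y"
  shows "r \<circ> f \<in> paths_between Y (r a) (r b)"
proof (rule paths_betweenI)
  show "continuous_on {0..1} (r \<circ> f)"
    using paths_betweenD(2,8)[OF assms(1)] assms(2)
    by (intro continuous_on_compose) (auto simp: path_image_def intro: continuous_on_subset)
qed (use paths_betweenD[OF assms(1)] assms(3) in auto)

lemma homotopic_paths_between:
  assumes "homotopic_paths X f g"
  shows "f \<in> paths_between X a b \<longleftrightarrow> g \<in> paths_between X a b"
  using homotopic_paths_imp_path[OF assms] homotopic_paths_imp_subset[OF assms]
    homotopic_paths_imp_pathstart[OF assms] homotopic_paths_imp_pathfinish[OF assms]
  by (auto simp: paths_between_def)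

lemma path_class_eqI: "homotopic_paths X f g \<Longrightarrow> path_class X f = path_class X g"
  unfolding path_class_def using homotopic_paths_trans homotopic_paths_sym by blast

lemma path_class_eqD:
  assumes "path_class X f = path_class X g" "g \<in> paths_between X a b"
  shows "homotopic_paths X f g"
proof -
  have "g \<in> path_class X g"
    using assms(2) by (simp add: path_class_def paths_between_def)
  then have "g \<in> path_class X f"
    using assms(1) by simp
  then show ?thesis
    by (simp add: path_class_def)
qed

text \<open>The straight-line homotopy between \<open>p\<close> and \<open>q\<close> lives in
  \<open>D\<close>, and only its image under \<open>f\<close> has to lie in \<open>X\<close>. So
  nothing linear is asked of the space that carries the paths.\<close>

lemma homotopic_paths_convex_image:
  fixes D :: "'a::real_normed_vector set" and f :: "'a \<Rightarrow> 'b::topological_space"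
  assumes "convex D" "continuous_on D f" "f ` D \<subseteq> X"
    and p: "p \<in> paths_between D a b" and q: "q \<in> paths_between D a b"
  shows "homotopic_paths X (f \<circ> p) (f \<circ> q)"
proof (rule homotopic_paths_continuous_image)
  show "homotopic_paths D p q"
  proof (rule homotopic_paths_linear)
    fix t :: real assume "t \<in> {0..1}"
    then show "closed_segment (p t) (q t) \<subseteq> D"
      using paths_betweenD(5)[OF p] paths_betweenD(5)[OF q] assms(1) by (simp add: closed_segment_subset)
  qed (use paths_betweenD[OF p] paths_betweenD[OF q] in auto)
qed (use assms in auto)

lemma linepath_paths_between:
  "convex D \<Longrightarrow> a \<in> D \<Longrightarrow> b \<in> D \<Longrightarrow> linepath a b \<in> paths_between D a b"
  by (auto simp: paths_between_def closed_segment_subset subset_iff[symmetric])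

lemma compose_joinpaths: "f \<circ> (p +++ q) = (f \<circ> p) +++ (f \<circ> q)"
  by (auto simp: joinpaths_def)

lemma path_compose_linepath_01: "f \<circ> linepath 0 1 = (f :: real \<Rightarrow> 'a)"
  by (auto simp: linepath_def)

lemma path_compose_linepath_const: "f \<circ> linepath a a = (\<lambda>_. f (a::real))"
  by (auto simp: linepath_def algebra_simps)

text \<open>Both sides are images under \<open>f\<close> of paths in \<open>{u..v}\<close> from
  \<open>a\<close> to \<open>c\<close>. The three points may come in any order and may repeat, so
  this one fact yields the unit laws, the inverse laws and the subdivision of a path.\<close>

lemma path_class_line_join:
  fixes f :: "real \<Rightarrow> 'a::topological_space"
  assumes f: "continuous_on {u..v} f" "f ` {u..v} \<subseteq> X" and "{a, b, c} \<subseteq> {u..v}"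
  shows "path_class X ((f \<circ> linepath a b) +++ (f \<circ> linepath b c)) = path_class X (f \<circ> linepath a c)"
  unfolding compose_joinpaths[symmetric] using assms
  by (intro path_class_eqI homotopic_paths_convex_image[of "{u..v}" f X _ a c]
       paths_between_join[of _ _ _ b] linepath_paths_between) auto

lemma path_mult_class:
  assumes f: "f \<in> paths_between X a b" and g: "g \<in> paths_between X b c"
  shows "path_mult X (path_class X f) (path_class X g) = path_class X (f +++ g)"
proof -
  have "path_class X (f' +++ g') = path_class X (f +++ g)"
    if "f' \<in> path_class X f" "g' \<in> path_class X g" for f' g'
    using that f g
    by (intro path_class_eqI[symmetric] homotopic_paths_join) (auto simp: path_class_def paths_between_def)
  moreover have "f \<in> path_class X f" "g \<in> path_class X g"
    using f g by (auto simp: path_class_def paths_between_def)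
  ultimately show ?thesis
    unfolding path_mult_def by blast
qed

definition path_classes :: "'a::topological_space set \<Rightarrow> 'a \<Rightarrow> 'a \<Rightarrow> (real \<Rightarrow> 'a) set set" where
  "path_classes X a b = path_class X ` paths_between X a b"

lemma path_classI: "f \<in> paths_between X a b \<Longrightarrow> path_class X f \<in> path_classes X a b"
  by (auto simp: path_classes_def)

lemma path_mult_closed:
  "A \<in> path_classes X a b \<Longrightarrow> B \<in> path_classes X b c \<Longrightarrow> path_mult X A B \<in> path_classes X a c"
  by (auto simp: path_classes_def path_mult_class intro!: imageI paths_between_join)

lemma path_mult_assoc:
  assumes "A \<in> path_classes X a b" "B \<in> path_classes X b c" "C \<in> path_classes X c d"
  shows "path_mult X (path_mult X A B) C = path_mult X A (path_mult X B C)"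
proof -
  obtain f g h where [simp]: "A = path_class X f" "B = path_class X g" "C = path_class X h"
    and f: "f \<in> paths_between X a b" and g: "g \<in> paths_between X b c" and h: "h \<in> paths_between X c d"
    using assms by (auto simp: path_classes_def)
  have "homotopic_paths X (f +++ (g +++ h)) ((f +++ g) +++ h)"
    using f g h by (intro homotopic_paths_assoc) (auto simp: paths_between_def)
  then have "path_class X (f +++ (g +++ h)) = path_class X ((f +++ g) +++ h)"
    by (rule path_class_eqI)
  then show ?thesis
    using path_mult_class[OF f g] path_mult_class[OF g h]
      path_mult_class[OF paths_between_join[OF f g] h] path_mult_class[OF f paths_between_join[OF g h]]
    by simp
qed

lemma path_mult_one_right:
  assumes "A \<in> path_classes X a b"
  shows "path_mult X A (path_class X (\<lambda>_. b)) = A"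
proof -
  obtain f where [simp]: "A = path_class X f" and f: "f \<in> paths_between X a b"
    using assms by (auto simp: path_classes_def)
  have "path_class X ((f \<circ> linepath 0 1) +++ (f \<circ> linepath 1 1)) = path_class X (f \<circ> linepath 0 1)"
    using paths_betweenD[OF f] by (intro path_class_line_join[of 0 1]) auto
  then have "path_class X (f +++ (\<lambda>_. b)) = path_class X f"
    using paths_betweenD[OF f] by (simp add: path_compose_linepath_01 path_compose_linepath_const)
  then show ?thesis
    using path_mult_class[OF f paths_between_const] paths_betweenD[OF f] by simp
qed

lemma path_mult_one_left:
  assumes "A \<in> path_classes X a b"
  shows "path_mult X (path_class X (\<lambda>_. a)) A = A"
proof -
  obtain f where [simp]: "A = path_class X f" and f: "f \<in> paths_between X a b"
    using assms by (auto simp: path_classes_def)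
  have "path_class X ((f \<circ> linepath 0 0) +++ (f \<circ> linepath 0 1)) = path_class X (f \<circ> linepath 0 1)"
    using paths_betweenD[OF f] by (intro path_class_line_join[of 0 1]) auto
  then have "path_class X ((\<lambda>_. a) +++ f) = path_class X f"
    using paths_betweenD[OF f] by (simp add: path_compose_linepath_01 path_compose_linepath_const)
  then show ?thesis
    using path_mult_class[OF paths_between_const f] paths_betweenD[OF f] by simp
qed

lemma path_mult_reverse:
  assumes f: "f \<in> paths_between X a b"
  shows "path_mult X (path_class X f) (path_class X (reversepath f)) = path_class X (\<lambda>_. a)"
    and "path_mult X (path_class X (reversepath f)) (path_class X f) = path_class X (\<lambda>_. b)"
proof -
  have r: "f \<circ> linepath 1 0 = reversepath f"
    by (auto simp: linepath_def reversepath_def)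
  have "path_class X ((f \<circ> linepath 0 1) +++ (f \<circ> linepath 1 0)) = path_class X (f \<circ> linepath 0 0)"
    using paths_betweenD[OF f] by (intro path_class_line_join[of 0 1]) auto
  then show "path_mult X (path_class X f) (path_class X (reversepath f)) = path_class X (\<lambda>_. a)"
    using paths_betweenD[OF f] path_mult_class[OF f paths_between_reverse[OF f]]
    by (simp add: path_compose_linepath_01 path_compose_linepath_const r)
  have "path_class X ((f \<circ> linepath 1 0) +++ (f \<circ> linepath 0 1)) = path_class X (f \<circ> linepath 1 1)"
    using paths_betweenD[OF f] by (intro path_class_line_join[of 0 1]) auto
  then show "path_mult X (path_class X (reversepath f)) (path_class X f) = path_class X (\<lambda>_. b)"
    using paths_betweenD[OF f] path_mult_class[OF paths_between_reverse[OF f] f]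
    by (simp add: path_compose_linepath_01 path_compose_linepath_const r)
qed

lemma path_classes_inverse:
  assumes "A \<in> path_classes X a b"
  obtains B where "B \<in> path_classes X b a" "path_mult X A B = path_class X (\<lambda>_. a)"
    "path_mult X B A = path_class X (\<lambda>_. b)"
proof -
  obtain f where "A = path_class X f" and f: "f \<in> paths_between X a b"
    using assms by (auto simp: path_classes_def)
  with that show thesis
    using path_mult_reverse[OF f] path_classI[OF paths_between_reverse[OF f]] by blast
qed

lemma carrier_fundamental_group': "carrier (fundamental_group X x) = path_classes X x x"
  by (simp add: carrier_fundamental_group path_classes_def)

lemma group_fundamental_group:
  assumes "x \<in> X"
  shows "group (fundamental_group X x)"
proof (rule groupI)
  fix A assume "A \<in> carrier (fundamental_group X x)"
  then obtain B where "B \<in> path_classes X x x" "path_mult X B A = path_class X (\<lambda>_. x)"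
    unfolding carrier_fundamental_group' by (metis path_classes_inverse)
  then show "\<exists>y\<in>carrier (fundamental_group X x).
       y \<otimes>\<^bsub>fundamental_group X x\<^esub> A = \<one>\<^bsub>fundamental_group X x\<^esub>"
    by (auto simp: carrier_fundamental_group')
qed (use assms in \<open>auto simp: carrier_fundamental_group' path_mult_assoc path_mult_one_left 
       intro: path_mult_closed path_classI paths_between_const\<close>)

lemma inv_fundamental_group:
  assumes "f \<in> paths_between X x x"
  shows "inv\<^bsub>fundamental_group X x\<^esub> (path_class X f) = path_class X (reversepath f)"
proof -
  interpret group "fundamental_group X x"
    using assms by (intro group_fundamental_group) (auto dest: paths_betweenD)
  show ?thesis
    using assms path_mult_reverse[OF assms]
    by (intro inv_equality) (auto simp: carrier_fundamental_group' intro: path_classI paths_between_reverse)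
qed

text \<open>The two ways along the boundary of the unit square from \<open>(0,0)\<close> to
  \<open>(1,1)\<close> are homotopic within the square. The relations for cones and for deformations
  are both read off from this.\<close>

lemma path_class_square:
  fixes h :: "real \<times> real \<Rightarrow> 'a::topological_space"
  assumes h: "continuous_on ({0..1} \<times> {0..1}) h" "h ` ({0..1} \<times> {0..1}) \<subseteq> X"
  shows "path_class X ((\<lambda>t. h (0, t)) +++ (\<lambda>s. h (s, 1))) = path_class X ((\<lambda>s. h (s, 0)) +++ (\<lambda>t. h (1, t)))"
proof -
  have "path_class X (h \<circ> (linepath (0,0) (0,1) +++ linepath (0,1) (1,1)))
      = path_class X (h \<circ> (linepath (0,0) (1,0) +++ linepath (1,0) (1,1)))"
    using assms
    by (intro path_class_eqI homotopic_paths_convex_image[of "{0..1} \<times> {0..1}" h X _ "(0,0)" "(1,1)"]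
        paths_between_join[of "linepath (0,0) (0,1)" _ _ "(0,1)"]
        paths_between_join[of "linepath (0,0) (1,0)" _ _ "(1,0)"] linepath_paths_between)
      (auto simp: convex_Times)
  then show ?thesis
    unfolding compose_joinpaths by (simp add: linepath_def o_def)
qed

section \<open>Parallel transport\<close>

text \<open>\<open>c x y\<close> is thought of as carrying the fibre over \<open>x\<close> to the
  fibre over a nearby \<open>y\<close>, and \<open>\<phi>\<close> is a horizontal section over
  \<open>f\<close> for this discrete connection. The fibre type \<open>'r\<close> has no topology;
  the condition is local in the parameter only.\<close>

definition lift_along :: "('b \<Rightarrow> 'b \<Rightarrow> 'r \<Rightarrow> 'r) \<Rightarrow> 'd::topological_space set \<Rightarrow> ('d \<Rightarrow> 'b) \<Rightarrow> ('d \<Rightarrow> 'r) \<Rightarrow> bool" where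
  "lift_along c D f \<phi> \<longleftrightarrow>
     (\<forall>d\<in>D. \<exists>U. open U \<and> d \<in> U \<and> (\<forall>e\<in>U \<inter> D. \<phi> e = c (f d) (f e) (\<phi> d)))"

definition transports :: "('b \<Rightarrow> 'b \<Rightarrow> 'r \<Rightarrow> 'r) \<Rightarrow> (real \<Rightarrow> 'b) \<Rightarrow> 'r \<Rightarrow> 'r \<Rightarrow> bool" where
  "transports c g w w' \<longleftrightarrow> (\<exists>\<phi>. lift_along c {0..1} g \<phi> \<and> \<phi> 0 = w \<and> \<phi> 1 = w')"

lemma lift_along_pullback:
  assumes "lift_along c D f \<phi>" "continuous_on D' g" "g ` D' \<subseteq> D"
  shows "lift_along c D' (f \<circ> g) (\<phi> \<circ> g)"
  unfolding lift_along_def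
proof
  fix d assume d: "d \<in> D'"
  then obtain U where U: "open U" "g d \<in> U" "\<forall>e\<in>U \<inter> D. \<phi> e = c (f (g d)) (f e) (\<phi> (g d))"
    using assms(1,3) unfolding lift_along_def by blast
  obtain V where V: "open V" "V \<inter> D' = g -` U \<inter> D'"
    using assms(2) U(1) unfolding continuous_on_open_invariant by blast
  show "\<exists>V. open V \<and> d \<in> V \<and> (\<forall>e\<in>V \<inter> D'. (\<phi> \<circ> g) e = c ((f \<circ> g) d) ((f \<circ> g) e) ((\<phi> \<circ> g) d))"
  proof (intro exI[of _ V] conjI ballI)
    fix e assume "e \<in> V \<inter> D'"
    then have "e \<in> g -` U \<inter> D'" using V(2) by simp
    with U(3) assms(3) show "(\<phi> \<circ> g) e = c ((f \<circ> g) d) ((f \<circ> g) e) ((\<phi> \<circ> g) d)"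
      by auto
  next
    have "d \<in> V \<inter> D'" using V(2) U(2) d by simp
    then show "d \<in> V" by simp
  qed (rule V(1))
qed

lemma lift_along_subset: "lift_along c D f \<phi> \<Longrightarrow> D' \<subseteq> D \<Longrightarrow> lift_along c D' f \<phi>"
  using lift_along_pullback[of c D f \<phi> D' id] by simp

lemma lift_along_cong:
  assumes "lift_along c D f \<phi>" "\<And>d. d \<in> D \<Longrightarrow> f d = f' d" "\<And>d. d \<in> D \<Longrightarrow> \<phi> d = \<phi>' d"
  shows "lift_along c D f' \<phi>'"
  unfolding lift_along_def
proof
  fix d assume d: "d \<in> D"
  then obtain U where U: "open U" "d \<in> U" "\<forall>e\<in>U \<inter> D. \<phi> e = c (f d) (f e) (\<phi> d)"
    using assms(1) unfolding lift_along_def by blast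
  have "\<phi>' e = c (f' d) (f' e) (\<phi>' d)" if "e \<in> U \<inter> D" for e
    using bspec[OF U(3) that] assms(2)[of e] assms(3)[of e] assms(2)[OF d] assms(3)[OF d] IntD2[OF that]
    by simp
  with U(1,2) show "\<exists>U. open U \<and> d \<in> U \<and> (\<forall>e\<in>U \<inter> D. \<phi>' e = c (f' d) (f' e) (\<phi>' d))"
    by blast
qed

text \<open>A parameter outside one of the closed sets has a neighbourhood that misses this set. So
  near every parameter the condition splits into one over \<open>A\<close> and one over
  \<open>B\<close>.\<close>

lemma lift_along_Un:
  assumes A: "lift_along c A f \<phi>" "closed A" and B: "lift_along c B f \<psi>" "closed B"
    and eq: "\<And>d. d \<in> A \<inter> B \<Longrightarrow> \<phi> d = \<psi> d"
  shows "lift_along c (A \<union> B) f (\<lambda>d. if d \<in> A then \<phi> d else \<psi> d)"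
proof -
  let ?\<chi> = "\<lambda>d. if d \<in> A then \<phi> d else \<psi> d"
  have *: "\<exists>U. open U \<and> d \<in> U \<and> (\<forall>e\<in>U \<inter> C. ?\<chi> e = c (f d) (f e) (?\<chi> d))"
    if "lift_along c C f ?\<chi>" "closed C" for C d
  proof (cases "d \<in> C")
    case False
    with that(2) show ?thesis by (intro exI[of _ "- C"]) auto
  next
    case True
    with that(1) show ?thesis unfolding lift_along_def by (rule bspec)
  qed
  have "lift_along c A f ?\<chi>"
    by (rule lift_along_cong[OF A(1)]) auto
  moreover have "lift_along c B f ?\<chi>"
    by (rule lift_along_cong[OF B(1)]) (use eq in auto)
  ultimately have ex: "\<exists>U. open U \<and> d \<in> U \<and> (\<forall>e\<in>U \<inter> A. ?\<chi> e = c (f d) (f e) (?\<chi> d))"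
    "\<exists>U. open U \<and> d \<in> U \<and> (\<forall>e\<in>U \<inter> B. ?\<chi> e = c (f d) (f e) (?\<chi> d))" for d
    using A(2) B(2) by - (erule *, assumption)+
  show ?thesis
    unfolding lift_along_def
  proof (intro ballI)
    fix d assume "d \<in> A \<union> B"
    obtain U where U: "open U" "d \<in> U" "\<forall>e\<in>U \<inter> A. ?\<chi> e = c (f d) (f e) (?\<chi> d)"
      using ex(1)[of d] by (elim exE conjE)
    obtain V where V: "open V" "d \<in> V" "\<forall>e\<in>V \<inter> B. ?\<chi> e = c (f d) (f e) (?\<chi> d)"
      using ex(2)[of d] by (elim exE conjE)
    have "?\<chi> e = c (f d) (f e) (?\<chi> d)" if "e \<in> (U \<inter> V) \<inter> (A \<union> B)" for e
      using that U(3) V(3) by blast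
    then show "\<exists>U. open U \<and> d \<in> U \<and> (\<forall>e\<in>U \<inter> (A \<union> B). ?\<chi> e = c (f d) (f e) (?\<chi> d))"
      using U(1,2) V(1,2) by (intro exI[of _ "U \<inter> V"] conjI open_Int) auto
  qed
qed

lemma transports_join:
  assumes f: "transports c f w w'" and g: "transports c g w' w''" and "pathfinish f = pathstart g"
  shows "transports c (f +++ g) w w''"
proof -
  obtain \<phi> where \<phi>: "lift_along c {0..1} f \<phi>" "\<phi> 0 = w" "\<phi> 1 = w'"
    using f by (auto simp: transports_def)
  obtain \<psi> where \<psi>: "lift_along c {0..1} g \<psi>" "\<psi> 0 = w'" "\<psi> 1 = w''"
    using g by (auto simp: transports_def)
  have "lift_along c {0..1/2} (f \<circ> (\<lambda>t. 2 * t)) (\<phi> \<circ> (\<lambda>t. 2 * t))"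
    by (rule lift_along_pullback[OF \<phi>(1)]) (auto intro!: continuous_intros)
  then have 1: "lift_along c {0..1/2} (f +++ g) (\<phi> \<circ> (\<lambda>t. 2 * t))"
    by (rule lift_along_cong) (auto simp: joinpaths_def)
  have "lift_along c {1/2..1} (g \<circ> (\<lambda>t. 2 * t - 1)) (\<psi> \<circ> (\<lambda>t. 2 * t - 1))"
    by (rule lift_along_pullback[OF \<psi>(1)]) (auto intro!: continuous_intros)
  then have 2: "lift_along c {1/2..1} (f +++ g) (\<psi> \<circ> (\<lambda>t. 2 * t - 1))"
  proof (rule lift_along_cong)
    fix d :: real assume "d \<in> {1/2..1}"
    then show "(g \<circ> (\<lambda>t. 2 * t - 1)) d = (f +++ g) d"
      using assms(3) by (cases "d = 1/2") (auto simp: joinpaths_def pathstart_def pathfinish_def field_simps)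
  qed simp
  have "lift_along c ({0..1/2} \<union> {1/2..1}) (f +++ g)
     (\<lambda>d. if d \<in> {0..1/2} then (\<phi> \<circ> (\<lambda>t. 2 * t)) d else (\<psi> \<circ> (\<lambda>t. 2 * t - 1)) d)"
  proof (rule lift_along_Un[OF 1 _ 2])
    fix d :: real assume "d \<in> {0..1 / 2} \<inter> {1 / 2..1}"
    then have "2 * d = 1" by auto
    then show "(\<phi> \<circ> (\<lambda>t. 2 * t)) d = (\<psi> \<circ> (\<lambda>t. 2 * t - 1)) d"
      unfolding comp_def using \<phi>(3) \<psi>(2) by (simp only: diff_self)
  qed auto
  moreover have "{0..1/2} \<union> {1/2..1} = {0..1::real}" by auto
  ultimately show ?thesis
    unfolding transports_def using \<phi> \<psi> by force
qed

lemma transports_reverse: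
  assumes "transports c f w w'"
  shows "transports c (reversepath f) w' w"
proof -
  obtain \<phi> where \<phi>: "lift_along c {0..1} f \<phi>" "\<phi> 0 = w" "\<phi> 1 = w'"
    using assms by (auto simp: transports_def)
  have "lift_along c {0..1} (f \<circ> (\<lambda>t. 1 - t)) (\<phi> \<circ> (\<lambda>t. 1 - t))"
    by (rule lift_along_pullback[OF \<phi>(1)]) (auto intro!: continuous_intros)
  then show ?thesis
    unfolding transports_def using \<phi> by (auto simp: reversepath_def o_def)
qed

text \<open>A cocycle law on small sets only: the failure of the law around a long loop is the
  holonomy that will separate words. Taking \<open>u = y\<close> in the law and using
  \<open>trans_id\<close> shows that local comparison is invertible.\<close>

locale transport =
  fixes X :: "'b::topological_space set" and c :: "'b \<Rightarrow> 'b \<Rightarrow> 'r \<Rightarrow> 'r"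
  assumes trans_id: "x \<in> X \<Longrightarrow> c x x w = w"
    and trans_local: "x \<in> X \<Longrightarrow>
      \<exists>N. open N \<and> x \<in> N \<and> (\<forall>y\<in>N \<inter> X. \<forall>z\<in>N \<inter> X. \<forall>u\<in>N \<inter> X. \<forall>w. c z u (c y z w) = c y u w)"
begin

lemma transports_const: "x \<in> X \<Longrightarrow> transports c (\<lambda>_. x) w w"
  unfolding transports_def lift_along_def using trans_id by (intro exI[of _ "\<lambda>_. w"]) auto

text \<open>Near each parameter both lifts arise from their values there by the same injective map,
  so whether they agree is locally constant on the connected set \<open>D\<close>.\<close>

lemma lift_along_unique:
  assumes D: "connected D" and f: "continuous_on D f" "f ` D \<subseteq> X"
    and "lift_along c D f \<phi>" "lift_along c D f \<psi>" "d0 \<in> D" "\<phi> d0 = \<psi> d0" "d \<in> D"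
  shows "\<phi> d = \<psi> d"
proof -
  have "(\<lambda>d. \<phi> d = \<psi> d) constant_on D"
  proof (rule locally_constant_imp_constant[OF D])
    fix d assume d: "d \<in> D"
    then have "f d \<in> X" using f by auto
    then obtain N where N: "open N" "f d \<in> N"
        "\<forall>y\<in>N \<inter> X. \<forall>z\<in>N \<inter> X. \<forall>u\<in>N \<inter> X. \<forall>w. c z u (c y z w) = c y u w"
      using trans_local by meson
    obtain U where U: "open U" "d \<in> U" "\<forall>e\<in>U \<inter> D. \<phi> e = c (f d) (f e) (\<phi> d)"
      using assms(4) d unfolding lift_along_def by blast
    obtain V where V: "open V" "d \<in> V" "\<forall>e\<in>V \<inter> D. \<psi> e = c (f d) (f e) (\<psi> d)"
      using assms(5) d unfolding lift_along_def by blast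
    obtain W where W: "open W" "W \<inter> D = f -` N \<inter> D"
      using f(1) N(1) unfolding continuous_on_open_invariant by blast
    have dW: "d \<in> W" using W N d by auto
    have "(\<phi> e = \<psi> e) = (\<phi> d = \<psi> d)" if "e \<in> U \<inter> V \<inter> W \<inter> D" for e
    proof -
      have "f e \<in> N \<inter> X" using that W f by auto
      with N d f have "c (f e) (f d) (c (f d) (f e) w) = w" for w
        using trans_id by (metis \<open>f d \<in> X\<close> IntI)
      moreover have "\<phi> e = c (f d) (f e) (\<phi> d)" "\<psi> e = c (f d) (f e) (\<psi> d)"
        using that U V by auto
      ultimately show ?thesis by metis
    qed
    moreover have "openin (top_of_set D) (U \<inter> V \<inter> W \<inter> D)"
      using U V W by (metis inf_commute open_Int openin_open_Int)
    ultimately show "\<exists>T. openin (top_of_set D) T \<and> d \<in> T \<and> (\<forall>e\<in>T. (\<phi> e = \<psi> e) = (\<phi> d = \<psi> d))"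
      using U V dW d by blast
  qed
  then show ?thesis
    using assms unfolding constant_on_def by metis
qed

definition liftable :: "'d::topological_space set \<Rightarrow> ('d \<Rightarrow> 'b) \<Rightarrow> bool" where
  "liftable D f \<longleftrightarrow> (\<forall>d\<in>D. \<forall>w. \<exists>\<phi>. lift_along c D f \<phi> \<and> \<phi> d = w)"

text \<open>Where the cocycle law holds throughout, comparison with one fixed parameter is itself a
  lift.\<close>

lemma liftable_local:
  assumes "f ` D \<subseteq> N \<inter> X"
    "\<forall>y\<in>N \<inter> X. \<forall>z\<in>N \<inter> X. \<forall>u\<in>N \<inter> X. \<forall>w. c z u (c y z w) = c y u w"
  shows "liftable D f"
  unfolding liftable_def
proof (intro ballI allI)
  fix d w assume "d \<in> D"
  then have fd: "f e \<in> N \<inter> X" if "e \<in> D" for e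
    using assms(1) that by auto
  have "lift_along c D f (\<lambda>e. c (f d) (f e) w)"
    unfolding lift_along_def
  proof (intro ballI exI[of _ UNIV] conjI)
    fix d' e assume "d' \<in> D" "e \<in> UNIV \<inter> D"
    then show "c (f d) (f e) w = c (f d') (f e) (c (f d) (f d') w)"
      using assms(2) fd \<open>d \<in> D\<close> by auto
  qed auto
  moreover have "c (f d) (f d) w = w"
    using trans_id fd[OF \<open>d \<in> D\<close>] by auto
  ultimately show "\<exists>\<phi>. lift_along c D f \<phi> \<and> \<phi> d = w" by metis
qed

text \<open>A lift over one piece is continued over the other from a common parameter; since the
  overlap is connected, uniqueness makes the two lifts agree on all of it.\<close>

lemma liftable_Un:
  assumes f: "continuous_on (A \<union> B) f" "f ` (A \<union> B) \<subseteq> X"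
    and "closed A" "closed B" "liftable A f" "liftable B f" and AB: "connected (A \<inter> B)" "A \<inter> B \<noteq> {}"
  shows "liftable (A \<union> B) f"
proof -
  have *: "\<exists>\<phi>. lift_along c (A \<union> B) f \<phi> \<and> \<phi> d = w"
    if d: "d \<in> A" and f: "continuous_on (A \<union> B) f" "f ` (A \<union> B) \<subseteq> X"
     and AB: "closed A" "closed B" "liftable A f" "liftable B f" "connected (A \<inter> B)" "A \<inter> B \<noteq> {}"
    for A B d w
  proof -
    obtain m where m: "m \<in> A" "m \<in> B" using AB(6) by blast
    have "\<exists>\<phi>. lift_along c A f \<phi> \<and> \<phi> d = w"
      using AB(3) d by (simp add: liftable_def)
    then obtain \<phi> where \<phi>: "lift_along c A f \<phi>" "\<phi> d = w"
      by (elim exE conjE)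
    have "\<exists>\<psi>. lift_along c B f \<psi> \<and> \<psi> m = \<phi> m"
      using AB(4) m(2) by (simp add: liftable_def)
    then obtain \<psi> where \<psi>: "lift_along c B f \<psi>" "\<psi> m = \<phi> m"
      by (elim exE conjE)
    have "lift_along c (A \<union> B) f (\<lambda>d. if d \<in> A then \<phi> d else \<psi> d)"
    proof (rule lift_along_Un[OF \<phi>(1) AB(1) \<psi>(1) AB(2)])
      fix e assume "e \<in> A \<inter> B"
      with AB(5) show "\<phi> e = \<psi> e"
        using f(2) m \<psi>(2) continuous_on_subset[OF f(1), of "A \<inter> B"]
          lift_along_subset[OF \<phi>(1), of "A \<inter> B"] lift_along_subset[OF \<psi>(1), of "A \<inter> B"]
        by (intro lift_along_unique[of "A \<inter> B" f \<phi> \<psi> m e]) (auto simp: le_infI1)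
    qed
    then show ?thesis using d \<phi>(2) by (intro exI[of _ "\<lambda>d. if d \<in> A then \<phi> d else \<psi> d"]) simp
  qed
  show ?thesis
    unfolding liftable_def
  proof (intro ballI allI)
    fix d w assume "d \<in> A \<union> B"
    then show "\<exists>\<phi>. lift_along c (A \<union> B) f \<phi> \<and> \<phi> d = w"
      using *[of d A B w] *[of d B A w] assms unfolding Un_commute[of B A] Int_commute[of B A] by blast
  qed
qed

text \<open>Two bisections: \<open>Bolzano\<close> in the second coordinate gives strips of positive
  width around each \<open>s\<close>, and \<open>Bolzano\<close> in the first coordinate glues the
  strips. All overlaps are segments, hence connected. The map is given on the whole plane because
  the short intervals of \<open>Bolzano\<close> may protrude beyond \<open>{0..1}\<close>.\<close>

lemma liftable_rectangle:
  fixes f :: "real \<times> real \<Rightarrow> 'b"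
  assumes f: "continuous_on UNIV f" "range f \<subseteq> X"
  shows "liftable ({0..1} \<times> {0..1}) f"
proof -
  have glue: "liftable (A \<union> B) f" if "liftable A f" "liftable B f" "closed A" "closed B"
    "connected (A \<inter> B)" "A \<inter> B \<noteq> {}" for A B
    using that f(2) continuous_on_subset[OF f(1)] by (intro liftable_Un) auto
  have strip: "\<exists>\<delta>>0. \<forall>a b. a \<le> s \<and> s \<le> b \<and> b - a < \<delta> \<longrightarrow> liftable ({a..b} \<times> {0..1}) f" for s
  proof -
    let ?P = "\<lambda>c d. c \<le> d \<longrightarrow> (\<exists>\<delta>>0. \<forall>a b. a \<le> s \<and> s \<le> b \<and> b - a < \<delta> \<longrightarrow> liftable ({a..b} \<times> {c..d}) f)"
    have "?P 0 1"
    proof (rule Bolzano[where P = ?P])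
      fix p q r :: real
      assume pq: "?P p q" and qr: "?P q r" and le: "p \<le> q" "q \<le> r"
      obtain \<delta> \<delta>' where d: "\<delta> > 0" "\<And>a b. a \<le> s \<Longrightarrow> s \<le> b \<Longrightarrow> b - a < \<delta> \<Longrightarrow> liftable ({a..b} \<times> {p..q}) f"
        and d': "\<delta>' > 0" "\<And>a b. a \<le> s \<Longrightarrow> s \<le> b \<Longrightarrow> b - a < \<delta>' \<Longrightarrow> liftable ({a..b} \<times> {q..r}) f"
        using pq qr le by blast
      have "liftable ({a..b} \<times> {p..r}) f" if "a \<le> s" "s \<le> b" "b - a < min \<delta> \<delta>'" for a b
      proof -
        have "{p..q} \<inter> {q..r} = {q}" and pr: "{p..r} = {p..q} \<union> {q..r}"
          using le by auto
        then have eq: "({a..b} \<times> {p..q}) \<inter> ({a..b} \<times> {q..r}) = {a..b} \<times> {q}"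
          by blast
        show ?thesis
          unfolding pr Sigma_Un_distrib2 using that d(2)[of a b] d'(2)[of a b] 
          by (intro glue) (auto simp: eq intro!: closed_Times connected_Times)
      qed
      then show "?P p r"
        using d(1) d'(1) by (intro impI exI[of _ "min \<delta> \<delta>'"]) auto
    next
      fix t :: real
      have "f (s, t) \<in> X" using f by auto
      then obtain N where N: "open N" "f (s,t) \<in> N"
          "\<forall>y\<in>N \<inter> X. \<forall>z\<in>N \<inter> X. \<forall>u\<in>N \<inter> X. \<forall>w. c z u (c y z w) = c y u w"
        using trans_local by meson
      have "open (f -` N)" using f(1) N(1) by (simp add: open_vimage)
      then have "\<exists>A B. open A \<and> open B \<and> (s, t) \<in> A \<times> B \<and> A \<times> B \<subseteq> f -` N"
        using N(2) by (auto elim!: open_prod_elim)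
      then obtain A B where AB: "open A" "s \<in> A" "open B" "t \<in> B" "A \<times> B \<subseteq> f -` N"
        by blast
      obtain e1 where e1: "e1 > 0" "ball s e1 \<subseteq> A" using AB open_contains_ball by blast
      obtain e2 where e2: "e2 > 0" "ball t e2 \<subseteq> B" using AB open_contains_ball by blast
      have "liftable ({a..b} \<times> {p..q}) f"
        if "a \<le> s" "s \<le> b" "b - a < e1" "p \<le> t" "t \<le> q" "q - p < e2" for a b p q
      proof (rule liftable_local)
        have "{a..b} \<subseteq> A" "{p..q} \<subseteq> B"
          using that e1(2) e2(2) by (auto simp: subset_iff dist_real_def)
        then show "f ` ({a..b} \<times> {p..q}) \<subseteq> N \<inter> X"
          using AB(5) f(2) by blast
      qed (rule N(3))
      then show "\<exists>d>0. \<forall>a b. a \<le> t \<and> t \<le> b \<and> b - a < d \<longrightarrow> ?P a b"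
        using e1(1) e2(1) by (intro exI[of _ e2] exI[of _ e1] conjI allI impI) auto
    qed simp
    then show ?thesis by simp
  qed
  let ?P = "\<lambda>a b. a \<le> b \<longrightarrow> liftable ({a..b} \<times> {0..1}) f"
  have "?P 0 1"
  proof (rule Bolzano[where P = ?P])
    fix p q r :: real
    assume pq: "?P p q" and qr: "?P q r" and le: "p \<le> q" "q \<le> r"
    have "{p..q} \<inter> {q..r} = {q}" and pr: "{p..r} = {p..q} \<union> {q..r}"
      using le by auto
    then have eq: "({p..q} \<times> {0..1::real}) \<inter> ({q..r} \<times> {0..1}) = {q} \<times> {0..1}"
      by blast
    show "?P p r"
      unfolding pr Sigma_Un_distrib1 using pq qr le
      by (intro impI glue) (auto simp: eq intro!: closed_Times connected_Times)
  next
    fix s :: real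
    show "\<exists>d>0. \<forall>a b. a \<le> s \<and> s \<le> b \<and> b - a < d \<longrightarrow> ?P a b"
      using strip[of s] by blast
  qed simp
  then show ?thesis by simp
qed

lemma lift_along_constant:
  assumes "lift_along c {0..1::real} f \<phi>" "x \<in> X" "\<And>t. t \<in> {0..1} \<Longrightarrow> f t = x"
  shows "\<phi> 1 = \<phi> 0"
proof -
  have "lift_along c {0..1} f (\<lambda>_. \<phi> 0)"
    unfolding lift_along_def using assms trans_id by (auto intro!: exI[of _ UNIV])
  moreover have "continuous_on {0..1} f"
    using assms(3) continuous_on_cong[of "{0..1}" "{0..1}" f "\<lambda>_. x"] by simp
  ultimately show ?thesis
    using assms lift_along_unique[of "{0..1}" f \<phi> "\<lambda>_. \<phi> 0" 0 1] by auto
qed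

text \<open>The homotopy is lifted over the square, starting from \<open>w\<close>. On the two sides
  where it keeps the ends of the paths fixed the lift is constant; over the other two sides
  uniqueness identifies it with the given transports.\<close>

theorem transports_homotopic:
  assumes h: "homotopic_paths X f g" and f: "transports c f w w1" and g: "transports c g w w2"
  shows "w1 = w2"
proof -
  obtain h where h: "continuous_on ({0..1} \<times> {0..1}) h" "h \<in> ({0..1} \<times> {0..1}) \<rightarrow> X"
     "\<And>x. x \<in> {0..1} \<Longrightarrow> h (0,x) = f x" "\<And>x. x \<in> {0..1} \<Longrightarrow> h (1,x) = g x"
     "\<And>t. t \<in> {0..1::real} \<Longrightarrow> h (t,0) = f 0" "\<And>t. t \<in> {0..1::real} \<Longrightarrow> h (t,1) = f 1"
    using h unfolding homotopic_paths by (auto simp: pathstart_def pathfinish_def)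
  \<comment> \<open>Clamping to the unit square extends the homotopy continuously to the plane, as
    \<open>liftable_rectangle\<close> requires.\<close>
  define k where "k = (\<lambda>p. (max 0 (min 1 (fst p)), max 0 (min 1 (snd p))) :: real \<times> real)"
  have k: "continuous_on UNIV k" "range k \<subseteq> {0..1} \<times> {0..1}"
    by (auto simp: k_def intro!: continuous_intros)
  have kid: "k (s,t) = (s,t)" if "s \<in> {0..1}" "t \<in> {0..1}" for s t
    using that by (auto simp: k_def)
  have hk: "continuous_on UNIV (h \<circ> k)"
    using k by (intro continuous_on_compose continuous_on_subset[OF h(1)])
  have hk': "range (h \<circ> k) \<subseteq> X"
  proof (rule image_subsetI)
    fix p :: "real \<times> real"
    have "k p \<in> {0..1} \<times> {0..1}" using k(2) by blast
    then show "(h \<circ> k) p \<in> X" using Pi_mem[OF h(2)] by simp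
  qed
  have "(0,0) \<in> {0..1::real} \<times> {0..1::real}" by simp
  then obtain \<Phi> where \<Phi>: "lift_along c ({0..1} \<times> {0..1}) (h \<circ> k) \<Phi>" "\<Phi> (0,0) = w"
    using liftable_rectangle[OF hk hk'] unfolding liftable_def by blast
  have pull: "lift_along c {0..1} f' (\<Phi> \<circ> j)"
    if "continuous_on {0..1::real} j" "j ` {0..1} \<subseteq> {0..1} \<times> {0..1}"
      "\<And>t. t \<in> {0..1} \<Longrightarrow> h (j t) = f' t" for j f'
  proof (rule lift_along_cong[OF lift_along_pullback[OF \<Phi>(1) that(1,2)]])
    fix t :: real assume t: "t \<in> {0..1}"
    then have "j t \<in> {0..1} \<times> {0..1}" using that(2) by blast
    then have "k (j t) = j t" using kid[of "fst (j t)" "snd (j t)"] by (simp add: mem_Times_iff)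
    then show "(h \<circ> k \<circ> j) t = f' t" using that(3)[OF t] by simp
  qed simp
  have X: "f 0 \<in> X" "f 1 \<in> X" using Pi_mem[OF h(2), of "(0,0)"] Pi_mem[OF h(2), of "(0,1)"] h(3)[of 0] h(3)[of 1] by simp_all
  have "\<Phi> (1,0) = \<Phi> (0,0)" 
  proof -
    have "lift_along c {0..1} (\<lambda>_. f 0) (\<Phi> \<circ> (\<lambda>s. (s,0)))"
      using h(5) by (intro pull) (auto intro!: continuous_intros)
    from lift_along_constant[OF this X(1)] show ?thesis by simp
  qed
  have "\<Phi> (1,1) = \<Phi> (0,1)" 
  proof -
    have "lift_along c {0..1} (\<lambda>_. f 1) (\<Phi> \<circ> (\<lambda>s. (s,1)))"
      using h(6) by (intro pull) (auto intro!: continuous_intros)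
    from lift_along_constant[OF this X(2)] show ?thesis by simp
  qed
  have uniq: "\<Phi> (s,1) = w'" if hyp: "s = 0 \<or> s = 1" "transports c f' w w'" "\<And>x. x \<in> {0..1} \<Longrightarrow> h (s,x) = f' x" for s w' f'
  proof -
    obtain \<phi> where \<phi>: "lift_along c {0..1} f' \<phi>" "\<phi> 0 = w" "\<phi> 1 = w'"
      using hyp(2) by (auto simp: transports_def)
    have l: "lift_along c {0..1} f' (\<Phi> \<circ> (\<lambda>t. (s,t)))"
      using that by (intro pull) (auto intro!: continuous_intros)
    have "continuous_on {0..1} (h \<circ> (\<lambda>t. (s,t)))"
      using that(1) by (intro continuous_on_compose continuous_intros continuous_on_subset[OF h(1)]) auto
    then have "continuous_on {0..1} f'"
      using that(3) continuous_on_cong[of "{0..1}" "{0..1}" "h \<circ> (\<lambda>t. (s,t))" f'] by simp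
    moreover have "f' ` {0..1} \<subseteq> X"
    proof (rule image_subsetI)
      fix t :: real assume "t \<in> {0..1}"
      then show "f' t \<in> X" using Pi_mem[OF h(2), of "(s,t)"] that(1,3) by auto
    qed
    ultimately have "(\<Phi> \<circ> (\<lambda>t. (s,t))) 1 = \<phi> 1"
      using \<Phi>(2) \<open>\<Phi> (1,0) = \<Phi> (0,0)\<close> \<phi> that(1) by (intro lift_along_unique[OF _ _ _ l \<phi>(1), of 0 1]) auto
    then show ?thesis using \<phi> by simp
  qed
  show ?thesis
    using uniq[of 0 f w1] uniq[of 1 g w2] f g h(3,4) \<open>\<Phi> (1,1) = \<Phi> (0,1)\<close> by simp
qed

end

section \<open>Words and free groups\<close>

lemma word_value_Nil [simp]: "word_value G [] = \<one>\<^bsub>G\<^esub>"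
  by (simp add: word_value_def)

lemma word_value_Cons [simp]:
  "word_value G ((s, e) # w) = (if e then s else inv\<^bsub>G\<^esub> s) \<otimes>\<^bsub>G\<^esub> word_value G w"
  by (simp add: word_value_def)

context group
begin

lemma word_value_closed: "set w \<subseteq> S \<times> UNIV \<Longrightarrow> S \<subseteq> carrier G \<Longrightarrow> word_value G w \<in> carrier G"
  by (induction w) auto

lemma word_value_append:
  assumes "S \<subseteq> carrier G" "set w \<subseteq> S \<times> UNIV" "set w' \<subseteq> S \<times> UNIV"
  shows "word_value G (w @ w') = word_value G w \<otimes> word_value G w'"
  using assms(2)
proof (induction w)
  case (Cons l w)
  then have "set w \<subseteq> S \<times> UNIV" "fst l \<in> carrier G" using assms(1) by auto
  with Cons show ?case
    using assms word_value_closed[of w S] word_value_closed[of w' S]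
    by (cases l) (simp add: m_assoc)
qed (use assms word_value_closed in auto)

end

text \<open>Left multiplication by a letter, in the model of the free group by reduced words. By the
  cancellation law below, each letter permutes the reduced words.\<close>

fun reduce_Cons :: "'a \<times> bool \<Rightarrow> ('a \<times> bool) list \<Rightarrow> ('a \<times> bool) list" where
  "reduce_Cons l [] = [l]"
| "reduce_Cons l (m # w) = (if fst l = fst m \<and> snd l \<noteq> snd m then w else l # m # w)"

lemma reduced_words_Nil [simp]: "[] \<in> reduced_words S"
  by (simp add: reduced_words_def)

lemma reduced_words_Cons: "l # w \<in> reduced_words S \<longleftrightarrow>
    fst l \<in> S \<and> w \<in> reduced_words S \<and> (w = [] \<or> \<not> (fst l = fst (hd w) \<and> snd l \<noteq> snd (hd w)))"
  by (cases l) (auto simp: reduced_words_def successively_Cons)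

lemma reduce_Cons_reduced: "fst l \<in> S \<Longrightarrow> w \<in> reduced_words S \<Longrightarrow> reduce_Cons l w \<in> reduced_words S"
  by (cases w) (auto simp: reduced_words_Cons)

lemma reduce_Cons_cancel:
  assumes "w \<in> reduced_words S"
  shows "reduce_Cons (s, \<not> e) (reduce_Cons (s, e) w) = w"
proof (cases w)
  case (Cons m v)
  then show ?thesis
    using assms by (cases v; cases m) (auto simp: reduced_words_Cons)
qed simp

lemma reduce_Cons_reduced_word: "l # w \<in> reduced_words S \<Longrightarrow> reduce_Cons l w = l # w"
  by (cases w) (auto simp: reduced_words_Cons)

text \<open>Transport along the loop of a word returns the word reversed, so the final comparison
  needs reducedness to be invariant under reversal.\<close>

lemma rev_reduced_words: "rev w \<in> reduced_words S \<longleftrightarrow> w \<in> reduced_words S"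
proof -
  have "successively (\<lambda>x y. \<not> (fst y = fst x \<and> snd y \<noteq> snd x)) w
      \<longleftrightarrow> successively (\<lambda>x y. \<not> (fst x = fst y \<and> snd x \<noteq> snd y)) w"
    by (intro arg_cong[where f = "\<lambda>P. successively P w"]) (auto simp: fun_eq_iff)
  then show ?thesis
    unfolding reduced_words_def successively_rev set_rev mem_Collect_eq by (simp only:)
qed

lemma (in group) word_value_reduce_Cons:
  assumes S: "S \<subseteq> carrier G" and "s \<in> S" "set w \<subseteq> S \<times> UNIV"
  shows "word_value G (reduce_Cons (s, e) w) = (if e then s else inv s) \<otimes> word_value G w"
proof (cases w)
  case (Cons m v)
  obtain t d where m: "m = (t, d)" by force
  have "t \<in> carrier G" "s \<in> carrier G" "word_value G v \<in> carrier G"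
    using assms Cons m word_value_closed[of v S] by auto
  then show ?thesis
    by (auto simp: Cons m m_assoc[symmetric])
qed simp

text \<open>Letters are put in front with \<open>reduce_Cons\<close>, which does not change the
  value. It therefore suffices to generate a group by arbitrary words.\<close>

lemma (in group) word_value_reduced:
  assumes S: "S \<subseteq> carrier G" and "set w \<subseteq> S \<times> UNIV"
  shows "\<exists>v\<in>reduced_words S. word_value G v = word_value G w"
  using assms(2)
proof (induction w)
  case (Cons l w)
  obtain s e where l: "l = (s, e)" by force
  from Cons obtain v where v: "v \<in> reduced_words S" "word_value G v = word_value G w"
    by auto
  have "word_value G (reduce_Cons (s, e) v) = word_value G (l # w)"
    using Cons.prems v by (subst word_value_reduce_Cons[OF S]) (auto simp: l reduced_words_def)
  moreover have "reduce_Cons (s, e) v \<in> reduced_words S"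
    using Cons.prems v(1) l by (intro reduce_Cons_reduced) auto
  ultimately show ?case by blast
qed (auto intro: bexI[of _ "[]"])

text \<open>\<open>free_group_on\<close> takes its basis inside the group, whereas the basis of a
  graph will be indexed by edges; this mediates between the two.\<close>

lemma reduced_words_map:
  assumes "inj_on f N"
  shows "reduced_words (f ` N) = map (apfst f) ` reduced_words N"
proof -
  have *: "map (apfst f) w \<in> reduced_words (f ` N) \<longleftrightarrow> w \<in> reduced_words N"
    if "set w \<subseteq> N \<times> UNIV" for w
    using that
  proof (induction w)
    case (Cons l w)
    then show ?case
      using inj_on_eq_iff[OF assms] by (cases w) (auto simp: reduced_words_Cons)
  qed simp
  have "w \<in> map (apfst f) ` reduced_words N" if w: "w \<in> reduced_words (f ` N)" for w
  proof -
    let ?v = "map (apfst (the_inv_into N f)) w"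
    have sub: "set w \<subseteq> f ` N \<times> UNIV" using w by (simp add: reduced_words_def)
    then have "set ?v \<subseteq> N \<times> UNIV"
      using assms by (auto simp: the_inv_into_f_f)
    moreover have "map (apfst f) ?v = w"
      using sub assms by (auto simp: the_inv_into_f_f intro!: map_idI)
    ultimately show ?thesis using * w by (metis imageI)
  qed
  moreover have "map (apfst f) w \<in> reduced_words (f ` N)" if "w \<in> reduced_words N" for w
    using *[of w] that by (simp add: reduced_words_def)
  ultimately show ?thesis by blast
qed

text \<open>Words of length one show that \<open>inj\<close> forces \<open>s\<close> to be injective
  on \<open>N\<close>, so reduced words over the indices and over the generators correspond.\<close>

lemma free_groupI:
  assumes "group G" and s: "s ` N \<subseteq> carrier G"
    and inj: "\<And>w w'. w \<in> reduced_words N \<Longrightarrow> w' \<in> reduced_words N \<Longrightarrow>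
       word_value G (map (apfst s) w) = word_value G (map (apfst s) w') \<Longrightarrow> w = w'"
    and gen: "\<And>g. g \<in> carrier G \<Longrightarrow> \<exists>w. set w \<subseteq> s ` N \<times> UNIV \<and> word_value G w = g"
  shows "free_group G"
proof -
  interpret group G by fact
  have "inj_on s N"
  proof (rule inj_onI)
    fix x y assume "x \<in> N" "y \<in> N" "s x = s y"
    then have "[(x, True)] = [(y, True)]"
      by (intro inj) (auto simp: reduced_words_Cons)
    then show "x = y" by simp
  qed
  have "bij_betw (word_value G) (reduced_words (s ` N)) (carrier G)"
    unfolding bij_betw_def
  proof (intro conjI equalityI subsetI)
    show "inj_on (word_value G) (reduced_words (s ` N))"
      unfolding reduced_words_map[OF \<open>inj_on s N\<close>] using inj by (auto simp: inj_on_def)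
    fix g assume "g \<in> carrier G"
    then show "g \<in> word_value G ` reduced_words (s ` N)"
      using gen word_value_reduced[OF s] by (metis imageI)
  next
    fix g assume "g \<in> word_value G ` reduced_words (s ` N)"
    then show "g \<in> carrier G"
      using word_value_closed[OF _ s] by (auto simp: reduced_words_def)
  qed
  then show ?thesis
    unfolding free_group_def free_group_on_def using \<open>group G\<close> s by blast
qed

lemma free_group_iso:
  assumes "f \<in> iso G H" "group H" "free_group G"
  shows "free_group H"
proof -
  obtain S where S: "group G" "S \<subseteq> carrier G" "bij_betw (word_value G) (reduced_words S) (carrier G)"
    using assms(3) by (auto simp: free_group_def free_group_on_def)
  interpret G: group G by fact
  interpret H: group H by fact
  have f: "f \<in> hom G H" "bij_betw f (carrier G) (carrier H)"
    using assms(1) by (auto simp: iso_def)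
  interpret group_hom G H f
    using f by unfold_locales (auto simp: S assms)
  have *: "word_value H (map (apfst f) w) = f (word_value G w)" if "set w \<subseteq> S \<times> UNIV" for w
    using that
  proof (induction w)
    case (Cons l w)
    then have "set w \<subseteq> S \<times> UNIV" "fst l \<in> carrier G" using S by auto
    with Cons S G.word_value_closed[of w S] show ?case by (cases l) simp
  qed simp
  show ?thesis
  proof (rule free_groupI[of H f S])
    fix w w' assume w: "w \<in> reduced_words S" "w' \<in> reduced_words S"
      and "word_value H (map (apfst f) w) = word_value H (map (apfst f) w')"
    then have "f (word_value G w) = f (word_value G w')"
      using * by (simp add: reduced_words_def)
    then have "word_value G w = word_value G w'"
      using w bij_betw_apply[OF S(3)] f(2) by (auto simp: bij_betw_def dest: inj_onD)
    then show "w = w'" using w S(3) by (auto simp: bij_betw_def inj_on_def)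
  next
    fix g assume "g \<in> carrier H"
    then obtain w where "w \<in> reduced_words S" "g = f (word_value G w)"
      using S(3) f(2) unfolding bij_betw_def by (metis imageE)
    then show "\<exists>w. set w \<subseteq> f ` S \<times> UNIV \<and> word_value H w = g"
      using *[of w] by (intro exI[of _ "map (apfst f) w"]) (auto simp: reduced_words_def)
  qed (use S f in \<open>auto simp: hom_def assms\<close>)
qed

section \<open>Loops from paths\<close>

definition path_inv :: "'a::topological_space set \<Rightarrow> (real \<Rightarrow> 'a) set \<Rightarrow> (real \<Rightarrow> 'a) set" where
  "path_inv X A = (\<Union>f\<in>A. path_class X (reversepath f))"

lemma path_inv_class:
  assumes "f \<in> paths_between X a b"
  shows "path_inv X (path_class X f) = path_class X (reversepath f)"
proof -
  have "path_class X (reversepath g) = path_class X (reversepath f)" if "g \<in> path_class X f" for g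
    using that by (intro path_class_eqI[symmetric]) (simp add: path_class_def homotopic_paths_reversepath)
  moreover have "f \<in> path_class X f"
    using assms by (auto simp: path_class_def paths_between_def)
  ultimately show ?thesis unfolding path_inv_def by blast
qed

lemma path_inv:
  assumes "A \<in> path_classes X a b"
  shows "path_inv X A \<in> path_classes X b a"
    and "path_mult X A (path_inv X A) = path_class X (\<lambda>_. a)"
    and "path_mult X (path_inv X A) A = path_class X (\<lambda>_. b)"
proof -
  obtain f where A: "A = path_class X f" and f: "f \<in> paths_between X a b"
    using assms by (auto simp: path_classes_def)
  show "path_inv X A \<in> path_classes X b a"
    and "path_mult X A (path_inv X A) = path_class X (\<lambda>_. a)"
    and "path_mult X (path_inv X A) A = path_class X (\<lambda>_. b)"
    unfolding A path_inv_class[OF f] path_mult_reverse[OF f]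
    by (auto intro!: path_classI paths_between_reverse f)
qed

text \<open>\<open>Q\<close> chooses a path class from the base point to every point, with no
  continuity in the point. The trivial choice at \<open>x0\<close> makes \<open>rebase\<close> the
  identity on loops.\<close>

locale based_space =
  fixes X :: "'a::topological_space set" and x0 :: 'a and Q :: "'a \<Rightarrow> (real \<Rightarrow> 'a) set"
  assumes base: "x0 \<in> X" "Q x0 = path_class X (\<lambda>_. x0)"
    and Q: "x \<in> X \<Longrightarrow> Q x \<in> path_classes X x0 x"
begin

definition rebase :: "'a \<Rightarrow> 'a \<Rightarrow> (real \<Rightarrow> 'a) set \<Rightarrow> (real \<Rightarrow> 'a) set" where
  "rebase a b A = path_mult X (path_mult X (Q a) A) (path_inv X (Q b))"

lemma path_classes_points:
  "A \<in> path_classes X a b \<Longrightarrow> a \<in> X \<and> b \<in> X"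
  by (auto simp: path_classes_def dest: paths_betweenD)

lemma rebase_closed: "A \<in> path_classes X a b \<Longrightarrow> rebase a b A \<in> path_classes X x0 x0"
  unfolding rebase_def using path_classes_points
  by (intro path_mult_closed[of _ _ _ b] path_mult_closed[of _ _ _ a] path_inv Q) auto

lemma rebase_loop:
  assumes "A \<in> path_classes X x0 x0"
  shows "rebase x0 x0 A = A"
proof -
  have "path_inv X (Q x0) = path_class X (\<lambda>_. x0)"
    unfolding base(2) using path_inv_class[OF paths_between_const[OF base(1)]]
    by (simp add: reversepath_def)
  then show ?thesis
    unfolding rebase_def using base assms by (simp add: path_mult_one_left path_mult_one_right)
qed

lemma rebase_eq_one:
  assumes "A \<in> path_classes X a b" "path_mult X (Q a) A = Q b"
  shows "rebase a b A = path_class X (\<lambda>_. x0)"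
  unfolding rebase_def assms(2) using path_classes_points[OF assms(1)] Q path_inv(2) by blast

lemma rebase_const: "a \<in> X \<Longrightarrow> rebase a a (path_class X (\<lambda>_. a)) = path_class X (\<lambda>_. x0)"
  by (intro rebase_eq_one path_classI paths_between_const path_mult_one_right[OF Q])

lemma rebase_mult:
  assumes A: "A \<in> path_classes X a b" and B: "B \<in> path_classes X b c"
  shows "rebase a c (path_mult X A B) = path_mult X (rebase a b A) (rebase b c B)"
proof -
  note pts = path_classes_points[OF A] path_classes_points[OF B]
  note Qa = Q[OF conjunct1[OF pts(1)]] and Qb = Q[OF conjunct2[OF pts(1)]] and Qc = Q[OF conjunct2[OF pts(2)]]
  note b' = path_inv(1)[OF Qb] and c' = path_inv(1)[OF Qc]
  note QA = path_mult_closed[OF Qa A] and QB = path_mult_closed[OF Qb B] and Bc = path_mult_closed[OF B c']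
  have "path_mult X (path_inv X (Q b)) (path_mult X (path_mult X (Q b) B) (path_inv X (Q c)))
      = path_mult X B (path_inv X (Q c))"
    unfolding path_mult_assoc[OF Qb B c'] path_mult_assoc[OF b' Qb Bc, symmetric] path_inv(3)[OF Qb]
    by (rule path_mult_one_left[OF Bc])
  then show ?thesis
    unfolding rebase_def
    by (simp add: path_mult_assoc[OF QA b' path_mult_closed[OF QB c']]
        path_mult_assoc[OF QA B c', symmetric] path_mult_assoc[OF Qa A B])
qed

lemma rebase_inv:
  assumes "A \<in> path_classes X a b"
  shows "rebase b a (path_inv X A) = inv\<^bsub>fundamental_group X x0\<^esub> (rebase a b A)"
proof -
  interpret group "fundamental_group X x0" by (rule group_fundamental_group[OF base(1)])
  show ?thesis
  proof (rule inv_equality[symmetric])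
    show "rebase b a (path_inv X A) \<otimes>\<^bsub>fundamental_group X x0\<^esub> rebase a b A = \<one>\<^bsub>fundamental_group X x0\<^esub>"
      using rebase_mult[OF path_inv(1)[OF assms] assms] path_inv(3)[OF assms] rebase_const
        path_classes_points[OF assms] by simp
  qed (use assms path_inv(1)[OF assms] in \<open>auto simp: carrier_fundamental_group' intro: rebase_closed\<close>)
qed

text \<open>Bisection cuts the path into pieces inside the sets \<open>N\<close>, and
  \<open>rebase\<close> is multiplicative. With \<open>H\<close> the set of values of words, this
  reduces generation of the group to paths inside small open sets.\<close>

theorem rebase_generated:
  assumes H: "\<And>A B. A \<in> H \<Longrightarrow> B \<in> H \<Longrightarrow> path_mult X A B \<in> H"
    and loc: "\<And>x. x \<in> X \<Longrightarrow> \<exists>N. open N \<and> x \<in> N \<and>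
       (\<forall>a b f. f \<in> paths_between (X \<inter> N) a b \<longrightarrow> rebase a b (path_class X f) \<in> H)"
    and f: "f \<in> paths_between X a b"
  shows "rebase a b (path_class X f) \<in> H"
proof -
  have line: "f \<circ> linepath s t \<in> paths_between X (f s) (f t)" if "s \<in> {0..1}" "t \<in> {0..1}" for s t
    using that paths_betweenD[OF f]
    by (intro paths_between_image[of _ "{0..1}"] linepath_paths_between) auto
  \<comment> \<open>The guard makes \<open>?P\<close> vacuous on intervals that leave
    \<open>{0..1}\<close>, where nothing is known about \<open>f\<close>.\<close>
  let ?P = "\<lambda>s t. s \<le> t \<and> {s..t} \<subseteq> {0..1} \<longrightarrow> rebase (f s) (f t) (path_class X (f \<circ> linepath s t)) \<in> H"
  have "?P 0 1"
  proof (rule Bolzano[where P = ?P])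
    fix r s t :: real
    assume P: "?P r s" "?P s t" "r \<le> s" "s \<le> t"
    show "?P r t"
    proof
      assume rt: "r \<le> t \<and> {r..t} \<subseteq> {0..1}"
      then have rst: "r \<in> {0..1}" "s \<in> {0..1}" "t \<in> {0..1}" using P by auto
      have "path_class X (f \<circ> linepath r t) = path_class X ((f \<circ> linepath r s) +++ (f \<circ> linepath s t))"
        using paths_betweenD[OF f] rst by (intro path_class_line_join[of 0 1, symmetric]) auto
      also have "\<dots> = path_mult X (path_class X (f \<circ> linepath r s)) (path_class X (f \<circ> linepath s t))"
        by (rule path_mult_class[OF line line, symmetric]) (use rst in auto)
      finally have "rebase (f r) (f t) (path_class X (f \<circ> linepath r t))
         = path_mult X (rebase (f r) (f s) (path_class X (f \<circ> linepath r s)))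
             (rebase (f s) (f t) (path_class X (f \<circ> linepath s t)))"
        using rebase_mult[OF path_classI[OF line] path_classI[OF line], of r s t] rst by simp
      moreover have "{r..s} \<subseteq> {0..1}" "{s..t} \<subseteq> {0..1}" using rt P by auto
      ultimately show "rebase (f r) (f t) (path_class X (f \<circ> linepath r t)) \<in> H"
        using H P by simp
    qed
  next
    fix x :: real assume x: "0 \<le> x" "x \<le> 1"
    then have "f x \<in> X" using paths_betweenD[OF f] by auto
    then obtain N where N: "open N" "f x \<in> N"
      "\<And>a b f. f \<in> paths_between (X \<inter> N) a b \<Longrightarrow> rebase a b (path_class X f) \<in> H"
      using loc by meson
    obtain U where U: "open U" "U \<inter> {0..1} = f -` N \<inter> {0..1}"
      using paths_betweenD(8)[OF f] N(1) unfolding continuous_on_open_invariant by blast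
    have "x \<in> U \<inter> {0..1}" unfolding U(2) using x N(2) by auto
    then obtain e where e: "e > 0" "ball x e \<subseteq> U" using U(1) open_contains_ball by blast
    have "?P s t" if st: "s \<le> x" "x \<le> t" "t - s < e" for s t
    proof
      assume *: "s \<le> t \<and> {s..t} \<subseteq> {0..1}"
      have "{s..t} \<subseteq> ball x e" using st by (auto simp: dist_real_def)
      with e * have sub: "{s..t} \<subseteq> U \<inter> {0..1}" by blast
      have img: "f ` {s..t} \<subseteq> X \<inter> N"
      proof (rule image_subsetI)
        fix y assume "y \<in> {s..t}"
        then have "y \<in> f -` N \<inter> {0..1}" using sub U(2) by blast
        then show "f y \<in> X \<inter> N" using paths_betweenD(5)[OF f] by auto
      qed
      have "continuous_on {s..t} f"
        by (rule continuous_on_subset[OF paths_betweenD(8)[OF f] conjunct2[OF *]])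
      then have "f \<circ> linepath s t \<in> paths_between (X \<inter> N) (f s) (f t)"
        using * by (intro paths_between_image[of _ "{s..t}"] linepath_paths_between img) auto
      then show "rebase (f s) (f t) (path_class X (f \<circ> linepath s t)) \<in> H"
        by (rule N(3))
    qed
    then show "\<exists>d>0. \<forall>s t. s \<le> x \<and> x \<le> t \<and> t - s < d \<longrightarrow> ?P s t"
      using e(1) by blast
  qed simp
  then show ?thesis
    using paths_betweenD[OF f] by (simp add: path_compose_linepath_01)
qed

end

section \<open>Geometry of the realization\<close>

definition support :: "('a \<Rightarrow> real) \<Rightarrow> 'a set" where
  "support x = {v. x v \<noteq> 0}"

definition simplex_points :: "'a set \<Rightarrow> ('a \<Rightarrow> real) set" where
  "simplex_points \<sigma> = {x. (\<forall>v. 0 \<le> x v) \<and> support x \<subseteq> \<sigma> \<and> sum x \<sigma> = 1}"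

definition vertex_point :: "'a \<Rightarrow> 'a \<Rightarrow> real" where
  "vertex_point a = (\<lambda>v. if v = a then 1 else 0)"

text \<open>The affine segment, written by coordinates because only the product topology of
  \<open>'a \<Rightarrow> real\<close> enters.\<close>

definition segment_path :: "('a \<Rightarrow> real) \<Rightarrow> ('a \<Rightarrow> real) \<Rightarrow> real \<Rightarrow> 'a \<Rightarrow> real" where
  "segment_path x y t = (\<lambda>v. (1 - t) * x v + t * y v)"

lemma segment_path_simps [simp]:
  "segment_path x y 0 = x" "segment_path x y 1 = y" "segment_path x x t = x"
  by (auto simp: segment_path_def algebra_simps)

lemma reversepath_segment_path: "reversepath (segment_path x y) = segment_path y x"
  by (auto simp: segment_path_def reversepath_def fun_eq_iff)

lemma support_vertex_point [simp]: "support (vertex_point a) = {a}"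
  by (auto simp: support_def vertex_point_def)

lemma abstract_complexD:
  assumes "abstract_complex K" "\<sigma> \<in> K"
  shows "finite \<sigma>" "\<sigma> \<noteq> {}" "\<tau> \<subseteq> \<sigma> \<Longrightarrow> \<tau> \<noteq> {} \<Longrightarrow> \<tau> \<in> K"
  using assms unfolding abstract_complex_def by blast+

lemma simplex_points_subset_realization:
  assumes "abstract_complex K" "\<sigma> \<in> K"
  shows "simplex_points \<sigma> \<subseteq> realization K"
proof
  fix x assume x: "x \<in> simplex_points \<sigma>"
  have fin: "finite \<sigma>" using abstract_complexD[OF assms] by simp
  have sum: "sum x (support x) = sum x \<sigma>"
    using x fin by (intro sum.mono_neutral_left) (auto simp: simplex_points_def support_def)
  then have "support x \<noteq> {}" using x by (auto simp: simplex_points_def)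
  then have "support x \<in> K"
    using abstract_complexD(3)[OF assms] x by (auto simp: simplex_points_def)
  then show "x \<in> realization K"
    using x sum by (auto simp: realization_def simplex_points_def support_def)
qed

lemma realizationD:
  assumes "x \<in> realization K"
  shows "support x \<in> K" "x \<in> simplex_points (support x)" "0 \<le> x v"
  using assms by (auto simp: realization_def simplex_points_def support_def)

lemma simplex_points_mono: "\<sigma> \<subseteq> \<tau> \<Longrightarrow> finite \<tau> \<Longrightarrow> simplex_points \<sigma> \<subseteq> simplex_points \<tau>"
proof
  fix x assume "\<sigma> \<subseteq> \<tau>" "finite \<tau>" "x \<in> simplex_points \<sigma>"
  moreover from this have "sum x \<sigma> = sum x \<tau>"
    by (intro sum.mono_neutral_left) (auto simp: simplex_points_def support_def)
  ultimately show "x \<in> simplex_points \<tau>" by (auto simp: simplex_points_def)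
qed

lemma vertex_point_in_simplex: "a \<in> \<sigma> \<Longrightarrow> finite \<sigma> \<Longrightarrow> vertex_point a \<in> simplex_points \<sigma>"
  by (auto simp: simplex_points_def) (auto simp: vertex_point_def)

lemma segment_in_simplex:
  assumes "x \<in> simplex_points \<sigma>" "y \<in> simplex_points \<sigma>" "0 \<le> t" "t \<le> 1"
  shows "segment_path x y t \<in> simplex_points \<sigma>"
proof -
  have "sum (segment_path x y t) \<sigma> = (1 - t) * sum x \<sigma> + t * sum y \<sigma>"
    by (simp add: segment_path_def sum.distrib sum_distrib_left)
  moreover have "x v = 0" "y v = 0" if "v \<notin> \<sigma>" for v
    using assms(1,2) that by (auto simp: simplex_points_def support_def)
  then have "support (segment_path x y t) \<subseteq> \<sigma>"
    unfolding support_def segment_path_def by force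
  moreover have "0 \<le> segment_path x y t v" for v
    using assms unfolding simplex_points_def segment_path_def by simp
  ultimately show ?thesis
    using assms(1,2) unfolding simplex_points_def by simp
qed

lemma continuous_on_coordinate:
  fixes f :: "'d::topological_space \<Rightarrow> 'a \<Rightarrow> real"
  shows "continuous_on D f \<Longrightarrow> continuous_on D (\<lambda>d. f d v)"
  by (rule continuous_on_product_then_coordinatewise)

lemma continuous_on_segment_path:
  fixes f g :: "'d::topological_space \<Rightarrow> 'a \<Rightarrow> real"
  assumes "continuous_on D f" "continuous_on D g" "continuous_on D h"
  shows "continuous_on D (\<lambda>d. segment_path (f d) (g d) (h d))"
  unfolding segment_path_def
proof (rule continuous_on_coordinatewise_then_product)
  fix v
  show "continuous_on D (\<lambda>d. (1 - h d) * f d v + h d * g d v)"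
    using continuous_on_coordinate[OF assms(1)] continuous_on_coordinate[OF assms(2)] assms(3)
    by (intro continuous_on_add continuous_on_mult continuous_on_diff continuous_on_const)
qed

lemma continuous_on_segment_path': "continuous_on A (segment_path x y)"
  using continuous_on_segment_path[of A "\<lambda>_. x" "\<lambda>_. y" "\<lambda>t. t"] by (simp add: continuous_on_id)

text \<open>For \<open>c = 0\<close> these sets cut out the open stars of vertices, the
  neighbourhoods for transport and for generation; for \<open>c = 1/2\<close> they cut out smaller
  stars that are disjoint, as homology needs.\<close>

lemma open_coordinate_gt: "open {x :: 'a \<Rightarrow> real. c < x v}"
  by (intro open_Collect_less continuous_on_const continuous_on_product_coordinates)

text \<open>The segments from the points of \<open>f\<close> to \<open>z\<close> sweep out a square
  whose side at \<open>s = 1\<close> is constantly \<open>z\<close>, so one factor of the square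
  relation drops out.\<close>

lemma path_class_cone:
  assumes f: "f \<in> paths_between X a b"
    and cone: "\<And>s t. s \<in> {0..1} \<Longrightarrow> t \<in> {0..1} \<Longrightarrow> segment_path (f t) z s \<in> X"
  shows "path_mult X (path_class X f) (path_class X (segment_path b z)) = path_class X (segment_path a z)"
proof -
  define h where "h = (\<lambda>(s, t). segment_path (f t) z s)"
  have seg: "segment_path (f t) z \<in> paths_between X (f t) z" if "t \<in> {0..1}" for t
    using that cone by (intro paths_betweenI continuous_on_segment_path') auto
  note ends = paths_betweenD(6,7)[OF f]
  have "continuous_on ({0..1} \<times> {0..1}) (\<lambda>p. f (snd p))"
    by (rule continuous_on_compose2[OF paths_betweenD(8)[OF f]]) (auto intro!: continuous_intros)
  then have "continuous_on ({0..1} \<times> {0..1}) h"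
    unfolding h_def case_prod_beta
    by (rule continuous_on_segment_path) (rule continuous_on_const continuous_on_fst continuous_on_id)+
  moreover have "h ` ({0..1} \<times> {0..1}) \<subseteq> X"
    using cone by (auto simp: h_def)
  ultimately have "path_class X (f +++ segment_path b z) = path_class X (segment_path a z +++ (\<lambda>_. z))"
    using path_class_square[of h X] by (simp add: h_def ends)
  moreover have "z \<in> X" using cone[of 1 0] by simp
  ultimately show ?thesis
    using path_mult_class[OF f seg[of 1, unfolded ends]]
      path_mult_class[OF seg[of 0, unfolded ends] paths_between_const]
      path_mult_one_right[OF path_classI[OF seg[of 0, unfolded ends]]] by simp
qed

locale complex =
  fixes K :: "'a set set"
  assumes K: "abstract_complex K"
begin

abbreviation "X \<equiv> realization K"

lemma in_realization: "x \<in> simplex_points \<sigma> \<Longrightarrow> \<sigma> \<in> K \<Longrightarrow> x \<in> X"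
  using simplex_points_subset_realization[OF K] by blast

lemma segment_in_realization:
  assumes "x \<in> simplex_points \<sigma>" "y \<in> simplex_points \<sigma>" "\<sigma> \<in> K" "0 \<le> t" "t \<le> 1"
  shows "segment_path x y t \<in> X"
  using in_realization[OF segment_in_simplex] assms by blast

lemma segment_paths_between:
  assumes "x \<in> simplex_points \<sigma>" "y \<in> simplex_points \<sigma>" "\<sigma> \<in> K"
  shows "segment_path x y \<in> paths_between X x y"
  using assms
  by (intro paths_betweenI segment_in_realization continuous_on_segment_path') auto

lemma vertex_point_simplex: "a \<in> \<sigma> \<Longrightarrow> \<sigma> \<in> K \<Longrightarrow> vertex_point a \<in> simplex_points \<sigma>"
  by (rule vertex_point_in_simplex[OF _ abstract_complexD(1)[OF K]])

lemma vertex_point_in: "{a} \<in> K \<Longrightarrow> vertex_point a \<in> X"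
  by (rule in_realization[OF vertex_point_simplex]) auto

lemma face: "\<sigma> \<in> K \<Longrightarrow> a \<in> \<sigma> \<Longrightarrow> b \<in> \<sigma> \<Longrightarrow> {a, b} \<in> K" "\<sigma> \<in> K \<Longrightarrow> a \<in> \<sigma> \<Longrightarrow> {a} \<in> K"
  by (rule abstract_complexD(3)[OF K]; simp)+

lemma segment_class_triangle:
  assumes "x \<in> simplex_points \<sigma>" "y \<in> simplex_points \<sigma>" "z \<in> simplex_points \<sigma>" "\<sigma> \<in> K"
  shows "path_mult X (path_class X (segment_path x y)) (path_class X (segment_path y z))
     = path_class X (segment_path x z)"
  using assms
  by (intro path_class_cone segment_paths_between) (auto intro!: segment_in_realization segment_in_simplex)

lemma path_inv_segment:
  assumes "x \<in> simplex_points \<sigma>" "y \<in> simplex_points \<sigma>" "\<sigma> \<in> K"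
  shows "path_inv X (path_class X (segment_path x y)) = path_class X (segment_path y x)"
  using path_inv_class[OF segment_paths_between[OF assms]] by (simp add: reversepath_segment_path)

text \<open>The path may pass through many simplices, but each of its points lies in a closed
  simplex with vertex \<open>u\<close>, so the cone to \<open>u\<close> stays in the
  realization.\<close>

lemma star_path_class:
  assumes f: "f \<in> paths_between (X \<inter> {x. 0 < x u}) a b"
  shows "path_mult X (path_class X f) (path_class X (segment_path b (vertex_point u)))
     = path_class X (segment_path a (vertex_point u))"
proof (rule path_class_cone)
  show "f \<in> paths_between X a b" using f by (auto simp: paths_between_def)
  fix s t :: real assume s: "s \<in> {0..1}" and "t \<in> {0..1}"
  then have ft: "f t \<in> X" "0 < f t u" using paths_betweenD(5)[OF f] by auto
  then have "u \<in> support (f t)" by (simp add: support_def)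
  with ft s show "segment_path (f t) (vertex_point u) s \<in> X"
    using realizationD[of "f t" K] vertex_point_simplex by (intro segment_in_realization) auto
qed

end

section \<open>Transport along path classes\<close>

context transport
begin

text \<open>Homotopy invariance makes this relation single-valued. That it relates anything at all
  is established only for the classes that occur: segments, and their products and inverses.\<close>

definition class_transports :: "(real \<Rightarrow> 'b) set \<Rightarrow> 'r \<Rightarrow> 'r \<Rightarrow> bool" where
  "class_transports A w w' \<longleftrightarrow> (\<exists>f\<in>A. transports c f w w')"

lemma class_transportsI:
  "f \<in> paths_between X a b \<Longrightarrow> transports c f w w' \<Longrightarrow> class_transports (path_class X f) w w'"
  unfolding class_transports_def path_class_def paths_between_def by (auto intro!: exI[of _ f])

lemma path_classes_member:
  assumes "A \<in> path_classes X a b" "f \<in> A"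
  shows "f \<in> paths_between X a b" "A = path_class X f"
proof -
  obtain g where g: "A = path_class X g" "g \<in> paths_between X a b"
    using assms(1) by (auto simp: path_classes_def)
  then have "homotopic_paths X g f" using assms(2) by (simp add: path_class_def)
  then show "f \<in> paths_between X a b" "A = path_class X f"
    using g homotopic_paths_between path_class_eqI by blast+
qed

lemma class_transports_mult:
  assumes "A \<in> path_classes X a b" "B \<in> path_classes X b d"
    and "class_transports A w w'" "class_transports B w' w''"
  shows "class_transports (path_mult X A B) w w''"
proof -
  obtain f g where f: "f \<in> A" "transports c f w w'" and g: "g \<in> B" "transports c g w' w''"
    using assms(3,4) by (auto simp: class_transports_def)
  note f' = path_classes_member[OF assms(1) f(1)] and g' = path_classes_member[OF assms(2) g(1)]
  have "transports c (f +++ g) w w''"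
    using transports_join[OF f(2) g(2)] paths_betweenD(4)[OF f'(1)] paths_betweenD(3)[OF g'(1)] by simp
  then show ?thesis
    unfolding f'(2) g'(2) path_mult_class[OF f'(1) g'(1)]
    by (rule class_transportsI[OF paths_between_join[OF f'(1) g'(1)]])
qed

lemma class_transports_inv:
  assumes "A \<in> path_classes X a b" "class_transports A w w'"
  shows "class_transports (path_inv X A) w' w"
proof -
  obtain f where f: "f \<in> A" "transports c f w w'"
    using assms(2) by (auto simp: class_transports_def)
  note f' = path_classes_member[OF assms(1) f(1)]
  show ?thesis
    unfolding f'(2) path_inv_class[OF f'(1)]
    by (rule class_transportsI[OF paths_between_reverse[OF f'(1)] transports_reverse[OF f(2)]])
qed

lemma class_transports_unique:
  assumes "A \<in> path_classes X a b" "class_transports A w w1" "class_transports A w w2"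
  shows "w1 = w2"
proof -
  obtain f g where f: "f \<in> A" "transports c f w w1" and g: "g \<in> A" "transports c g w w2"
    using assms(2,3) by (auto simp: class_transports_def)
  have "homotopic_paths X f g"
    using g(1) unfolding path_classes_member(2)[OF assms(1) f(1)] by (simp add: path_class_def)
  then show ?thesis using transports_homotopic f g by blast
qed

end

section \<open>The fundamental group of a graph\<close>

text \<open>The base point is an arbitrary point and not only a vertex, because collapses can move
  it into an edge. The relation in \<open>conn\<close> contains the pairs \<open>(a, a)\<close> of
  vertices, since \<open>{a, a}\<close> is \<open>{a}\<close>.\<close>

locale graph = complex K for K :: "'a::linorder set set" +
  fixes x0 :: "'a \<Rightarrow> real"
  assumes dim: "\<sigma> \<in> K \<Longrightarrow> card \<sigma> \<le> 2"
    and x0: "x0 \<in> X"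
    and conn: "{a} \<in> K \<Longrightarrow> {b} \<in> K \<Longrightarrow> (a, b) \<in> {(a, b). {a, b} \<in> K}\<^sup>*"
begin

text \<open>A discontinuous choice of a vertex of the simplex around \<open>x\<close>; the order on
  the vertices makes the choice canonical, so that points with the same support get the same
  vertex.\<close>

definition carrier_vertex :: "('a \<Rightarrow> real) \<Rightarrow> 'a" where
  "carrier_vertex x = Min (support x)"

lemma carrier_vertex_in: "x \<in> X \<Longrightarrow> carrier_vertex x \<in> support x"
  unfolding carrier_vertex_def using realizationD(1)[of x K] abstract_complexD(1,2)[OF K] by (intro Min_in) auto

lemma carrier_vertex_vertex_point [simp]: "carrier_vertex (vertex_point a) = a"
  by (simp add: carrier_vertex_def)

section \<open>A spanning tree of shortest paths\<close>

definition root :: 'a where "root = carrier_vertex x0"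

definition edges :: "('a \<times> 'a) set" where "edges = {(a, b). {a, b} \<in> K}"

definition depth :: "'a \<Rightarrow> nat" where
  "depth a = (LEAST n. (root, a) \<in> edges ^^ n)"

definition parent :: "'a \<Rightarrow> 'a" where
  "parent a = (SOME u. (u, a) \<in> edges \<and> Suc (depth u) = depth a)"

lemma root: "{root} \<in> K"
  unfolding root_def using carrier_vertex_in[OF x0] realizationD(1)[OF x0] by (rule face(2)[rotated])

lemma depth:
  assumes "{a} \<in> K"
  shows "(root, a) \<in> edges ^^ depth a"
proof -
  obtain n where "(root, a) \<in> edges ^^ n"
    using conn[OF root assms] unfolding edges_def rtrancl_power by blast
  then show ?thesis unfolding depth_def by (rule LeastI)
qed

lemma depth_le: "(root, a) \<in> edges ^^ n \<Longrightarrow> depth a \<le> n"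
  unfolding depth_def by (rule Least_le)

lemma depth_root: "depth root = 0"
  using depth_le[of root 0] by simp

text \<open>The last edge of a shortest walk from \<open>root\<close> to \<open>a\<close> starts at
  a vertex whose depth is smaller by one. This descent justifies the recursion and the induction
  along parents.\<close>

lemma parent:
  assumes a: "{a} \<in> K" "a \<noteq> root"
  shows "{parent a, a} \<in> K" "Suc (depth (parent a)) = depth a"
proof -
  obtain n where n: "depth a = Suc n"
    using depth[OF a(1)] a(2) by (cases "depth a") auto
  then obtain u where u: "(root, u) \<in> edges ^^ n" "(u, a) \<in> edges"
    using depth[OF a(1)] by auto
  have "{u} \<in> K" using u(2) face(2)[of "{u, a}" u] by (simp add: edges_def)
  from depth[OF this] u(2) have "(root, a) \<in> edges ^^ Suc (depth u)" by auto
  then have "Suc (depth u) = depth a"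
    using depth_le[OF u(1)] depth_le[of a "Suc (depth u)"] n by simp
  with u(2) have "(u, a) \<in> edges \<and> Suc (depth u) = depth a" by simp
  then have "(parent a, a) \<in> edges \<and> Suc (depth (parent a)) = depth a"
    unfolding parent_def by (rule someI)
  then show "{parent a, a} \<in> K" "Suc (depth (parent a)) = depth a"
    by (auto simp: edges_def)
qed

definition edge_class :: "'a \<Rightarrow> 'a \<Rightarrow> (real \<Rightarrow> 'a \<Rightarrow> real) set" where
  "edge_class a b = path_class X (segment_path (vertex_point a) (vertex_point b))"

lemma edge_segment:
  "{a, b} \<in> K \<Longrightarrow> segment_path (vertex_point a) (vertex_point b) \<in> paths_between X (vertex_point a) (vertex_point b)"
  by (rule segment_paths_between[of _ "{a, b}"]) (auto intro: vertex_point_simplex)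

lemma edge_class: "{a, b} \<in> K \<Longrightarrow> edge_class a b \<in> path_classes X (vertex_point a) (vertex_point b)"
  unfolding edge_class_def by (intro path_classI edge_segment)

lemma edge_class_refl: "edge_class a a = path_class X (\<lambda>_. vertex_point a)"
proof -
  have "segment_path (vertex_point a) (vertex_point a) = (\<lambda>_. vertex_point a)"
    by (rule ext) simp
  then show ?thesis by (simp add: edge_class_def)
qed

lemma path_inv_edge_class: "{a, b} \<in> K \<Longrightarrow> path_inv X (edge_class a b) = edge_class b a"
  unfolding edge_class_def by (rule path_inv_segment[of _ "{a, b}"]) (auto intro: vertex_point_simplex)

lemma carrier_segment:
  assumes "x \<in> X"
  shows "segment_path x (vertex_point (carrier_vertex x)) \<in> paths_between X x (vertex_point (carrier_vertex x))"
    and "segment_path (vertex_point (carrier_vertex x)) x \<in> paths_between X (vertex_point (carrier_vertex x)) x"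
  using realizationD[OF assms] vertex_point_simplex[OF carrier_vertex_in[OF assms]]
  by (intro segment_paths_between[of _ "support x"]; simp)+

text \<open>The recursion is on the depth. Its first piece leads from the base point, which may lie
  inside an edge, to the vertex \<open>root\<close> of its simplex.\<close>

fun tree_path_aux :: "nat \<Rightarrow> 'a \<Rightarrow> (real \<Rightarrow> 'a \<Rightarrow> real) set" where
  "tree_path_aux 0 a = path_class X (segment_path x0 (vertex_point root))"
| "tree_path_aux (Suc n) a = path_mult X (tree_path_aux n (parent a)) (edge_class (parent a) a)"

definition tree_path :: "'a \<Rightarrow> (real \<Rightarrow> 'a \<Rightarrow> real) set" where
  "tree_path a = tree_path_aux (depth a) a"

lemma tree_path_root: "tree_path root = path_class X (segment_path x0 (vertex_point root))"
  by (simp add: tree_path_def depth_root)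

lemma tree_path_parent:
  assumes "{a} \<in> K" "a \<noteq> root"
  shows "tree_path a = path_mult X (tree_path (parent a)) (edge_class (parent a) a)"
  unfolding tree_path_def using parent(2)[OF assms, symmetric] by simp

lemma tree_induct [consumes 1, case_names root parent]:
  assumes "{a} \<in> K" and "P root"
    and step: "\<And>a. {a} \<in> K \<Longrightarrow> a \<noteq> root \<Longrightarrow> {parent a} \<in> K \<Longrightarrow> P (parent a) \<Longrightarrow> P a"
  shows "P a"
  using assms(1)
proof (induction "depth a" arbitrary: a rule: less_induct)
  case less
  show ?case
  proof (cases "a = root")
    case False
    note p = parent[OF less.prems False]
    then have K: "{parent a} \<in> K" using face(2)[of "{parent a, a}" "parent a"] by simp
    have "depth (parent a) < depth a" using p(2) by simp
    then show ?thesis by (rule step[OF less.prems False K less.hyps[OF _ K]])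
  qed (use assms in simp)
qed

lemma tree_path:
  assumes "{a} \<in> K"
  shows "tree_path a \<in> path_classes X x0 (vertex_point a)"
  using assms
proof (induction rule: tree_induct)
  case root
  show ?case
    unfolding tree_path_root using carrier_segment(1)[OF x0] by (simp add: path_classI root_def)
next
  case (parent a)
  then show ?case
    unfolding tree_path_parent[OF parent(1,2)]
    by (intro path_mult_closed[OF _ edge_class]) (use graph.parent(1)[OF graph_axioms parent(1,2)] in auto)
qed

text \<open>At \<open>x0\<close> the tree path is the segment to \<open>root\<close> and the second
  factor runs straight back, so the class is trivial there, as \<open>based_space\<close>
  demands.\<close>

definition base_path :: "('a \<Rightarrow> real) \<Rightarrow> (real \<Rightarrow> 'a \<Rightarrow> real) set" where
  "base_path x = path_mult X (tree_path (carrier_vertex x))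
     (path_class X (segment_path (vertex_point (carrier_vertex x)) x))"

lemma carrier_vertex_simplex: "x \<in> X \<Longrightarrow> {carrier_vertex x} \<in> K"
  by (rule face(2)[OF realizationD(1) carrier_vertex_in])

lemma base_path_vertex: 
  assumes "{a} \<in> K"
  shows "base_path (vertex_point a) = tree_path a"
  using path_mult_one_right[OF tree_path[OF assms]] edge_class_refl[of a]
  by (simp add: base_path_def edge_class_def)

sublocale based_space X x0 base_path
proof
  show "x0 \<in> X" by (rule x0)
  show "base_path x0 = path_class X (\<lambda>_. x0)"
    using path_mult_reverse(1)[OF carrier_segment(1)[OF x0]]
    by (simp add: base_path_def tree_path_root[unfolded root_def] reversepath_segment_path)
  show "base_path x \<in> path_classes X x0 x" if "x \<in> X" for x
    unfolding base_path_def
    by (intro path_mult_closed[OF tree_path[OF carrier_vertex_simplex[OF that]]] path_classI carrier_segment(2) that)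
qed

section \<open>Generation by the edges outside the tree\<close>

definition tree_edge :: "'a \<Rightarrow> 'a \<Rightarrow> bool" where
  "tree_edge a b \<longleftrightarrow> (b \<noteq> root \<and> a = parent b) \<or> (a \<noteq> root \<and> b = parent a)"

lemma tree_edge_sym: "tree_edge a b \<longleftrightarrow> tree_edge b a"
  by (auto simp: tree_edge_def)

definition gens :: "('a \<times> 'a) set" where
  "gens = {(a, b). a < b \<and> {a, b} \<in> K \<and> \<not> tree_edge a b}"

definition gen_loop :: "'a \<times> 'a \<Rightarrow> (real \<Rightarrow> 'a \<Rightarrow> real) set" where
  "gen_loop e = rebase (vertex_point (fst e)) (vertex_point (snd e)) (edge_class (fst e) (snd e))"

lemma rebase_edge_sym:
  assumes "{a, b} \<in> K"
  shows "rebase (vertex_point b) (vertex_point a) (edge_class b a)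
    = inv\<^bsub>fundamental_group X x0\<^esub> (rebase (vertex_point a) (vertex_point b) (edge_class a b))"
  using rebase_inv[OF edge_class[OF assms]] path_inv_edge_class[OF assms] by simp

text \<open>The base path of the parent continued along the edge is by construction the base path of
  the child, so the rebased edge cancels; the opposite direction follows by inverting.\<close>

lemma rebase_tree_edge:
  assumes ab: "{a, b} \<in> K" and "tree_edge a b"
  shows "rebase (vertex_point a) (vertex_point b) (edge_class a b) = path_class X (\<lambda>_. x0)"
proof -
  have *: "rebase (vertex_point (parent b)) (vertex_point b) (edge_class (parent b) b) = path_class X (\<lambda>_. x0)"
    if b: "{b} \<in> K" "b \<noteq> root" for b
  proof -
    note p = parent(1)[OF b]
    then have "{parent b} \<in> K" using face(2)[of "{parent b, b}" "parent b"] by simp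
    then show ?thesis
      by (intro rebase_eq_one[OF edge_class[OF p]]) (simp add: base_path_vertex b tree_path_parent)
  qed
  interpret group "fundamental_group X x0" by (rule group_fundamental_group[OF x0])
  have "{a} \<in> K" "{b} \<in> K" using face(2)[OF ab] by simp_all
  with assms(2) * rebase_edge_sym[of b a] ab inv_one show ?thesis
    by (auto simp: tree_edge_def insert_commute)
qed

text \<open>Every edge costs at most one letter: none if it is degenerate or in the tree, and
  otherwise one whose sign records whether the edge is run through upwards in the order of the
  vertices.\<close>

lemma gens_words:
  assumes "{a, b} \<in> K"
  shows "\<exists>w. set w \<subseteq> gen_loop ` gens \<times> UNIV \<and>
    word_value (fundamental_group X x0) w = rebase (vertex_point a) (vertex_point b) (edge_class a b)"
proof -
  interpret group "fundamental_group X x0" by (rule group_fundamental_group[OF x0])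
  have ab: "{a} \<in> K" "{b} \<in> K" using face(2)[OF assms] by simp_all
  have clo: "rebase (vertex_point a) (vertex_point b) (edge_class a b) \<in> carrier (fundamental_group X x0)"
    if "{a, b} \<in> K" for a b
    unfolding carrier_fundamental_group' by (intro rebase_closed edge_class that)
  consider "a = b" | "tree_edge a b" | "a < b" "\<not> tree_edge a b" | "b < a" "\<not> tree_edge a b"
    by (meson linorder_cases)
  then show ?thesis
  proof cases
    case 1
    then show ?thesis
      using rebase_const[OF vertex_point_in[OF ab(1)]] by (intro exI[of _ "[]"]) (simp add: edge_class_refl)
  next
    case 2
    then show ?thesis
      using rebase_tree_edge[OF assms] by (intro exI[of _ "[]"]) simp
  next
    case 3
    then have "(a, b) \<in> gens" using assms by (simp add: gens_def)
    then show ?thesis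
      using r_one[OF clo[OF assms]] imageI[of "(a, b)" gens gen_loop]
      by (intro exI[of _ "[(gen_loop (a, b), True)]"]) (simp add: gen_loop_def[of "(a, b)"])
  next
    case 4
    have ba: "{b, a} \<in> K" using assms by (simp add: insert_commute)
    then have "(b, a) \<in> gens" using 4 tree_edge_sym[of a b] by (simp add: gens_def)
    then show ?thesis
      using r_one[OF inv_closed[OF clo[OF ba]]] rebase_edge_sym[OF ba] imageI[of "(b, a)" gens gen_loop]
      by (intro exI[of _ "[(gen_loop (b, a), False)]"]) (simp add: gen_loop_def[of "(b, a)"])
  qed
qed

lemma gen_loop_closed: "gen_loop ` gens \<subseteq> carrier (fundamental_group X x0)"
  unfolding carrier_fundamental_group' gen_loop_def gens_def
  by (auto intro!: rebase_closed edge_class)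

text \<open>\<open>base_path x\<close> arrives by way of \<open>carrier_vertex x\<close>, and the
  way from there over \<open>x\<close> to \<open>u\<close> stays in one simplex, so an edge replaces
  it. Interior points thereby disappear from the generators.\<close>

lemma rebase_to_vertex:
  assumes x: "x \<in> X" and u: "u \<in> support x"
  shows "rebase x (vertex_point u) (path_class X (segment_path x (vertex_point u)))
    = rebase (vertex_point (carrier_vertex x)) (vertex_point u) (edge_class (carrier_vertex x) u)"
proof -
  let ?m = "carrier_vertex x"
  interpret group "fundamental_group X x0" by (rule group_fundamental_group[OF x0])
  note s = realizationD[OF x] and m = carrier_vertex_in[OF x]
  have seg: "path_class X (segment_path (vertex_point ?m) x) \<in> path_classes X (vertex_point ?m) x"
    by (intro path_classI carrier_segment x)
  have seg': "path_class X (segment_path x (vertex_point u)) \<in> path_classes X x (vertex_point u)"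
    by (intro path_classI segment_paths_between[of _ "support x"] s vertex_point_simplex u)
  have "path_mult X (path_class X (segment_path (vertex_point ?m) x)) (path_class X (segment_path x (vertex_point u)))
      = edge_class ?m u"
    unfolding edge_class_def
    by (rule segment_class_triangle[of _ "support x"]) (intro s vertex_point_simplex u m)+
  then have "rebase (vertex_point ?m) (vertex_point u) (edge_class ?m u)
    = path_mult X (rebase (vertex_point ?m) x (path_class X (segment_path (vertex_point ?m) x)))
       (rebase x (vertex_point u) (path_class X (segment_path x (vertex_point u))))"
    using rebase_mult[OF seg seg'] by simp
  also have "rebase (vertex_point ?m) x (path_class X (segment_path (vertex_point ?m) x)) = path_class X (\<lambda>_. x0)"
    by (rule rebase_eq_one[OF seg])
      (simp add: base_path_vertex[OF carrier_vertex_simplex[OF x]] base_path_def[of x])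
  finally show ?thesis
    using path_mult_one_left[OF rebase_closed[OF seg']] by simp
qed

text \<open>\<open>rebase_generated\<close> is applied to the open stars. In the star of
  \<open>u\<close>, a path from \<open>a\<close> to \<open>b\<close> followed by the segment from
  \<open>b\<close> to \<open>u\<close> is homotopic to the segment from \<open>a\<close> to
  \<open>u\<close>, so its rebased class is a product of two rebased edges.\<close>

lemma gens_generate:
  assumes "g \<in> carrier (fundamental_group X x0)"
  shows "\<exists>w. set w \<subseteq> gen_loop ` gens \<times> UNIV \<and> word_value (fundamental_group X x0) w = g"
proof -
  interpret group "fundamental_group X x0" by (rule group_fundamental_group[OF x0])
  define H where "H = word_value (fundamental_group X x0) ` {w. set w \<subseteq> gen_loop ` gens \<times> UNIV}"
  have mult: "path_mult X A B \<in> H" if AB: "A \<in> H" "B \<in> H" for A B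
  proof -
    obtain v w where vw: "set v \<subseteq> gen_loop ` gens \<times> UNIV" "set w \<subseteq> gen_loop ` gens \<times> UNIV"
      "A = word_value (fundamental_group X x0) v" "B = word_value (fundamental_group X x0) w"
      using AB unfolding H_def by blast
    then have "path_mult X A B = word_value (fundamental_group X x0) (v @ w)"
      using word_value_append[OF gen_loop_closed vw(1,2)] by simp
    moreover have "set (v @ w) \<subseteq> gen_loop ` gens \<times> UNIV" using vw(1,2) by simp
    ultimately show ?thesis unfolding H_def by blast
  qed
  have edge: "rebase (vertex_point a) (vertex_point b) (edge_class a b) \<in> H" if "{a, b} \<in> K" for a b
    using gens_words[OF that] unfolding H_def by blast
  obtain f where f: "f \<in> paths_between X x0 x0" "g = path_class X f"
    using assms unfolding carrier_fundamental_group by auto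
  have "rebase x0 x0 (path_class X f) \<in> H"
  proof (rule rebase_generated[OF mult _ f(1)])
    fix x assume x: "x \<in> X"
    define u where "u = carrier_vertex x"
    have xu: "0 < x u"
      using carrier_vertex_in[OF x] realizationD(3)[OF x, of u] by (simp add: u_def support_def)
    have "rebase a b (path_class X f) \<in> H" if f: "f \<in> paths_between (X \<inter> {x. 0 < x u}) a b" for a b f
    proof -
      have ab: "a \<in> X" "b \<in> X" "u \<in> support a" "u \<in> support b"
        using paths_betweenD(9,10)[OF f] by (auto simp: support_def)
      have fX: "path_class X f \<in> path_classes X a b"
        using f by (intro path_classI) (auto simp: paths_between_def)
      have seg: "path_class X (segment_path b (vertex_point u)) \<in> path_classes X b (vertex_point u)"
        by (rule path_classI[OF segment_paths_between[OF realizationD(2)[OF ab(2)]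
              vertex_point_simplex[OF ab(4)]]]; rule realizationD(1)[OF ab(2)])
      let ?a = "carrier_vertex a" and ?b = "carrier_vertex b"
      have edges: "{?a, u} \<in> K" "{?b, u} \<in> K" "{u, ?b} \<in> K"
        using face(1)[OF realizationD(1)[OF ab(1)] carrier_vertex_in[OF ab(1)] ab(3)]
          face(1)[OF realizationD(1)[OF ab(2)] carrier_vertex_in[OF ab(2)] ab(4)]
          face(1)[OF realizationD(1)[OF ab(2)] ab(4) carrier_vertex_in[OF ab(2)]] .
      define R where "R = (\<lambda>a b. rebase (vertex_point a) (vertex_point b) (edge_class a b))"
      have Rc: "R c d \<in> carrier (fundamental_group X x0)" if "{c, d} \<in> K" for c d
        unfolding R_def carrier_fundamental_group' by (intro rebase_closed edge_class that)
      have "path_mult X (rebase a b (path_class X f)) (R ?b u) = R ?a u"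
        unfolding R_def rebase_to_vertex[OF ab(2,4), symmetric] rebase_to_vertex[OF ab(1,3), symmetric]
          rebase_mult[OF fX seg, symmetric] star_path_class[OF f] ..
      then have "rebase a b (path_class X f) = path_mult X (R ?a u) (inv\<^bsub>fundamental_group X x0\<^esub> (R ?b u))"
        using inv_solve_right[OF _ Rc[OF edges(1)] Rc[OF edges(2)], of "rebase a b (path_class X f)"] 
          rebase_closed[OF fX] by (simp add: carrier_fundamental_group')
      also have "inv\<^bsub>fundamental_group X x0\<^esub> (R ?b u) = R u ?b"
        unfolding R_def by (rule rebase_edge_sym[OF edges(2), symmetric])
      finally show ?thesis
        using mult edge edges unfolding R_def by simp
    qed
    then show "\<exists>N. open N \<and> x \<in> N \<and> (\<forall>a b f. f \<in> paths_between (X \<inter> N) a b \<longrightarrow> rebase a b (path_class X f) \<in> H)"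
      using xu open_coordinate_gt by (intro exI[of _ "{x. 0 < x u}"]) simp
  qed
  then have "g \<in> H" unfolding rebase_loop[OF path_classI[OF f(1)]] f(2) .
  then show ?thesis unfolding H_def by blast
qed

section \<open>Freeness by transport of reduced words\<close>

definition letter_act :: "('a \<times> 'a) \<times> bool \<Rightarrow> (('a \<times> 'a) \<times> bool) list \<Rightarrow> (('a \<times> 'a) \<times> bool) list" where
  "letter_act l w = (if w \<in> reduced_words gens then reduce_Cons l w else w)"

text \<open>On reduced words this is the cocycle that describes the universal cover, trivialised
  along the spanning tree: tree edges act as the identity, every other edge as a generator or its
  inverse.\<close>

definition edge_act :: "'a \<Rightarrow> 'a \<Rightarrow> (('a \<times> 'a) \<times> bool) list \<Rightarrow> (('a \<times> 'a) \<times> bool) list" where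
  "edge_act a b w =
     (if a = b \<or> tree_edge a b then w
      else if a < b then letter_act ((a, b), True) w else letter_act ((b, a), False) w)"

text \<open>\<open>letter_act\<close> fixes the lists that are not reduced, so the law holds for
  every list \<open>w\<close>; the locale \<open>transport\<close> quantifies over the whole fibre
  type.\<close>

lemma letter_act_cancel: "e \<in> gens \<Longrightarrow> letter_act (e, \<not> s) (letter_act (e, s) w) = w"
  using reduce_Cons_cancel[of w gens e s] reduce_Cons_reduced[of "(e, s)" gens w]
  by (simp add: letter_act_def)

lemma edge_act_inverse: 
  assumes "{a, b} \<in> K"
  shows "edge_act b a (edge_act a b w) = w"
proof -
  have "(a, b) \<in> gens" if "a < b" "\<not> tree_edge a b" using that assms by (simp add: gens_def)
  moreover have "(b, a) \<in> gens" if "b < a" "\<not> tree_edge a b"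
    using that assms by (simp add: gens_def insert_commute tree_edge_sym[of b a])
  ultimately show ?thesis
    using letter_act_cancel[of "(a, b)" True w] letter_act_cancel[of "(b, a)" False w] tree_edge_sym[of a b]
    by (cases a b rule: linorder_cases) (auto simp: edge_act_def)
qed

lemma edge_act_refl [simp]: "edge_act a a w = w"
  by (simp add: edge_act_def)

text \<open>A simplex of a graph has at most two vertices, so two of the three coincide and the
  cocycle law shrinks to \<open>edge_act_inverse\<close>. A triangle would impose a relation between
  the generators here.\<close>

lemma edge_act_trans:
  assumes \<sigma>: "\<sigma> \<in> K" and abc: "a \<in> \<sigma>" "b \<in> \<sigma>" "c \<in> \<sigma>"
  shows "edge_act b c (edge_act a b w) = edge_act a c w"
proof -
  have "card {a, b, c} \<le> card \<sigma>"
    using abc abstract_complexD(1)[OF K \<sigma>] by (intro card_mono) auto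
  with dim[OF \<sigma>] have "card {a, b, c} \<le> 2" by simp
  then have "a = b \<or> b = c \<or> a = c" by (rule_tac ccontr) simp
  then show ?thesis
    using edge_act_inverse[OF face(1)[OF \<sigma> abc(1,2)]] by auto
qed

text \<open>Fibres are compared by going from \<open>carrier_vertex x\<close> over a common vertex
  \<open>u\<close> to \<open>carrier_vertex y\<close>. For points without a common vertex the value
  is arbitrary; the laws are only checked inside open stars.\<close>

definition shift :: "('a \<Rightarrow> real) \<Rightarrow> ('a \<Rightarrow> real) \<Rightarrow> (('a \<times> 'a) \<times> bool) list \<Rightarrow> (('a \<times> 'a) \<times> bool) list" where
  "shift x y w = (let u = (SOME u. u \<in> support x \<inter> support y)
     in edge_act u (carrier_vertex y) (edge_act (carrier_vertex x) u w))"

text \<open>Two different common vertices force \<open>x\<close> and \<open>y\<close> into the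
  interior of the same edge. Their carrier vertices then coincide, and either choice of
  \<open>u\<close> gives the identity.\<close>

lemma shift_eq:
  assumes x: "x \<in> X" and y: "y \<in> X" and u: "u \<in> support x" "u \<in> support y"
  shows "shift x y w = edge_act u (carrier_vertex y) (edge_act (carrier_vertex x) u w)"
proof -
  note sx = realizationD(1)[OF x] and sy = realizationD(1)[OF y]
  note vx = carrier_vertex_in[OF x] and vy = carrier_vertex_in[OF y]
  define v where "v = (SOME u. u \<in> support x \<inter> support y)"
  have v: "v \<in> support x" "v \<in> support y"
    using someI[of "\<lambda>u. u \<in> support x \<inter> support y" u] u by (auto simp: v_def)
  have "edge_act v (carrier_vertex y) (edge_act (carrier_vertex x) v w)
      = edge_act u (carrier_vertex y) (edge_act (carrier_vertex x) u w)"
  proof (cases "u = v")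
    case False
    have sup: "support z = {u, v}" if "z \<in> X" "u \<in> support z" "v \<in> support z" for z
      using that dim[OF realizationD(1)[OF that(1)]] abstract_complexD(1)[OF K realizationD(1)[OF that(1)]] False
      by (intro card_seteq[symmetric]) auto
    have "support x = support y" using sup[OF x u(1) v(1)] sup[OF y u(2) v(2)] by simp
    then show ?thesis
      using edge_act_trans[OF sx vx _ vx] vx vy u v by (simp add: carrier_vertex_def)
  qed simp
  then show ?thesis by (simp add: shift_def v_def)
qed

text \<open>In the open star of \<open>u\<close> all shifts can be routed through \<open>u\<close>,
  where the end of one cancels against the start of the next.\<close>

sublocale transport X shift
proof
  fix x w assume x: "x \<in> X"
  show "shift x x w = w"
    using shift_eq[OF x x carrier_vertex_in[OF x] carrier_vertex_in[OF x]] by simp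
next
  fix x assume x: "x \<in> X"
  define u where "u = carrier_vertex x"
  have "x \<in> {x. 0 < x u}"
    using carrier_vertex_in[OF x] realizationD(3)[OF x, of u] by (simp add: u_def support_def)
  moreover have "shift z v (shift y z w) = shift y v w"
    if "y \<in> X" "z \<in> X" "v \<in> X" "0 < y u" "0 < z u" "0 < v u" for y z v w
  proof -
    have u: "u \<in> support y" "u \<in> support z" "u \<in> support v" using that by (auto simp: support_def)
    show ?thesis
      using edge_act_inverse[OF face(1)[OF realizationD(1)[OF that(2)] u(2) carrier_vertex_in[OF that(2)]]] u that
      by (simp add: shift_eq[of _ _ u])
  qed
  ultimately show "\<exists>N. open N \<and> x \<in> N \<and>
      (\<forall>y\<in>N \<inter> X. \<forall>z\<in>N \<inter> X. \<forall>u\<in>N \<inter> X. \<forall>w. shift z u (shift y z w) = shift y u w)"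
    using open_coordinate_gt by (intro exI[of _ "{x. 0 < x u}"]) simp
qed

text \<open>The lift is explicit: the action of the edge from the carrier vertex of the start to
  that of the current point. It jumps where \<open>carrier_vertex\<close> jumps, in step with
  \<open>shift\<close>.\<close>

lemma transports_in_simplex:
  assumes \<sigma>: "\<sigma> \<in> K" and f: "continuous_on {0..1} f" "\<And>t. t \<in> {0..1} \<Longrightarrow> f t \<in> simplex_points \<sigma>"
  shows "transports shift f w (edge_act (carrier_vertex (f 0)) (carrier_vertex (f 1)) w)"
proof -
  define a where "a = carrier_vertex (f 0)"
  have fX: "f t \<in> X" if "t \<in> {0..1}" for t using in_realization[OF f(2)[OF that] \<sigma>] .
  have sup: "support (f t) \<subseteq> \<sigma>" if "t \<in> {0..1}" for t
    using f(2)[OF that] by (simp add: simplex_points_def)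
  have cv: "carrier_vertex (f t) \<in> \<sigma>" if "t \<in> {0..1}" for t
    using carrier_vertex_in[OF fX[OF that]] sup[OF that] by blast
  have a: "a \<in> \<sigma>" using cv[of 0] by (simp add: a_def)
  have "lift_along shift {0..1} f (\<lambda>t. edge_act a (carrier_vertex (f t)) w)"
    unfolding lift_along_def
  proof
    fix d :: real assume d: "d \<in> {0..1}"
    define u where "u = carrier_vertex (f d)"
    have ud: "u \<in> support (f d)" unfolding u_def by (rule carrier_vertex_in[OF fX[OF d]])
    then have pos: "0 < f d u" using realizationD(3)[OF fX[OF d], of u] by (simp add: support_def)
    obtain U where U: "open U" "U \<inter> {0..1} = f -` {x. 0 < x u} \<inter> {0..1}"
      using f(1) open_coordinate_gt[of 0 u] unfolding continuous_on_open_invariant by blast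
    have "d \<in> U \<inter> {0..1}" unfolding U(2) using d pos by simp
    moreover have "edge_act a (carrier_vertex (f e)) w = shift (f d) (f e) (edge_act a (carrier_vertex (f d)) w)"
      if "e \<in> U \<inter> {0..1}" for e
    proof -
      have e: "e \<in> {0..1}" "0 < f e u" using that unfolding U(2) by simp_all
      then have "u \<in> support (f e)" by (simp add: support_def)
      then have "shift (f d) (f e) (edge_act a (carrier_vertex (f d)) w)
         = edge_act u (carrier_vertex (f e)) (edge_act (carrier_vertex (f d)) u (edge_act a (carrier_vertex (f d)) w))"
        by (rule shift_eq[OF fX[OF d] fX[OF e(1)] ud])
      also have "\<dots> = edge_act a (carrier_vertex (f e)) w"
        using edge_act_trans[OF \<sigma> a cv[OF d] cv[OF e(1)]] by (simp add: u_def)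
      finally show ?thesis by simp
    qed
    ultimately show "\<exists>U. open U \<and> d \<in> U \<and> (\<forall>e\<in>U \<inter> {0..1}. edge_act a (carrier_vertex (f e)) w
        = shift (f d) (f e) (edge_act a (carrier_vertex (f d)) w))"
      using U(1) by blast
  qed
  moreover have "edge_act a (carrier_vertex (f 0)) w = w" by (simp add: a_def)
  ultimately show ?thesis unfolding transports_def a_def by blast
qed

lemma segment_transports:
  assumes "x \<in> simplex_points \<sigma>" "y \<in> simplex_points \<sigma>" "\<sigma> \<in> K"
  shows "class_transports (path_class X (segment_path x y)) w (edge_act (carrier_vertex x) (carrier_vertex y) w)"
proof -
  have "transports shift (segment_path x y) w (edge_act (carrier_vertex (segment_path x y 0)) (carrier_vertex (segment_path x y 1)) w)"
    by (rule transports_in_simplex[OF assms(3) continuous_on_segment_path'])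
      (use assms in \<open>simp add: segment_in_simplex\<close>)
  then show ?thesis
    by (intro class_transportsI[OF segment_paths_between[OF assms]]) simp
qed

lemma edge_class_transports:
  assumes "{a, b} \<in> K"
  shows "class_transports (edge_class a b) w (edge_act a b w)"
  using segment_transports[OF vertex_point_simplex[OF _ assms] vertex_point_simplex[OF _ assms] assms, of a b w]
  by (simp add: edge_class_def)

lemma tree_path_transports:
  assumes "{a} \<in> K"
  shows "class_transports (tree_path a) w w"
  using assms
proof (induction rule: tree_induct)
  case root
  show ?case
    using segment_transports[OF realizationD(2)[OF x0] vertex_point_simplex[OF carrier_vertex_in[OF x0]
        realizationD(1)[OF x0]] realizationD(1)[OF x0], of w]
    unfolding tree_path_root by (simp add: root_def)
next
  case (parent a)
  note p = graph.parent(1)[OF graph_axioms parent(1,2)]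
  have "tree_edge (parent a) a" using parent(2) by (simp add: tree_edge_def)
  then have "class_transports (edge_class (parent a) a) w w"
    using edge_class_transports[OF p, of w] by (simp add: edge_act_def)
  then show ?case
    unfolding tree_path_parent[OF parent(1,2)]
    by (rule class_transports_mult[OF tree_path[OF parent(3)] edge_class[OF p] parent(4)])
qed

text \<open>Both legs of the loop run in the tree and act as the identity, so only its one edge
  outside the tree is felt.\<close>

lemma gen_loop_transports:
  assumes "e \<in> gens"
  shows "class_transports (gen_loop e) w (letter_act (e, True) w)"
proof -
  obtain a b where e: "e = (a, b)" "a < b" "{a, b} \<in> K" "\<not> tree_edge a b"
    using assms by (auto simp: gens_def)
  have ab: "{a} \<in> K" "{b} \<in> K" using face(2)[OF e(3)] by simp_all
  note ta = tree_path[OF ab(1)] and tb = tree_path[OF ab(2)] and ec = edge_class[OF e(3)]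
  have act: "edge_act a b w = letter_act (e, True) w" using e by (auto simp: edge_act_def)
  have "class_transports (path_mult X (tree_path a) (edge_class a b)) w (letter_act (e, True) w)"
    using class_transports_mult[OF ta ec tree_path_transports[OF ab(1)] edge_class_transports[OF e(3)], of w] 
    by (simp add: act)
  then have "class_transports (path_mult X (path_mult X (tree_path a) (edge_class a b)) (path_inv X (tree_path b)))
      w (letter_act (e, True) w)"
    by (rule class_transports_mult[OF path_mult_closed[OF ta ec] path_inv(1)[OF tb] _
        class_transports_inv[OF tb tree_path_transports[OF ab(2)]]])
  then show ?thesis
    by (simp add: gen_loop_def rebase_def base_path_vertex ab e(1))
qed

text \<open>The first letter is traversed first, hence pushed onto the list first, and ends up
  deepest; this is why the word appears reversed. Reducedness of \<open>rev w @ u\<close> rules out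
  cancellation at every stage.\<close>

lemma word_value_transports:
  assumes "set w \<subseteq> gens \<times> UNIV" "rev w @ u \<in> reduced_words gens"
  shows "class_transports (word_value (fundamental_group X x0) (map (apfst gen_loop) w)) u (rev w @ u)"
  using assms
proof (induction w arbitrary: u)
  case Nil
  then show ?case
    using class_transportsI[OF paths_between_const[OF x0] transports_const[OF x0]] by simp
next
  case (Cons l w)
  interpret group "fundamental_group X x0" by (rule group_fundamental_group[OF x0])
  obtain e s where l: "l = (e, s)" and e: "e \<in> gens" using Cons.prems(1) by (cases l) auto
  have red: "v @ y \<in> reduced_words gens \<Longrightarrow> y \<in> reduced_words gens" for v y
    by (induction v) (auto simp: reduced_words_Cons)
  have lu: "l # u \<in> reduced_words gens" using red[of "rev w" "l # u"] Cons.prems(2) by simp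
  then have u: "u \<in> reduced_words gens" by (simp add: reduced_words_Cons)
  have act: "letter_act l u = l # u"
    using u reduce_Cons_reduced_word[OF lu] by (simp add: letter_act_def)
  have gl: "gen_loop e \<in> path_classes X x0 x0"
    using gen_loop_closed e unfolding carrier_fundamental_group' by blast
  define A where "A = (if s then gen_loop e else inv\<^bsub>fundamental_group X x0\<^esub> (gen_loop e))"
  have "A \<in> carrier (fundamental_group X x0)"
    using gl inv_closed unfolding carrier_fundamental_group' A_def by auto
  then have A: "A \<in> path_classes X x0 x0" by (simp add: carrier_fundamental_group')
  have "class_transports A u (l # u)"
  proof (cases s)
    case True
    then show ?thesis using gen_loop_transports[OF e, of u] act by (simp add: A_def l)
  next
    case False
    obtain f where f: "gen_loop e = path_class X f" "f \<in> paths_between X x0 x0"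
      using gl by (auto simp: path_classes_def)
    have "A = path_inv X (gen_loop e)"
      using False inv_fundamental_group[OF f(2)] path_inv_class[OF f(2)] by (simp add: A_def f(1))
    \<comment> \<open>A negative letter is treated backwards: the positive generator takes
      \<open>l # u\<close> to \<open>u\<close>, and this transport is then reversed.\<close>
    moreover have "letter_act (e, True) (l # u) = u"
      using letter_act_cancel[OF e, of False u] act False by (simp add: l)
    ultimately show ?thesis
      using class_transports_inv[OF gl gen_loop_transports[OF e, of "l # u"]] by simp
  qed
  moreover have "set (map (apfst gen_loop) w) \<subseteq> gen_loop ` gens \<times> UNIV"
    using Cons.prems(1) by auto
  then have "word_value (fundamental_group X x0) (map (apfst gen_loop) w) \<in> path_classes X x0 x0"
    using word_value_closed[OF _ gen_loop_closed] by (simp add: carrier_fundamental_group')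
  moreover have "class_transports (word_value (fundamental_group X x0) (map (apfst gen_loop) w)) (l # u) (rev w @ l # u)"
    using Cons by simp
  ultimately have "class_transports (path_mult X A (word_value (fundamental_group X x0) (map (apfst gen_loop) w)))
      u (rev w @ l # u)"
    using class_transports_mult[OF A] by blast
  then show ?case by (simp add: l A_def)
qed

theorem free_fundamental_group_graph: "free_group (fundamental_group X x0)"
proof (rule free_groupI[OF group_fundamental_group[OF x0] gen_loop_closed _ gens_generate])
  interpret group "fundamental_group X x0" by (rule group_fundamental_group[OF x0])
  fix w w' assume w: "w \<in> reduced_words gens" "w' \<in> reduced_words gens"
    and eq: "word_value (fundamental_group X x0) (map (apfst gen_loop) w)
      = word_value (fundamental_group X x0) (map (apfst gen_loop) w')"
  have sub: "set w \<subseteq> gens \<times> UNIV" "set w' \<subseteq> gens \<times> UNIV" using w by (auto simp: reduced_words_def)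
  have "set (map (apfst gen_loop) w) \<subseteq> gen_loop ` gens \<times> UNIV"
    using sub(1) by auto
  then have "word_value (fundamental_group X x0) (map (apfst gen_loop) w) \<in> path_classes X x0 x0"
    using word_value_closed[OF _ gen_loop_closed] by (simp add: carrier_fundamental_group')
  then have "rev w @ [] = rev w' @ []"
    using word_value_transports[OF sub(1), of "[]"] word_value_transports[OF sub(2), of "[]"] w
    unfolding eq by (intro class_transports_unique) (auto simp: rev_reduced_words)
  then show "w = w'" by simp
qed

end

section \<open>Deformation retractions\<close>

lemma deformation_homotopy_equivalent:
  fixes h :: "real \<times> 'a::topological_space \<Rightarrow> 'a"
  assumes h: "continuous_on ({0..1} \<times> X) h" "\<And>t x. t \<in> {0..1} \<Longrightarrow> x \<in> X \<Longrightarrow> h (t, x) \<in> X"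
    and h0: "\<And>x. h (0, x) = x" and A: "A \<subseteq> X"
    and h1: "\<And>x. x \<in> X \<Longrightarrow> h (1, x) \<in> A" "\<And>x. x \<in> A \<Longrightarrow> h (1, x) = x"
  shows "top_of_set X homotopy_equivalent_space top_of_set A"
proof (rule deformation_retract_imp_homotopy_equivalent_space)
  have "homotopic_with (\<lambda>_. True) (top_of_set X) (top_of_set X) id (\<lambda>x. h (1, x))"
    unfolding homotopic_with_def
    using h h0 by (intro exI[of _ h]) (auto simp: continuous_map_subtopology_eu)
  then show "homotopic_with (\<lambda>_. True) (top_of_set X) (top_of_set X) (\<lambda>x. h (1, x)) id"
    by (rule homotopic_with_symD)
  have "continuous_on X (\<lambda>x. h (1, x))"
    by (rule continuous_on_compose2[OF h(1)]) (auto intro!: continuous_intros)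
  then show "retraction_maps (top_of_set X) (top_of_set A) (\<lambda>x. h (1, x)) id"
    using A h1 by (auto simp: retraction_maps_def continuous_map_subtopology_eu)
qed

text \<open>The base point \<open>x\<close> may lie outside \<open>A\<close> and travels along its
  track \<open>\<sigma>\<close>. By \<open>fibre\<close> the retraction \<open>r\<close> is constant
  on tracks, so \<open>r \<circ> \<sigma>\<close> is constant and conjugation by
  \<open>\<sigma>\<close> is inverse to \<open>r\<close> on classes of loops.\<close>

theorem deformation_fundamental_group:
  fixes h :: "real \<times> 'a::topological_space \<Rightarrow> 'a"
  assumes h: "continuous_on ({0..1} \<times> X) h" "\<And>t x. t \<in> {0..1} \<Longrightarrow> x \<in> X \<Longrightarrow> h (t, x) \<in> X"
    and h0: "\<And>x. h (0, x) = x" and A: "A \<subseteq> X"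
    and h1: "\<And>x. x \<in> X \<Longrightarrow> h (1, x) \<in> A" "\<And>x. x \<in> A \<Longrightarrow> h (1, x) = x"
    and fibre: "\<And>t x. t \<in> {0..1} \<Longrightarrow> x \<in> X \<Longrightarrow> h (1, h (t, x)) = h (1, x)"
    and x: "x \<in> X" and free: "free_group (fundamental_group A (h (1, x)))"
  shows "free_group (fundamental_group X x)"
proof -
  define r where "r = (\<lambda>x. h (1, x))"
  have r: "continuous_on X r" "r ` X \<subseteq> A"
    unfolding r_def using h1 
    by (auto intro!: continuous_on_compose2[OF h(1)] continuous_intros)
  have rx: "r x \<in> A" using r(2) x by auto
  define \<sigma> where "\<sigma> = (\<lambda>s. h (s, x))"
  have "continuous_on {0..1} \<sigma>"
    unfolding \<sigma>_def using x by (intro continuous_on_compose2[OF h(1)] continuous_intros) auto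
  then have \<sigma>: "\<sigma> \<in> paths_between X x (r x)"
    using h(2) x h0 by (intro paths_betweenI) (auto simp: \<sigma>_def r_def)
  define S where "S = path_class X \<sigma>"
  have S: "S \<in> path_classes X x (r x)" unfolding S_def by (rule path_classI[OF \<sigma>])
  have AX: "f \<in> paths_between X a b" if "f \<in> paths_between A a b" for f a b
    using that A by (auto simp: paths_between_def)
  \<comment> \<open>Under the deformation the loop sweeps out a square with sides \<open>f\<close>,
    \<open>r \<circ> f\<close> and twice \<open>\<sigma>\<close>, so its class is conjugate to that
    of \<open>r \<circ> f\<close>.\<close>
  have square: "path_mult X (path_class X f) S = path_mult X S (path_class X (r \<circ> f))"
    if f: "f \<in> paths_between X x x" for f
  proof -
    define k where "k = (\<lambda>p. h (fst p, f (snd p)))"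
    have "continuous_on ({0..1} \<times> {0..1}) (\<lambda>p. f (snd p))"
      by (rule continuous_on_compose2[OF paths_betweenD(8)[OF f]]) (auto intro!: continuous_intros)
    then have "continuous_on ({0..1} \<times> {0..1}) k"
      unfolding k_def using paths_betweenD(5)[OF f]
      by (intro continuous_on_compose2[OF h(1)] continuous_on_Pair continuous_on_fst continuous_on_id) auto
    moreover have "k ` ({0..1} \<times> {0..1}) \<subseteq> X"
      using paths_betweenD(5)[OF f] h(2) by (auto simp: k_def)
    ultimately have "path_class X ((\<lambda>t. k (0, t)) +++ (\<lambda>s. k (s, 1))) = path_class X ((\<lambda>s. k (s, 0)) +++ (\<lambda>t. k (1, t)))"
      by (rule path_class_square)
    moreover have "(\<lambda>t. k (0, t)) = f" "(\<lambda>s. k (s, 1)) = \<sigma>" "(\<lambda>s. k (s, 0)) = \<sigma>" "(\<lambda>t. k (1, t)) = r \<circ> f"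
      using paths_betweenD(6,7)[OF f] h0 by (auto simp: k_def \<sigma>_def r_def)
    ultimately show ?thesis
      using path_mult_class[OF f \<sigma>] path_mult_class[OF \<sigma> AX[OF paths_between_image[OF f r]]] by (simp add: S_def)
  qed
  define \<Phi> where "\<Phi> = (\<lambda>C. \<Union>f\<in>C. path_class A (r \<circ> f))"
  have \<Phi>: "\<Phi> (path_class X f) = path_class A (r \<circ> f)" if f: "f \<in> paths_between X a b" for f a b
  proof -
    have "path_class A (r \<circ> g) = path_class A (r \<circ> f)" if "g \<in> path_class X f" for g
      using that r
      by (intro path_class_eqI[symmetric] homotopic_paths_continuous_image[of X]) (auto simp: path_class_def)
    moreover have "f \<in> path_class X f"
      using f by (auto simp: path_class_def paths_between_def)
    ultimately show ?thesis unfolding \<Phi>_def by blast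
  qed
  interpret G: group "fundamental_group X x" by (rule group_fundamental_group[OF x])
  interpret H: group "fundamental_group A (r x)" by (rule group_fundamental_group[OF rx])
  have hom: "\<Phi> \<in> hom (fundamental_group X x) (fundamental_group A (r x))"
  proof (rule homI)
    fix C assume "C \<in> carrier (fundamental_group X x)"
    then obtain f where f: "f \<in> paths_between X x x" "C = path_class X f"
      unfolding carrier_fundamental_group by auto
    then show "\<Phi> C \<in> carrier (fundamental_group A (r x))"
      using \<Phi>[OF f(1)] path_classI[OF paths_between_image[OF f(1) r]] by (simp add: carrier_fundamental_group')
    fix D assume "D \<in> carrier (fundamental_group X x)"
    then obtain g where g: "g \<in> paths_between X x x" "D = path_class X g"
      unfolding carrier_fundamental_group by auto
    show "\<Phi> (C \<otimes>\<^bsub>fundamental_group X x\<^esub> D) = \<Phi> C \<otimes>\<^bsub>fundamental_group A (r x)\<^esub> \<Phi> D"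
      using path_mult_class[OF f(1) g(1)] \<Phi>[OF paths_between_join[OF f(1) g(1)]] \<Phi>[OF f(1)] \<Phi>[OF g(1)]
        path_mult_class[OF paths_between_image[OF f(1) r] paths_between_image[OF g(1) r]]
      by (simp add: f g compose_joinpaths)
  qed
  have inj: "inj_on \<Phi> (carrier (fundamental_group X x))"
  proof (rule inj_onI)
    fix C D assume "C \<in> carrier (fundamental_group X x)" "D \<in> carrier (fundamental_group X x)" and eq: "\<Phi> C = \<Phi> D"
    then obtain f g where f: "f \<in> paths_between X x x" "C = path_class X f"
      and g: "g \<in> paths_between X x x" "D = path_class X g"
      unfolding carrier_fundamental_group by auto
    have "homotopic_paths A (r \<circ> f) (r \<circ> g)"
      using eq \<Phi>[OF f(1)] \<Phi>[OF g(1)] path_class_eqD[OF _ paths_between_image[OF g(1) r]] by (simp add: f g)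
    then have "path_class X (r \<circ> f) = path_class X (r \<circ> g)"
      by (rule path_class_eqI[OF homotopic_paths_subset[OF _ A]])
    then have "path_mult X C S = path_mult X D S"
      using square[OF f(1)] square[OF g(1)] by (simp add: f g)
    then have "path_mult X (path_mult X C S) (path_inv X S) = path_mult X (path_mult X D S) (path_inv X S)"
      by simp
    moreover have "path_mult X (path_mult X B S) (path_inv X S) = B" if "B \<in> path_classes X x x" for B
      using path_mult_assoc[OF that S path_inv(1)[OF S]] path_inv(2)[OF S] path_mult_one_right[OF that] by simp
    ultimately show "C = D" using path_classI[OF f(1)] path_classI[OF g(1)] by (simp add: f g)
  qed
  have surj: "\<exists>C\<in>carrier (fundamental_group X x). \<Phi> C = D"
    if D: "D \<in> carrier (fundamental_group A (r x))" for D
  proof -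
    obtain d where d: "d \<in> paths_between A (r x) (r x)" "D = path_class A d"
      using D unfolding carrier_fundamental_group by auto
    \<comment> \<open>Witness for surjectivity: the loop \<open>d\<close> conjugated back to
      \<open>x\<close> along the track.\<close>
    let ?g = "\<sigma> +++ (d +++ reversepath \<sigma>)"
    have g: "?g \<in> paths_between X x x"
      by (intro paths_between_join[OF \<sigma>] paths_between_join[OF AX[OF d(1)]] paths_between_reverse[OF \<sigma>])
    have fix1: "r (\<sigma> s) = r x" if "s \<in> {0..1}" for s
      using fibre[OF that x] by (simp add: r_def \<sigma>_def)
    have const: "path_class A f = path_class A (\<lambda>_. r x)" if "\<And>t. t \<in> {0..1} \<Longrightarrow> f t = r x" for f
      using that rx paths_between_const[OF rx]
      by (intro path_class_eqI[symmetric] homotopic_paths_eq) (auto simp: paths_between_def)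
    have rd: "path_class A (r \<circ> d) = path_class A d"
      using d(1) h1(2) paths_betweenD(5)[OF d(1)]
      by (intro path_class_eqI[symmetric] homotopic_paths_eq) (auto simp: paths_between_def r_def)
    note r\<sigma> = paths_between_image[OF \<sigma> r] and r\<sigma>' = paths_between_image[OF paths_between_reverse[OF \<sigma>] r]
      and rd' = paths_between_image[OF AX[OF d(1)] r]
    have "\<Phi> (path_class X ?g) = path_class A ((r \<circ> \<sigma>) +++ ((r \<circ> d) +++ (r \<circ> reversepath \<sigma>)))"
      using \<Phi>[OF g] by (simp add: compose_joinpaths)
    also have "\<dots> = path_mult A (path_class A (r \<circ> \<sigma>)) (path_mult A (path_class A (r \<circ> d)) (path_class A (r \<circ> reversepath \<sigma>)))"
      using path_mult_class[OF r\<sigma> paths_between_join[OF rd' r\<sigma>']] path_mult_class[OF rd' r\<sigma>'] by simp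
    also have "\<dots> = path_mult A (path_class A (\<lambda>_. r x)) (path_mult A (path_class A d) (path_class A (\<lambda>_. r x)))"
      using const[of "r \<circ> \<sigma>"] const[of "r \<circ> reversepath \<sigma>"] fix1 rd by (simp add: reversepath_def)
    also have "\<dots> = path_class A d"
      using path_mult_one_right[OF path_classI[OF d(1)]] path_mult_one_left[OF path_classI[OF d(1)]] by simp
    finally show ?thesis
      using d(2) path_classI[OF g] by (intro bexI[of _ "path_class X ?g"]) (auto simp: carrier_fundamental_group')
  qed
  have "\<Phi> \<in> iso (fundamental_group X x) (fundamental_group A (r x))"
    unfolding iso_def bij_betw_def using hom inj surj by (auto simp: hom_def)
  then have "\<exists>\<Psi>. \<Psi> \<in> iso (fundamental_group A (r x)) (fundamental_group X x)"
    using G.iso_sym unfolding is_iso_def by blast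
  then show ?thesis
    using free free_group_iso G.is_group unfolding r_def by blast
qed

section \<open>Homology of graphs\<close>

lemma trivial_homology_starlike:
  fixes C :: "('a \<Rightarrow> real) set"
  assumes z: "z \<in> C" and C: "\<And>x t. x \<in> C \<Longrightarrow> t \<in> {0..1} \<Longrightarrow> segment_path x z t \<in> C" and "p \<noteq> 0"
  shows "trivial_group (homology_group p (top_of_set C))"
proof -
  define h where "h = (\<lambda>q. segment_path (snd q) z (fst q))"
  have "continuous_on ({0..1} \<times> C) h"
    unfolding h_def
    by (rule continuous_on_segment_path) (rule continuous_on_const continuous_on_fst continuous_on_snd continuous_on_id)+
  then have "top_of_set C homotopy_equivalent_space top_of_set {z}"
  proof (rule deformation_homotopy_equivalent)
    show "h (t, x) \<in> C" if "t \<in> {0..1}" "x \<in> C" for t x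
      using C[OF that(2,1)] by (simp add: h_def)
  qed (use z in \<open>simp_all add: h_def\<close>)
  then have "homology_group p (top_of_set {z}) \<cong> homology_group p (top_of_set C)"
    by (rule homotopy_equivalent_space_imp_isomorphic_homology_groups[OF homotopy_equivalent_space_sym[THEN iffD1]])
  moreover have "trivial_group (homology_group p (top_of_set {z}))"
    by (rule homology_dimension_axiom[OF _ \<open>p \<noteq> 0\<close>]) simp
  ultimately show ?thesis
    using isomorphic_group_triviality1 group_relative_homology_group by blast
qed

text \<open>Disjoint pieces that are open in their union are also closed in it. So a path-connected
  set meets only one of them, which is what the additivity axiom asks for.\<close>

lemma trivial_homology_Union:
  assumes disj: "pairwise disjnt \<U>" and UU: "\<Union>\<U> = S"
    and opn: "\<And>T. T \<in> \<U> \<Longrightarrow> openin (top_of_set S) T"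
    and triv: "\<And>T. T \<in> \<U> \<Longrightarrow> trivial_group (homology_group p (top_of_set T))"
  shows "trivial_group (homology_group p (top_of_set S))"
proof -
  have sub: "subtopology (top_of_set S) T = top_of_set T" if "T \<in> \<U>" for T
    using that UU by (auto simp: subtopology_subtopology Int_absorb1 Sup_upper)
  have clo: "closedin (top_of_set S) T" if "T \<in> \<U>" for T
  proof -
    have "S - T = \<Union>(\<U> - {T})"
      using disj that UU by (auto simp: pairwise_def disjnt_iff)
    then have "openin (top_of_set S) (S - T)" using opn by auto
    then show ?thesis using that UU by (auto simp: closedin_def)
  qed
  have "(\<lambda>x. gfinprod (homology_group p (top_of_set S))
             (\<lambda>V. hom_induced p (subtopology (top_of_set S) V) {} (top_of_set S) {} id (x V)) \<U>)
      \<in> iso (sum_group \<U> (\<lambda>T. homology_group p (subtopology (top_of_set S) T))) (homology_group p (top_of_set S))"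
  proof (rule homology_additivity_axiom_gen[OF disj])
    fix C T assume "path_connectedin (top_of_set S) C" "T \<in> \<U>" "\<not> disjnt C T"
    then show "C \<subseteq> T"
      using connectedin_clopen_cases[OF path_connectedin_imp_connectedin clo opn] by blast
  qed (simp add: UU)
  then have "sum_group \<U> (\<lambda>T. homology_group p (subtopology (top_of_set S) T)) \<cong> homology_group p (top_of_set S)"
    by (auto simp: is_iso_def)
  moreover have "trivial_group (sum_group \<U> (\<lambda>T. homology_group p (subtopology (top_of_set S) T)))"
  proof -
    have "x \<in> {\<one>\<^bsub>sum_group \<U> (\<lambda>T. homology_group p (subtopology (top_of_set S) T))\<^esub>}"
      if "x \<in> carrier (sum_group \<U> (\<lambda>T. homology_group p (subtopology (top_of_set S) T)))" for x
      using that triv sub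
      by (auto simp: carrier_sum_group trivial_group_def PiE_iff extensional_def fun_eq_iff)
    then show ?thesis
      by (subst group.trivial_group_subset) auto
  qed
  ultimately show ?thesis
    using isomorphic_group_triviality1 group_relative_homology_group by blast
qed

lemma exact_seq_trivial:
  assumes "exact_seq ([C, B, A], [g, f])" "trivial_group A" "trivial_group C"
  shows "trivial_group B"
proof -
  have hom: "group A" "group B" "group C" "f \<in> hom A B" "g \<in> hom B C" and ker: "kernel B C g = f ` carrier A"
    using assms(1) by (auto simp: group_hom_def group_hom_axioms_def)
  have "f ` carrier A = {\<one>\<^bsub>B\<^esub>}"
    using assms(2) hom by (auto simp: trivial_group_def hom_one)
  moreover have "kernel B C g = carrier B"
    using assms(3) hom by (auto simp: trivial_group_def kernel_def hom_def)
  ultimately show ?thesis using ker hom by (simp add: trivial_group_def)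
qed

lemma segment_path_gt:
  assumes "c < x a" "c < z a" "t \<in> {0..1}"
  shows "c < segment_path x z t a"
  using convex_bound_lt[of "- x a" "- c" "- z a" "1 - t" t] assms by (simp add: segment_path_def)

lemma support_segment_path:
  assumes "x \<in> realization K" "z \<in> realization K" "support x = e" "support z = e" "t \<in> {0..1}"
  shows "support (segment_path x z t) = e"
proof -
  have pos: "0 < segment_path x z t v" if "v \<in> e" for v
  proof (rule segment_path_gt[OF _ _ assms(5)])
    have "v \<in> support x" "v \<in> support z" using that assms(3,4) by simp_all
    then show "0 < x v" "0 < z v"
      using realizationD(3)[OF assms(1), of v] realizationD(3)[OF assms(2), of v] by (simp_all add: support_def)
  qed
  have zero: "segment_path x z t v = 0" if "v \<notin> e" for v
  proof -
    have "v \<notin> support x" "v \<notin> support z" using that assms(3,4) by simp_all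
    then show ?thesis by (simp add: support_def segment_path_def)
  qed
  show ?thesis
  proof (rule Set.set_eqI)
    show "v \<in> support (segment_path x z t) \<longleftrightarrow> v \<in> e" for v
      using pos[of v] zero[of v] by (cases "v \<in> e") (simp_all add: support_def)
  qed
qed

context complex
begin

lemma sum_support: "x \<in> X \<Longrightarrow> sum x (support x) = 1"
  using realizationD(2)[of x K] by (simp add: simplex_points_def)

lemma segment_same_support:
  assumes "x \<in> X" "z \<in> X" "support x = support z" "t \<in> {0..1}"
  shows "segment_path x z t \<in> X"
  using realizationD[OF assms(1)] realizationD[OF assms(2)] assms(3,4) by (intro segment_in_realization) auto

lemma coordinates_le_one:
  assumes "x \<in> X" "a \<noteq> b"
  shows "x a + x b \<le> 1"
proof -
  have fin: "finite (support x \<union> {a, b})" using abstract_complexD(1)[OF K realizationD(1)[OF assms(1)]] by simp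
  have "sum x {a, b} \<le> sum x (support x \<union> {a, b})"
    using fin realizationD(3)[OF assms(1)] by (intro sum_mono2) auto
  also have "\<dots> = sum x (support x)"
    using fin by (intro sum.mono_neutral_right) (auto simp: support_def)
  finally show ?thesis using sum_support[OF assms(1)] assms(2) by simp
qed

lemma edge_point:
  assumes "{a, b} \<in> K" "a \<noteq> b" "0 < c" "c < 1"
  shows "segment_path (vertex_point a) (vertex_point b) c \<in> X"
    and "support (segment_path (vertex_point a) (vertex_point b) c) = {a, b}"
    and "segment_path (vertex_point a) (vertex_point b) c a = 1 - c"
proof -
  show "segment_path (vertex_point a) (vertex_point b) c \<in> X"
    using assms by (intro segment_in_realization[of _ "{a, b}"] vertex_point_simplex) auto
qed (use assms in \<open>auto simp: support_def segment_path_def vertex_point_def split: if_splits\<close>)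

text \<open>Degree 2 matters through the boundary map: the relative group of
  \<open>(W, U \<inter> W)\<close> sits between degree 2 of \<open>W\<close> and degree 1 of
  \<open>U \<inter> W\<close>, and star-shaped pieces have no homology in either of these non-zero
  degrees.\<close>

theorem trivial_homology_graph:
  assumes dim: "\<And>\<sigma>. \<sigma> \<in> K \<Longrightarrow> card \<sigma> \<le> 2"
  shows "trivial_group (homology_group 2 (top_of_set X))"
proof -
  \<comment> \<open>\<open>V\<close> consists of the vertices, \<open>W\<close> of the open edges,
    and \<open>U\<close> omits exactly the edge midpoints. Two coordinates cannot both exceed 1/2,
    so \<open>U\<close> falls apart into one star for each vertex.\<close>
  define V where "V = {x \<in> X. card (support x) = 1}"
  define U where "U = {x \<in> X. \<exists>a. 1/2 < x a}"
  define W where "W = {x \<in> X. card (support x) = 2}"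
  have fin: "finite (support x)" and ne: "support x \<noteq> {}" if "x \<in> X" for x
    using abstract_complexD(1,2)[OF K realizationD(1)[OF that]] by blast+
  \<comment> \<open>In dimension one, two positive coordinates determine the support; this makes
    open edges open in \<open>X\<close>.\<close>
  have supp2: "support x = {a, b}" if "x \<in> X" "0 < x a" "0 < x b" "a \<noteq> b" for x a b
    using that fin[OF that(1)] dim[OF realizationD(1)[OF that(1)]]
    by (intro card_seteq[symmetric]) (auto simp: support_def)
  have pos: "0 < x a" if "x \<in> X" "a \<in> support x" for x a
    using that realizationD(3)[OF that(1), of a] by (simp add: support_def)
  have card_cases: "card (support x) = 1 \<or> card (support x) = 2" if "x \<in> X" for x
    using dim[OF realizationD(1)[OF that]] fin[OF that] ne[OF that] by (cases "card (support x)") auto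
  have "card (support x) \<noteq> 1 \<longleftrightarrow> card (support x) = 2" if "x \<in> X" for x
    using card_cases[OF that] by auto
  then have XV: "X - V = W" unfolding V_def W_def by blast
  have W_eq: "W = X \<inter> (\<Union>a. \<Union>b\<in>-{a}. {x. 0 < x a} \<inter> {x. 0 < x b})"
  proof (intro equalityI subsetI)
    fix x assume "x \<in> W"
    then have x: "x \<in> X" "card (support x) = 2" by (auto simp: W_def)
    then obtain a b where ab: "support x = {a, b}" "a \<noteq> b" by (auto simp: card_2_iff)
    then have "0 < x a" "0 < x b" using pos[OF x(1), of a] pos[OF x(1), of b] by simp_all
    then show "x \<in> X \<inter> (\<Union>a. \<Union>b\<in>-{a}. {x. 0 < x a} \<inter> {x. 0 < x b})"
      using x(1) ab(2) by blast
  next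
    fix x assume "x \<in> X \<inter> (\<Union>a. \<Union>b\<in>-{a}. {x. 0 < x a} \<inter> {x. 0 < x b})"
    then obtain a b where "x \<in> X" "a \<noteq> b" "0 < x a" "0 < x b" by auto
    then show "x \<in> W" using supp2[of x a b] by (simp add: W_def)
  qed
  have "open (\<Union>a. \<Union>b\<in>-{a}. {x. 0 < x a} \<inter> {x :: 'a \<Rightarrow> real. 0 < x b})"
    by (intro open_UN ballI open_Int open_coordinate_gt)
  then have W_open: "openin (top_of_set X) W" unfolding W_eq by (rule openin_open_Int)
  then have V_closed: "closedin (top_of_set X) V"
    unfolding closedin_def XV[symmetric] by (auto simp: V_def)
  have U_eq: "U = X \<inter> (\<Union>a. {x. 1/2 < x a})" by (auto simp: U_def)
  have "open (\<Union>a. {x :: 'a \<Rightarrow> real. 1/2 < x a})" by (intro open_UN ballI open_coordinate_gt)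
  then have U_open: "openin (top_of_set X) U" unfolding U_eq by (rule openin_open_Int)
  have VU: "V \<subseteq> U"
  proof
    fix x assume "x \<in> V"
    then have x: "x \<in> X" "card (support x) = 1" by (auto simp: V_def)
    then obtain a where "support x = {a}" by (auto simp: card_1_singleton_iff)
    then have "x a = 1" using sum_support[OF x(1)] by simp
    then show "x \<in> U" using x by (auto simp: U_def intro!: exI[of _ a])
  qed
  have U_triv: "trivial_group (homology_group p (top_of_set U))" if "p \<noteq> 0" for p
  proof (rule trivial_homology_Union)
    let ?\<U> = "(\<lambda>a. {x \<in> X. 1/2 < x a}) ` {a. {a} \<in> K}"
    show "pairwise disjnt ?\<U>"
    proof (rule pairwise_imageI)
      fix a b :: 'a assume "a \<noteq> b"
      have False if "x \<in> X" "1/2 < x a" "1/2 < x b" for x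
        using coordinates_le_one[OF that(1) \<open>a \<noteq> b\<close>] that(2,3) by simp
      then show "disjnt {x \<in> X. 1/2 < x a} {x \<in> X. 1/2 < x b}"
        unfolding disjnt_iff by blast
    qed
    have "{a} \<in> K" if "x \<in> X" "1/2 < x a" for x a
      using face(2)[OF realizationD(1)[OF that(1)], of a] that(2) by (simp add: support_def)
    then show "\<Union>?\<U> = U" unfolding U_def by blast
    fix T assume "T \<in> ?\<U>"
    then obtain a where a: "{a} \<in> K" "T = {x \<in> X. 1/2 < x a}" by auto
    have T: "T = U \<inter> {x. 1/2 < x a}" by (auto simp: a(2) U_def)
    show "openin (top_of_set U) T" unfolding T by (intro openin_open_Int open_Int open_coordinate_gt)
    show "trivial_group (homology_group p (top_of_set T))"
    proof (rule trivial_homology_starlike[OF _ _ that])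
      show "vertex_point a \<in> T" using vertex_point_in[OF a(1)] by (simp add: a(2) vertex_point_def)
      fix x t assume x: "x \<in> T" and t: "t \<in> {0..1::real}"
      then have "a \<in> support x" by (auto simp: a(2) support_def)
      with x t have "segment_path x (vertex_point a) t \<in> X"
        using realizationD[of x K] by (intro segment_in_realization[of _ "support x"] vertex_point_simplex) (auto simp: a(2))
      moreover have "1/2 < segment_path x (vertex_point a) t a"
        using x t by (intro segment_path_gt) (simp_all add: a(2) vertex_point_def)
      ultimately show "segment_path x (vertex_point a) t \<in> T" by (simp add: a(2))
    qed
  qed
  have W_triv: "trivial_group (homology_group p (top_of_set W))" if "p \<noteq> 0" for p
  proof (rule trivial_homology_Union)
    let ?\<U> = "(\<lambda>e. {x \<in> X. support x = e}) ` {e \<in> K. card e = 2}"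
    show "pairwise disjnt ?\<U>" by (auto simp: pairwise_def disjnt_iff)
    show "\<Union>?\<U> = W" using realizationD(1)[of _ K] unfolding W_def by blast
    fix T assume "T \<in> ?\<U>"
    then obtain a b where ab: "{a, b} \<in> K" "a \<noteq> b" "T = {x \<in> X. support x = {a, b}}"
      by (auto simp: card_2_iff)
    have T: "T = W \<inter> ({x. 0 < x a} \<inter> {x. 0 < x b})"
    proof (intro equalityI subsetI)
      fix x assume "x \<in> T"
      then show "x \<in> W \<inter> ({x. 0 < x a} \<inter> {x. 0 < x b})"
        using pos[of x a] pos[of x b] ab(2) by (simp add: ab(3) W_def)
    next
      fix x assume "x \<in> W \<inter> ({x. 0 < x a} \<inter> {x. 0 < x b})"
      then show "x \<in> T" using supp2[of x a b] ab(2) by (simp add: ab(3) W_def)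
    qed
    show "openin (top_of_set W) T" unfolding T by (intro openin_open_Int open_Int open_coordinate_gt)
    show "trivial_group (homology_group p (top_of_set T))"
    proof (rule trivial_homology_starlike[OF _ _ that])
      note z = edge_point[OF ab(1,2), of "1/2", simplified]
      show "segment_path (vertex_point a) (vertex_point b) (1/2) \<in> T"
        using z by (simp add: ab(3))
      fix x t assume "x \<in> T" "t \<in> {0..1::real}"
      then show "segment_path x (segment_path (vertex_point a) (vertex_point b) (1/2)) t \<in> T"
        using z segment_same_support[of x _ t] support_segment_path[of x K _ "{a, b}" t] by (simp add: ab(3))
    qed
  qed
  have UW_triv: "trivial_group (homology_group p (top_of_set (U \<inter> W)))" if "p \<noteq> 0" for p
  proof (rule trivial_homology_Union)
    \<comment> \<open>One piece for each half-edge: an edge together with the end that carries more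
      than half of the weight.\<close>
    let ?\<U> = "(\<lambda>(e, a). {x \<in> X. support x = e \<and> 1/2 < x a}) ` {(e, a). e \<in> K \<and> card e = 2 \<and> a \<in> e}"
    show "pairwise disjnt ?\<U>"
    proof (rule pairwise_imageI)
      fix q q' :: "'a set \<times> 'a" assume "q \<noteq> q'"
      obtain e a e' b where q: "q = (e, a)" "q' = (e', b)" by (cases q; cases q')
      have False if x: "x \<in> X" "support x = e" "1/2 < x a" "support x = e'" "1/2 < x b" for x
      proof -
        have "a \<noteq> b" using \<open>q \<noteq> q'\<close> x(2,4) by (auto simp: q)
        then show False using coordinates_le_one[OF x(1)] x(3,5) by fastforce
      qed
      then show "disjnt (case q of (e, a) \<Rightarrow> {x \<in> X. support x = e \<and> 1/2 < x a})
          (case q' of (e, a) \<Rightarrow> {x \<in> X. support x = e \<and> 1/2 < x a})"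
        unfolding disjnt_iff q prod.case by blast
    qed
    have sup: "a \<in> support x" if "1/2 < x a" for x :: "'a \<Rightarrow> real" and a
      using that by (simp add: support_def)
    show "\<Union>?\<U> = U \<inter> W"
    proof (intro equalityI subsetI)
      fix x assume "x \<in> U \<inter> W"
      then obtain a where "x \<in> X" "1/2 < x a" "card (support x) = 2" by (auto simp: U_def W_def)
      then show "x \<in> \<Union>?\<U>"
        using realizationD(1)[of x K] sup[of x a] by (intro UnionI[OF imageI[of "(support x, a)"]]) simp_all
    next
      fix x assume "x \<in> \<Union>?\<U>"
      then show "x \<in> U \<inter> W" unfolding U_def W_def by auto
    qed
    fix T assume "T \<in> ?\<U>"
    then obtain e a where e: "e \<in> K" "card e = 2" "a \<in> e" "T = {x \<in> X. support x = e \<and> 1/2 < x a}"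
      by auto
    then obtain b where b: "e = {a, b}" "a \<noteq> b" by (auto simp: card_2_iff)
    note ab = e(1)[unfolded b(1)] b(2) e(4)[unfolded b(1)]
    have T: "T = (U \<inter> W) \<inter> ({x. 1/2 < x a} \<inter> {x. 0 < x b})"
    proof (intro equalityI subsetI)
      fix x assume "x \<in> T"
      then show "x \<in> (U \<inter> W) \<inter> ({x. 1/2 < x a} \<inter> {x. 0 < x b})"
        using pos[of x b] ab(2) unfolding ab(3) W_def U_def by auto
    next
      fix x assume "x \<in> (U \<inter> W) \<inter> ({x. 1/2 < x a} \<inter> {x. 0 < x b})"
      then show "x \<in> T" using supp2[of x a b] ab(2) by (simp add: ab(3) W_def)
    qed
    show "openin (top_of_set (U \<inter> W)) T"
      unfolding T by (intro openin_open_Int open_Int open_coordinate_gt)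
    show "trivial_group (homology_group p (top_of_set T))"
    proof (rule trivial_homology_starlike[OF _ _ that])
      \<comment> \<open>The centre must lie in the half of the edge belonging to \<open>a\<close>:
        at parameter 1/4 its coordinate at \<open>a\<close> is 3/4.\<close>
      note z = edge_point[OF ab(1,2), of "1/4", simplified]
      show "segment_path (vertex_point a) (vertex_point b) (1/4) \<in> T"
        using z by (simp add: ab(3))
      fix x t assume "x \<in> T" "t \<in> {0..1::real}"
      then show "segment_path x (segment_path (vertex_point a) (vertex_point b) (1/4)) t \<in> T"
        using z segment_same_support[of x _ t] support_segment_path[of x K _ "{a, b}" t]
          segment_path_gt[of "1/2" x a _ t] by (simp add: ab(3))
    qed
  qed
  have "W \<subseteq> X" "U \<subseteq> X" by (auto simp: W_def U_def)
  then have subW: "subtopology (top_of_set X) W = top_of_set W" "subtopology (top_of_set X) U = top_of_set U"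
    "subtopology (top_of_set W) (U \<inter> W) = top_of_set (U \<inter> W)"
    by (simp_all add: subtopology_subtopology Int_absorb1)
  have "trivial_group (relative_homology_group 2 (top_of_set W) (U \<inter> W))"
    by (rule exact_seq_trivial[OF homology_exactness_axiom_1]) (simp_all add: subW W_triv UW_triv)
  \<comment> \<open>Excision of \<open>V\<close>, which is closed and contained in the open set
    \<open>U\<close>.\<close>
  moreover have "relative_homology_group 2 (subtopology (top_of_set X) (X - V)) (U - V)
       \<cong> relative_homology_group 2 (subtopology (top_of_set X) X) U"
    unfolding is_iso_def
    using homology_excision_axiom[of "top_of_set X" V U X 2] V_closed U_open VU
    unfolding closure_of_closedin[OF V_closed] interior_of_openin[OF U_open]
    using VU \<open>U \<subseteq> X\<close> by blast
  moreover have "U - V = U \<inter> W" using XV \<open>U \<subseteq> X\<close> by blast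
  moreover have "subtopology (top_of_set X) X = top_of_set X" by (simp add: subtopology_subtopology)
  ultimately have rel: "trivial_group (relative_homology_group 2 (top_of_set X) U)"
    unfolding XV subW using isomorphic_group_triviality1 group_relative_homology_group by metis
  show ?thesis
    by (rule exact_seq_trivial[OF homology_exactness_axiom_3[of 2 "top_of_set X" U]])
      (simp_all add: subW U_triv rel)
qed

end

section \<open>Elementary collapses\<close>

text \<open>Projection of the triangle onto the edges \<open>{a, c}\<close> and
  \<open>{b, c}\<close>, parallel to its median through \<open>c\<close>: the weight
  \<open>min (x a) (x b)\<close> is taken off at \<open>a\<close> and at \<open>b\<close> and added
  twice at \<open>c\<close>. Points of the realization with coordinate 0 at \<open>a\<close> or
  \<open>b\<close> stay fixed, so one continuous formula serves the whole complex.\<close>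

definition push :: "'a \<Rightarrow> 'a \<Rightarrow> 'a \<Rightarrow> ('a \<Rightarrow> real) \<Rightarrow> 'a \<Rightarrow> real" where
  "push a b c x = (\<lambda>v. x v - min (x a) (x b) * (if v = a \<or> v = b then 1 else if v = c then - 2 else 0))"

lemma continuous_on_push: "continuous_on A (push a b c)"
proof (rule continuous_on_coordinatewise_then_product)
  fix v
  have coord: "continuous_on A (\<lambda>x. x w)" for w :: 'a
    by (rule continuous_on_coordinate[OF continuous_on_id])
  show "continuous_on A (\<lambda>x. push a b c x v)"
    unfolding push_def
    by (rule continuous_on_diff continuous_on_mult continuous_on_min continuous_on_const coord)+
qed

text \<open>On the way to its image a point has lost the fraction \<open>t\<close> of
  \<open>min (x a) (x b)\<close>, and pushing takes off the rest. So all points of a track have the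
  same image, which is the hypothesis \<open>fibre\<close> of
  \<open>deformation_fundamental_group\<close>.\<close>

lemma push_segment:
  assumes "a \<noteq> c" "b \<noteq> c" "t \<le> 1"
  shows "push a b c (segment_path x (push a b c x) t) = push a b c x"
proof -
  define m where "m = min (x a) (x b)"
  define k where "k = (\<lambda>v. if v = a \<or> v = b then 1 else if v = c then - 2 else 0 :: real)"
  define y where "y = segment_path x (push a b c x) t"
  have push: "push a b c z v = z v - min (z a) (z b) * k v" for z v
    by (simp add: push_def k_def)
  have y: "y v = x v - t * m * k v" for v
    by (simp add: y_def segment_path_def push m_def[symmetric] algebra_simps)
  have min: "min (y a) (y b) = m - t * m"
    unfolding y using assms(1,2) by (simp add: m_def k_def min_def)
  have "push a b c y v = push a b c x v" for v
    unfolding push min m_def[symmetric] by (simp add: y algebra_simps)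
  then show ?thesis by (simp add: y_def fun_eq_iff)
qed

lemma push_in_simplex:
  assumes "x \<in> simplex_points {a, b, c}" "a \<noteq> b" "a \<noteq> c" "b \<noteq> c"
  shows "push a b c x \<in> simplex_points {b, c} \<union> simplex_points {a, c}"
proof -
  have x: "\<And>v. 0 \<le> x v" "\<And>v. v \<notin> {a, b, c} \<Longrightarrow> x v = 0" "x a + x b + x c = 1"
    using assms by (auto simp: simplex_points_def support_def)
  show ?thesis
  proof (cases "x a \<le> x b")
    case True
    then have "push a b c x = (\<lambda>v. if v = b then x b - x a else if v = c then x c + 2 * x a else 0)"
      using assms x(2) by (auto simp: push_def fun_eq_iff)
    then have "push a b c x \<in> simplex_points {b, c}"
      using True x assms by (auto simp: simplex_points_def support_def)
    then show ?thesis by simp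
  next
    case False
    then have "push a b c x = (\<lambda>v. if v = a then x a - x b else if v = c then x c + 2 * x b else 0)"
      using assms x(2) by (auto simp: push_def fun_eq_iff)
    then have "push a b c x \<in> simplex_points {a, c}"
      using False x assms by (auto simp: simplex_points_def support_def)
    then show ?thesis by simp
  qed
qed

locale elementary_collapse = complex +
  fixes a b c :: 'a
  assumes dist: "a \<noteq> b" "a \<noteq> c" "b \<noteq> c"
    and triangle: "{a, b, c} \<in> K"
    and free: "\<sigma> \<in> K \<Longrightarrow> a \<in> \<sigma> \<Longrightarrow> b \<in> \<sigma> \<Longrightarrow> \<sigma> = {a, b} \<or> \<sigma> = {a, b, c}"
begin

definition "K' = K - {{a, b}, {a, b, c}}"

text \<open>No remaining simplex contains both \<open>a\<close> and \<open>b\<close>, so neither of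
  the removed simplices is a face of a remaining one.\<close>

lemma collapsed_complex: "abstract_complex K'"
proof -
  have "\<tau> \<in> K'" if "\<sigma> \<in> K'" "\<tau> \<subseteq> \<sigma>" "\<tau> \<noteq> {}" for \<sigma> \<tau>
  proof -
    have "\<sigma> \<in> K" using that(1) by (simp add: K'_def)
    then have "\<tau> \<in> K" using abstract_complexD(3)[OF K] that by blast
    moreover have "\<not> (a \<in> \<sigma> \<and> b \<in> \<sigma>)" using free[OF \<open>\<sigma> \<in> K\<close>] that(1) by (auto simp: K'_def)
    ultimately show ?thesis using that(2) by (auto simp: K'_def)
  qed
  moreover have "finite \<sigma> \<and> \<sigma> \<noteq> {}" if "\<sigma> \<in> K'" for \<sigma>
    using abstract_complexD(1,2)[OF K, of \<sigma>] that by (simp add: K'_def)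
  ultimately show ?thesis unfolding abstract_complex_def by blast
qed

lemma edges_remain: "{a, c} \<in> K'" "{b, c} \<in> K'"
  using face(1)[OF triangle, of a c] face(1)[OF triangle, of b c] dist by (auto simp: K'_def)

lemma collapsed_subset: "realization K' \<subseteq> X"
  by (auto simp: realization_def K'_def)

lemma push_cases:
  assumes "x \<in> X"
  obtains "push a b c x = x" "x \<in> realization K'"
  | "x \<in> simplex_points {a, b, c}" "push a b c x \<in> realization K'"
proof (cases "a \<in> support x \<and> b \<in> support x")
  case True
  then have "support x \<subseteq> {a, b, c}" using free[OF realizationD(1)[OF assms]] by blast
  then have x: "x \<in> simplex_points {a, b, c}"
    using simplex_points_mono[of "support x" "{a, b, c}"] realizationD(2)[OF assms] by blast
  have "push a b c x \<in> realization K'"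
    using push_in_simplex[OF x dist] simplex_points_subset_realization[OF collapsed_complex] edges_remain by blast
  with x show ?thesis by (rule that(2))
next
  case False
  then have "min (x a) (x b) = 0"
    using realizationD(3)[OF assms, of a] realizationD(3)[OF assms, of b] by (auto simp: support_def)
  then have "push a b c x = x" by (simp add: push_def fun_eq_iff)
  moreover have "support x \<noteq> {a, b}" "support x \<noteq> {a, b, c}" using False by auto
  then have "x \<in> realization K'" using assms by (simp add: realization_def K'_def support_def)
  ultimately show ?thesis by (rule that(1))
qed

lemma push_in_collapsed: "x \<in> X \<Longrightarrow> push a b c x \<in> realization K'"
  by (erule push_cases) simp_all

lemma push_fixed:
  assumes "x \<in> realization K'"
  shows "push a b c x = x"
proof -
  have "support x \<in> K" "support x \<noteq> {a, b}" "support x \<noteq> {a, b, c}"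
    using realizationD(1)[OF assms] by (auto simp: K'_def)
  then have "\<not> (a \<in> support x \<and> b \<in> support x)" using free by blast
  then have "min (x a) (x b) = 0"
    using realizationD(3)[OF assms, of a] realizationD(3)[OF assms, of b] by (auto simp: support_def)
  then show ?thesis by (simp add: push_def fun_eq_iff)
qed

lemma push_homotopy:
  assumes "x \<in> X" "t \<in> {0..1}"
  shows "segment_path x (push a b c x) t \<in> X"
  using assms(1)
proof (cases rule: push_cases)
  case 2
  have "simplex_points {b, c} \<union> simplex_points {a, c} \<subseteq> simplex_points {a, b, c}"
    using simplex_points_mono[of "{b, c}" "{a, b, c}"] simplex_points_mono[of "{a, c}" "{a, b, c}"] by auto
  then have "push a b c x \<in> simplex_points {a, b, c}"
    using push_in_simplex[OF 2(1) dist] by blast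
  then show ?thesis using 2(1) assms(2) triangle by (intro segment_in_realization) auto
qed (use assms in simp)

lemma push_homotopy_continuous:
  "continuous_on A (\<lambda>q. segment_path (snd q) (push a b c (snd q)) (fst q))"
  by (rule continuous_on_segment_path continuous_on_snd continuous_on_fst continuous_on_id
      continuous_on_compose2[OF continuous_on_push[of UNIV]] subset_UNIV)+

lemma free_fundamental_group_collapse:
  assumes "x \<in> X" "\<And>y. y \<in> realization K' \<Longrightarrow> free_group (fundamental_group (realization K') y)"
  shows "free_group (fundamental_group X x)"
proof (rule deformation_fundamental_group[OF push_homotopy_continuous _ _ collapsed_subset])
  show "free_group (fundamental_group (realization K') (segment_path (snd (1, x)) (push a b c (snd (1, x))) (fst (1, x))))"
    using assms push_in_collapsed by simp
qed (use assms push_in_collapsed push_fixed push_homotopy push_segment dist in auto)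

lemma trivial_homology_collapse:
  assumes "trivial_group (homology_group p (top_of_set (realization K')))"
  shows "trivial_group (homology_group p (top_of_set X))"
proof -
  have "top_of_set X homotopy_equivalent_space top_of_set (realization K')"
    by (rule deformation_homotopy_equivalent[OF push_homotopy_continuous _ _ collapsed_subset])
      (use push_in_collapsed push_fixed push_homotopy in auto)
  then have "homology_group p (top_of_set (realization K')) \<cong> homology_group p (top_of_set X)"
    by (rule homotopy_equivalent_space_imp_isomorphic_homology_groups[OF homotopy_equivalent_space_sym[THEN iffD1]])
  then show ?thesis
    using assms isomorphic_group_triviality1 group_relative_homology_group by blast
qed

end

section \<open>Induction over the collapses\<close>

definition triangles :: "'a set set \<Rightarrow> 'a set set" where
  "triangles K = {\<sigma> \<in> K. card \<sigma> = 3}"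

definition has_free_edge :: "'a set set \<Rightarrow> bool" where
  "has_free_edge S \<longleftrightarrow> (\<exists>\<tau>\<in>S. \<exists>e. e \<subseteq> \<tau> \<and> card e = 2 \<and> (\<forall>\<sigma>\<in>S. e \<subseteq> \<sigma> \<longrightarrow> \<sigma> = \<tau>))"

text \<open>Free edges are assumed for every nonempty set of triangles, so the assumption survives
  when a collapse removes a triangle. Freeness at all points is what the induction can use, since a
  collapse moves the base point.\<close>

theorem free_fundamental_group_and_trivial_homology:
  fixes K :: "'a::linorder set set"
  assumes "abstract_complex K" "\<And>\<sigma>. \<sigma> \<in> K \<Longrightarrow> card \<sigma> \<le> 3" "finite (triangles K)"
    and "\<And>a b. {a} \<in> K \<Longrightarrow> {b} \<in> K \<Longrightarrow> (a, b) \<in> {(a, b). {a, b} \<in> K}\<^sup>*"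
    and "\<And>S. S \<subseteq> triangles K \<Longrightarrow> S \<noteq> {} \<Longrightarrow> has_free_edge S"
  shows "(\<forall>x\<in>realization K. free_group (fundamental_group (realization K) x)) \<and>
    trivial_group (homology_group 2 (top_of_set (realization K)))"
  using assms
proof (induction "card (triangles K)" arbitrary: K)
  case 0
  then have "triangles K = {}" by simp
  then have dim: "card \<sigma> \<le> 2" if "\<sigma> \<in> K" for \<sigma>
    using 0(3)[OF that] that by (cases "card \<sigma> = 3") (auto simp: triangles_def)
  interpret complex K by unfold_locales (rule 0)
  have "free_group (fundamental_group (realization K) x)" if x: "x \<in> realization K" for x
  proof -
    interpret graph K x by unfold_locales (use dim x 0(5) in auto)
    show ?thesis by (rule free_fundamental_group_graph)
  qed
  then show ?case using trivial_homology_graph[OF dim] by blast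
next
  case (Suc n)
  have "triangles K \<noteq> {}" using Suc.hyps(2) by auto
  then have "has_free_edge (triangles K)" by (rule Suc.prems(5)[OF order_refl])
  then obtain \<tau> e where \<tau>: "\<tau> \<in> triangles K" "e \<subseteq> \<tau>" "card e = 2"
    and free: "\<forall>\<sigma>\<in>triangles K. e \<subseteq> \<sigma> \<longrightarrow> \<sigma> = \<tau>"
    unfolding has_free_edge_def by (elim bexE exE conjE)
  have \<tau>K: "\<tau> \<in> K" "card \<tau> = 3" using \<tau>(1) by (auto simp: triangles_def)
  obtain a b where ab: "e = {a, b}" "a \<noteq> b" using \<tau>(3) by (auto simp: card_2_iff)
  have "card (\<tau> - e) = 1"
    using \<tau>(2,3) \<tau>K(2) card_Diff_subset[of e \<tau>] ab(1) by simp
  then obtain c where c: "\<tau> - e = {c}" by (auto simp: card_1_singleton_iff)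
  then have abc: "\<tau> = {a, b, c}" "a \<noteq> c" "b \<noteq> c" using \<tau>(2) ab(1) by auto
  interpret complex K by unfold_locales (rule Suc)
  interpret elementary_collapse K a b c
  proof
    fix \<sigma> assume \<sigma>: "\<sigma> \<in> K" "a \<in> \<sigma>" "b \<in> \<sigma>"
    then have e: "e \<subseteq> \<sigma>" by (simp add: ab)
    have fin: "finite \<sigma>" by (rule abstract_complexD(1)[OF K \<sigma>(1)])
    then have "2 \<le> card \<sigma>" using card_mono[OF fin e] \<tau>(3) by simp
    then consider "card \<sigma> = 2" | "card \<sigma> = 3" using Suc.prems(2)[OF \<sigma>(1)] by linarith
    then show "\<sigma> = {a, b} \<or> \<sigma> = {a, b, c}"
    proof cases
      case 1
      then show ?thesis using card_subset_eq[OF fin e] \<tau>(3) ab(1) by simp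
    next
      case 2
      then show ?thesis using bspec[OF free, of \<sigma>] \<sigma>(1) e abc(1) by (simp add: triangles_def)
    qed
  qed (use ab abc \<tau>K in auto)
  have tri: "triangles K' = triangles K - {\<tau>}"
  proof -
    have "card {a, b} \<noteq> 3" using ab(2) by simp
    then show ?thesis unfolding triangles_def K'_def abc(1) by auto
  qed
  have vert: "{v} \<in> K" if "{v} \<in> K'" for v using that by (simp add: K'_def)
  have "{(x, y). {x, y} \<in> K} \<subseteq> {(x, y). {x, y} \<in> K'}\<^sup>*"
  proof clarify
    fix x y assume xy: "{x, y} \<in> K"
    show "(x, y) \<in> {(x, y). {x, y} \<in> K'}\<^sup>*"
    proof (cases "{x, y} \<in> K'")
      case False
      moreover have "card {x, y} \<noteq> 3" using card_insert_le_m1[of 2 "{y}" x] by (auto simp: card_insert_if)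
      then have "{x, y} \<noteq> {a, b, c}" using \<tau>K(2) abc(1) by auto
      ultimately have "{x, y} = {a, b}" using xy by (auto simp: K'_def)
      \<comment> \<open>The way round over \<open>c\<close> replaces the removed edge and keeps the
        collapsed complex connected.\<close>
      then have "{x, c} \<in> K'" "{c, y} \<in> K'"
        using edges_remain by (auto simp: doubleton_eq_iff insert_commute)
      then have "(x, c) \<in> {(x, y). {x, y} \<in> K'}" "(c, y) \<in> {(x, y). {x, y} \<in> K'}" by simp_all
      then show ?thesis by (rule rtrancl_into_rtrancl[OF r_into_rtrancl])
    qed (simp add: r_into_rtrancl)
  qed
  then have conn: "{(x, y). {x, y} \<in> K}\<^sup>* \<subseteq> {(x, y). {x, y} \<in> K'}\<^sup>*"
    by (rule rtrancl_subset_rtrancl)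
  have "(\<forall>x\<in>realization K'. free_group (fundamental_group (realization K') x)) \<and>
    trivial_group (homology_group 2 (top_of_set (realization K')))"
  proof (rule Suc.hyps(1)[OF _ collapsed_complex])
    show "n = card (triangles K')"
      using Suc.hyps(2) Suc.prems(3) \<tau>(1) by (simp add: tri)
    show "card \<sigma> \<le> 3" if "\<sigma> \<in> K'" for \<sigma> using that Suc.prems(2) by (simp add: K'_def)
    show "finite (triangles K')" using Suc.prems(3) by (simp add: tri)
    show "(x, y) \<in> {(a, b). {a, b} \<in> K'}\<^sup>*" if "{x} \<in> K'" "{y} \<in> K'" for x y
      using Suc.prems(4)[OF vert[OF that(1)] vert[OF that(2)]] conn by blast
    show "has_free_edge S" if "S \<subseteq> triangles K'" "S \<noteq> {}" for S
      using that tri by (intro Suc.prems(5)) auto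
  qed
  then show ?case
    using free_fundamental_group_collapse trivial_homology_collapse by blast
qed

section \<open>Sets of triangles without free edges\<close>

text \<open>A set that has stopped growing witnesses the second alternative for all larger
  \<open>k\<close> too. So the step only has to treat a set of \<open>k + 1\<close> triangles, which
  is either closed by now or has a neighbour to be added.\<close>

lemma linked_triangles:
  assumes S: "\<And>\<sigma>. \<sigma> \<in> S \<Longrightarrow> finite \<sigma> \<and> card \<sigma> = 3" and "S \<noteq> {}"
  shows "(\<exists>R\<subseteq>S. finite R \<and> card R = Suc k \<and> card (\<Union>R) \<le> k + 3) \<or>
    (\<exists>R\<subseteq>S. finite R \<and> R \<noteq> {} \<and> card R \<le> k \<and>
       (\<forall>\<sigma>\<in>S. \<forall>\<tau>\<in>R. \<forall>e. e \<subseteq> \<sigma> \<inter> \<tau> \<and> card e = 2 \<longrightarrow> \<sigma> \<in> R))"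
proof (induction k)
  case 0
  obtain \<tau> where "\<tau> \<in> S" using \<open>S \<noteq> {}\<close> by blast
  then show ?case using S[of \<tau>] by (intro disjI1 exI[of _ "{\<tau>}"]) auto
next
  case (Suc k)
  then consider R where "R \<subseteq> S" "finite R" "card R = Suc k" "card (\<Union>R) \<le> k + 3"
    | R where "R \<subseteq> S" "finite R" "R \<noteq> {}" "card R \<le> k"
       "\<forall>\<sigma>\<in>S. \<forall>\<tau>\<in>R. \<forall>e. e \<subseteq> \<sigma> \<inter> \<tau> \<and> card e = 2 \<longrightarrow> \<sigma> \<in> R"
    by blast
  then show ?case
  proof cases
    case 1
    show ?thesis
    proof (cases "\<forall>\<sigma>\<in>S. \<forall>\<tau>\<in>R. \<forall>e. e \<subseteq> \<sigma> \<inter> \<tau> \<and> card e = 2 \<longrightarrow> \<sigma> \<in> R")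
      case True
      then show ?thesis using 1 by (intro disjI2 exI[of _ R]) auto
    next
      case False
      then obtain \<sigma> \<tau> e where \<sigma>: "\<sigma> \<in> S" "\<sigma> \<notin> R" "\<tau> \<in> R" "e \<subseteq> \<sigma> \<inter> \<tau>" "card e = 2" by blast
      have fin: "finite (\<Union>R)" using 1(1,2) S by auto
      have "card (\<sigma> - e) = 1"
        using \<sigma>(4,5) S[OF \<sigma>(1)] by (subst card_Diff_subset) (auto intro: finite_subset)
      moreover have "\<Union>(insert \<sigma> R) \<subseteq> \<Union>R \<union> (\<sigma> - e)" using \<sigma>(3,4) by blast
      then have "card (\<Union>(insert \<sigma> R)) \<le> card (\<Union>R \<union> (\<sigma> - e))"
        using fin S[OF \<sigma>(1)] by (intro card_mono) auto
      moreover have "card (\<Union>R \<union> (\<sigma> - e)) \<le> card (\<Union>R) + card (\<sigma> - e)" by (rule card_Un_le)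
      ultimately have "card (\<Union>(insert \<sigma> R)) \<le> Suc k + 3" using 1(4) by linarith
      then show ?thesis
        using 1 \<sigma>(1,2) by (intro disjI1 exI[of _ "insert \<sigma> R"]) simp
    qed
  next
    case 2
    then show ?thesis by (intro disjI2 exI[of _ R]) simp
  qed
qed

text \<open>Without free edges every vertex lies in at least three triangles; double counting of the
  incidences then bounds the number of vertices by the number of triangles.\<close>

lemma card_vertices_le:
  assumes R: "\<And>\<sigma>. \<sigma> \<in> R \<Longrightarrow> finite \<sigma> \<and> card \<sigma> = 3" and "finite R"
    and double: "\<And>\<tau> e. \<tau> \<in> R \<Longrightarrow> e \<subseteq> \<tau> \<Longrightarrow> card e = 2 \<Longrightarrow> \<exists>\<sigma>\<in>R. e \<subseteq> \<sigma> \<and> \<sigma> \<noteq> \<tau>"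
  shows "card (\<Union>R) \<le> card R"
proof -
  have fin: "finite (\<Union>R)" using R \<open>finite R\<close> by auto
  have "3 \<le> card {\<sigma>\<in>R. v \<in> \<sigma>}" if v: "v \<in> \<Union>R" for v
  proof -
    obtain \<tau> where \<tau>: "\<tau> \<in> R" "v \<in> \<tau>" using v by blast
    have "card (\<tau> - {v}) = 2" using R[OF \<tau>(1)] \<tau>(2) by simp
    then obtain a b where ab: "\<tau> - {v} = {a, b}" "a \<noteq> b" by (auto simp: card_2_iff)
    then have \<tau>_eq: "\<tau> = {v, a, b}" "v \<noteq> a" "v \<noteq> b" using \<tau>(2) by auto
    obtain \<sigma> where \<sigma>: "\<sigma> \<in> R" "{v, a} \<subseteq> \<sigma>" "\<sigma> \<noteq> \<tau>"
      using double[OF \<tau>(1), of "{v, a}"] \<tau>_eq by auto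
    obtain \<rho> where \<rho>: "\<rho> \<in> R" "{v, b} \<subseteq> \<rho>" "\<rho> \<noteq> \<tau>"
      using double[OF \<tau>(1), of "{v, b}"] \<tau>_eq by auto
    have "\<sigma> \<noteq> \<rho>"
    proof
      assume "\<sigma> = \<rho>"
      then have "\<tau> \<subseteq> \<sigma>" using \<sigma>(2) \<rho>(2) \<tau>_eq(1) by simp
      then show False using card_subset_eq[of \<sigma> \<tau>] R[OF \<sigma>(1)] R[OF \<tau>(1)] \<sigma>(3) by simp
    qed
    then have "card {\<tau>, \<sigma>, \<rho>} = 3" using \<sigma>(3) \<rho>(3) by simp
    moreover have "{\<tau>, \<sigma>, \<rho>} \<subseteq> {\<sigma>\<in>R. v \<in> \<sigma>}" using \<tau> \<sigma> \<rho> by simp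
    ultimately show ?thesis using card_mono[of "{\<sigma>\<in>R. v \<in> \<sigma>}" "{\<tau>, \<sigma>, \<rho>}"] \<open>finite R\<close> by simp
  qed
  then have "(\<Sum>v\<in>\<Union>R. 3) \<le> (\<Sum>v\<in>\<Union>R. card {\<sigma>\<in>R. v \<in> \<sigma>})"
    by (rule sum_mono)
  moreover have "card {v \<in> \<Union>R. v \<in> \<sigma>} = 3" if "\<sigma> \<in> R" for \<sigma>
  proof -
    have "{v \<in> \<Union>R. v \<in> \<sigma>} = \<sigma>" using that by blast
    then show ?thesis using R[OF that] by simp
  qed
  then have "(\<Sum>v\<in>\<Union>R. card {\<sigma>\<in>R. v \<in> \<sigma>}) = 3 * card R"
    by (intro sum_multicount[OF fin \<open>finite R\<close>]) simp
  ultimately show ?thesis by simp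
qed

definition contains_dense :: "'a set set \<Rightarrow> nat \<Rightarrow> nat \<Rightarrow> bool" where
  "contains_dense S t v \<longleftrightarrow> (\<exists>R\<subseteq>S. finite R \<and> card R = t \<and> card (\<Union>R) \<le> v)"

text \<open>The closed set \<open>R\<close> inherits the absence of free edges from
  \<open>S\<close>: a second triangle of \<open>S\<close> on an edge of \<open>R\<close> already
  belongs to \<open>R\<close>. This is the hypothesis \<open>double\<close> of
  \<open>card_vertices_le\<close>.\<close>

lemma no_free_edge_dense:
  assumes S: "\<And>\<sigma>. \<sigma> \<in> S \<Longrightarrow> finite \<sigma> \<and> card \<sigma> = 3" and "S \<noteq> {}" "\<not> has_free_edge S"
  shows "contains_dense S (k + 1) (k + 3) \<or> (\<exists>t\<in>{1..k}. contains_dense S t t)"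
  using linked_triangles[OF S \<open>S \<noteq> {}\<close>, of k]
proof
  assume "\<exists>R\<subseteq>S. finite R \<and> card R = Suc k \<and> card (\<Union>R) \<le> k + 3"
  then show ?thesis by (simp add: contains_dense_def)
next
  assume "\<exists>R\<subseteq>S. finite R \<and> R \<noteq> {} \<and> card R \<le> k \<and>
       (\<forall>\<sigma>\<in>S. \<forall>\<tau>\<in>R. \<forall>e. e \<subseteq> \<sigma> \<inter> \<tau> \<and> card e = 2 \<longrightarrow> \<sigma> \<in> R)"
  then obtain R where R: "R \<subseteq> S" "finite R" "R \<noteq> {}" "card R \<le> k"
    and closed: "\<forall>\<sigma>\<in>S. \<forall>\<tau>\<in>R. \<forall>e. e \<subseteq> \<sigma> \<inter> \<tau> \<and> card e = 2 \<longrightarrow> \<sigma> \<in> R"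
    by (elim exE conjE)
  have "card (\<Union>R) \<le> card R"
  proof (rule card_vertices_le)
    fix \<tau> e assume \<tau>: "\<tau> \<in> R" "e \<subseteq> \<tau>" "card e = 2"
    have "\<tau> \<in> S" using R(1) \<tau>(1) by (rule subsetD)
    have "\<not> (\<forall>\<sigma>\<in>S. e \<subseteq> \<sigma> \<longrightarrow> \<sigma> = \<tau>)"
    proof
      assume "\<forall>\<sigma>\<in>S. e \<subseteq> \<sigma> \<longrightarrow> \<sigma> = \<tau>"
      with \<tau>(2,3) \<open>\<tau> \<in> S\<close> have "has_free_edge S"
        unfolding has_free_edge_def by (intro bexI[of _ \<tau>] exI[of _ e] conjI)
      then show False using \<open>\<not> has_free_edge S\<close> by simp
    qed
    then obtain \<sigma> where \<sigma>: "\<sigma> \<in> S" "e \<subseteq> \<sigma>" "\<sigma> \<noteq> \<tau>"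
      by auto
    have "e \<subseteq> \<sigma> \<inter> \<tau> \<and> card e = 2" using \<sigma>(2) \<tau>(2,3) by simp
    then have "\<sigma> \<in> R" by (rule bspec[OF bspec[OF closed \<sigma>(1)] \<tau>(1), THEN spec, THEN mp])
    then show "\<exists>\<sigma>\<in>R. e \<subseteq> \<sigma> \<and> \<sigma> \<noteq> \<tau>" using \<sigma>(2,3) by (intro bexI[of _ \<sigma>] conjI)
  next
    show "finite \<sigma> \<and> card \<sigma> = 3" if "\<sigma> \<in> R" for \<sigma>
      using S R(1) that by (simp add: subset_iff)
  qed (rule R(2))
  moreover have "card R \<in> {1..k}" using R(2-4) by (simp add: Suc_le_eq card_gt_0_iff)
  ultimately have "\<exists>t\<in>{1..k}. contains_dense S t t"
    unfolding contains_dense_def using R(1,2) by (intro bexI[of _ "card R"] exI[of _ R]) simp_all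
  then show ?thesis by simp
qed

section \<open>First moments in the Linial--Meshulam model\<close>

definition all_triangles :: "nat \<Rightarrow> nat set set" where
  "all_triangles n = {\<sigma>. \<sigma> \<subseteq> {1..n} \<and> card \<sigma> = 3}"

lemma finite_all_triangles: "finite (all_triangles n)"
  unfolding all_triangles_def by simp

lemma card_all_triangles: "card (all_triangles n) = n choose 3"
  unfolding all_triangles_def using n_subsets[of "{1..n}" 3] by simp

lemma triangles_LM:
  assumes "T \<subseteq> all_triangles n"
  shows "simplex_skeleton n 1 \<union> T \<in> LM_complexes n" "triangles (simplex_skeleton n 1 \<union> T) = T"
proof -
  have fin: "finite \<sigma>" if "\<sigma> \<subseteq> {1..n}" for \<sigma> using that by (rule finite_subset) simp
  have T: "\<sigma> \<subseteq> {1..n} \<and> card \<sigma> = 3" if "\<sigma> \<in> T" for \<sigma> using that assms by (auto simp: all_triangles_def)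
  have sk: "\<sigma> \<in> simplex_skeleton n i \<longleftrightarrow> \<sigma> \<subseteq> {1..n} \<and> \<sigma> \<noteq> {} \<and> card \<sigma> \<le> i + 1" for \<sigma> i
    by (simp add: simplex_skeleton_def)
  have all: "\<sigma> \<subseteq> {1..n} \<and> \<sigma> \<noteq> {} \<and> card \<sigma> \<le> 3" if "\<sigma> \<in> simplex_skeleton n 1 \<union> T" for \<sigma>
    using that
  proof
    assume "\<sigma> \<in> T"
    then show ?thesis using T[of \<sigma>] by (metis card.empty order_refl zero_neq_numeral)
  qed (simp add: sk)
  have face: "\<tau> \<in> simplex_skeleton n 1 \<union> T"
    if "\<sigma> \<in> simplex_skeleton n 1 \<union> T" "\<tau> \<subseteq> \<sigma>" "\<tau> \<noteq> {}" for \<sigma> \<tau>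
  proof (cases "\<tau> = \<sigma>")
    case False
    have \<sigma>: "\<sigma> \<subseteq> {1..n}" "card \<sigma> \<le> 3" using all[OF that(1)] by simp_all
    have "card \<tau> < card \<sigma>"
      by (rule psubset_card_mono[OF fin[OF \<sigma>(1)] psubsetI[OF that(2) False]])
    then have "\<tau> \<in> simplex_skeleton n 1"
      using \<sigma> subset_trans[OF that(2) \<sigma>(1)] that(3) by (simp add: sk)
    then show ?thesis ..
  qed (use that in simp)
  have "finite \<sigma> \<and> \<sigma> \<noteq> {}" if "\<sigma> \<in> simplex_skeleton n 1 \<union> T" for \<sigma>
    using all[OF that] fin[of \<sigma>] by simp
  then have "abstract_complex (simplex_skeleton n 1 \<union> T)"
    unfolding abstract_complex_def using face by metis
  moreover have "simplex_skeleton n 1 \<union> T \<subseteq> simplex_skeleton n 2"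
  proof
    fix \<sigma> assume "\<sigma> \<in> simplex_skeleton n 1 \<union> T"
    from all[OF this] show "\<sigma> \<in> simplex_skeleton n 2" by (simp add: sk)
  qed
  ultimately show "simplex_skeleton n 1 \<union> T \<in> LM_complexes n" by (simp add: LM_complexes_def)
  have "card \<sigma> = 3 \<longleftrightarrow> \<sigma> \<in> T" if "\<sigma> \<in> simplex_skeleton n 1 \<union> T" for \<sigma>
    using that T[of \<sigma>] by (auto simp: sk)
  then show "triangles (simplex_skeleton n 1 \<union> T) = T" unfolding triangles_def by blast
qed

lemma LM_complexesD:
  assumes "Y \<in> LM_complexes n"
  shows "abstract_complex Y" "triangles Y \<subseteq> all_triangles n" "Y = simplex_skeleton n 1 \<union> triangles Y"
    "\<And>\<sigma>. \<sigma> \<in> Y \<Longrightarrow> card \<sigma> \<le> 3"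
proof -
  have Y: "abstract_complex Y" "simplex_skeleton n 1 \<subseteq> Y" "Y \<subseteq> simplex_skeleton n 2"
    using assms by (auto simp: LM_complexes_def)
  then show "abstract_complex Y" by simp
  have Y': "\<sigma> \<subseteq> {1..n} \<and> \<sigma> \<noteq> {} \<and> card \<sigma> \<le> 3" if "\<sigma> \<in> Y" for \<sigma>
    using that Y(3) by (auto simp: simplex_skeleton_def)
  then show "\<And>\<sigma>. \<sigma> \<in> Y \<Longrightarrow> card \<sigma> \<le> 3" by blast
  show "triangles Y \<subseteq> all_triangles n" using Y' by (auto simp: triangles_def all_triangles_def)
  have "\<sigma> \<in> simplex_skeleton n 1 \<union> triangles Y" if "\<sigma> \<in> Y" for \<sigma>
    using Y'[OF that] that by (cases "card \<sigma> = 3") (auto simp: simplex_skeleton_def triangles_def)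
  then show "Y = simplex_skeleton n 1 \<union> triangles Y" using Y(2) by (auto simp: triangles_def)
qed

lemma bij_betw_LM_complexes: "bij_betw (\<lambda>T. simplex_skeleton n 1 \<union> T) (Pow (all_triangles n)) (LM_complexes n)"
proof (rule bij_betw_byWitness[where f' = triangles])
  show "\<forall>Y\<in>LM_complexes n. simplex_skeleton n 1 \<union> triangles Y = Y"
    using LM_complexesD(3) by blast
  show "triangles ` LM_complexes n \<subseteq> Pow (all_triangles n)"
    using LM_complexesD(2) by blast
qed (use triangles_LM in blast)+

lemma finite_LM_complexes: "finite (LM_complexes n)"
  using bij_betw_finite[OF bij_betw_LM_complexes] finite_all_triangles by simp

lemma measure_LM:
  assumes "0 < q" "q < 1" "B \<subseteq> LM_complexes n"
  shows "measure (LM_measure n q) B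
    = (\<Sum>Y\<in>B. q ^ num_triangles Y * (1 - q) ^ ((n choose 3) - num_triangles Y))"
  unfolding LM_measure_def
  using assms by (subst measure_point_measure_finite_if) (simp_all add: finite_LM_complexes)

text \<open>Summing over the possible further triangles expands a product of factors
  \<open>q + (1 - q)\<close>, one for each triangle outside \<open>S\<close>.\<close>

lemma measure_LM_superset:
  assumes q: "0 < q" "q < 1" and S: "S \<subseteq> all_triangles n"
  shows "measure (LM_measure n q) {Y \<in> LM_complexes n. S \<subseteq> triangles Y} = q ^ card S"
proof -
  let ?A = "all_triangles n" and ?N = "n choose 3"
  note fin = finite_all_triangles[of n]
  have finS: "finite S" using S fin by (rule finite_subset)
  have bij: "bij_betw (\<lambda>U. simplex_skeleton n 1 \<union> (S \<union> U)) (Pow (?A - S)) {Y \<in> LM_complexes n. S \<subseteq> triangles Y}"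
  proof (rule bij_betw_byWitness[where f' = "\<lambda>Y. triangles Y - S"])
    show "\<forall>U\<in>Pow (?A - S). triangles (simplex_skeleton n 1 \<union> (S \<union> U)) - S = U"
    proof
      fix U assume "U \<in> Pow (?A - S)"
      then show "triangles (simplex_skeleton n 1 \<union> (S \<union> U)) - S = U"
        using triangles_LM(2)[of "S \<union> U" n] S by auto
    qed
    show "\<forall>Y\<in>{Y \<in> LM_complexes n. S \<subseteq> triangles Y}. simplex_skeleton n 1 \<union> (S \<union> (triangles Y - S)) = Y"
    proof
      fix Y assume "Y \<in> {Y \<in> LM_complexes n. S \<subseteq> triangles Y}"
      then have "S \<union> (triangles Y - S) = triangles Y" "Y = simplex_skeleton n 1 \<union> triangles Y"
        using LM_complexesD(3)[of Y n] by auto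
      then show "simplex_skeleton n 1 \<union> (S \<union> (triangles Y - S)) = Y" by simp
    qed
    show "(\<lambda>U. simplex_skeleton n 1 \<union> (S \<union> U)) ` Pow (?A - S) \<subseteq> {Y \<in> LM_complexes n. S \<subseteq> triangles Y}"
    proof (rule image_subsetI)
      fix U assume "U \<in> Pow (?A - S)"
      then have "S \<union> U \<subseteq> ?A" using S by auto
      then show "simplex_skeleton n 1 \<union> (S \<union> U) \<in> {Y \<in> LM_complexes n. S \<subseteq> triangles Y}"
        using triangles_LM[of "S \<union> U" n] by auto
    qed
    show "(\<lambda>Y. triangles Y - S) ` {Y \<in> LM_complexes n. S \<subseteq> triangles Y} \<subseteq> Pow (?A - S)"
      using LM_complexesD(2) by auto
  qed
  have "measure (LM_measure n q) {Y \<in> LM_complexes n. S \<subseteq> triangles Y}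
    = (\<Sum>Y\<in>{Y \<in> LM_complexes n. S \<subseteq> triangles Y}. q ^ num_triangles Y * (1 - q) ^ (?N - num_triangles Y))"
    by (rule measure_LM[OF q]) auto
  also have "\<dots> = (\<Sum>U\<in>Pow (?A - S). q ^ card S * ((\<Prod>x\<in>U. q) * (\<Prod>x\<in>(?A - S) - U. 1 - q)))"
  proof (rule sum.reindex_bij_betw[OF bij, symmetric, THEN trans], rule sum.cong[OF refl])
    fix U assume U: "U \<in> Pow (?A - S)"
    then have SU: "S \<union> U \<subseteq> ?A" "S \<inter> U = {}" using S by auto
    then have fU: "finite U" using fin finite_subset by blast
    have "num_triangles (simplex_skeleton n 1 \<union> (S \<union> U)) = card (S \<union> U)"
      using triangles_LM(2)[OF SU(1)] by (simp add: num_triangles_def triangles_def)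
    also have "\<dots> = card S + card U" by (rule card_Un_disjoint[OF finS fU SU(2)])
    finally have num: "num_triangles (simplex_skeleton n 1 \<union> (S \<union> U)) = card S + card U" .
    have "?A - S - U = ?A - (S \<union> U)" by blast
    then have "card (?A - S - U) = card ?A - card (S \<union> U)"
      using SU(1) finS fU by (simp add: card_Diff_subset)
    then have "card (?A - S - U) = ?N - (card S + card U)"
      by (simp add: card_all_triangles card_Un_disjoint[OF finS fU SU(2)])
    then show "q ^ num_triangles (simplex_skeleton n 1 \<union> (S \<union> U)) *
        (1 - q) ^ (?N - num_triangles (simplex_skeleton n 1 \<union> (S \<union> U)))
        = q ^ card S * ((\<Prod>x\<in>U. q) * (\<Prod>x\<in>?A - S - U. 1 - q))"
      unfolding num by (simp add: power_add)
  qed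
  also have "\<dots> = q ^ card S * (\<Prod>x\<in>?A - S. q + (1 - q))"
    by (simp only: sum_distrib_left[symmetric] prod_add[OF finite_Diff[OF fin]])
  finally show ?thesis by simp
qed

lemma measure_LM_space: "0 < q \<Longrightarrow> q < 1 \<Longrightarrow> measure (LM_measure n q) (LM_complexes n) = 1"
  using measure_LM_superset[of q "{}" n] by simp

lemma measure_LM_mono:
  assumes "0 < q" "q < 1" "A \<subseteq> B" "B \<subseteq> LM_complexes n"
  shows "measure (LM_measure n q) A \<le> measure (LM_measure n q) B"
proof -
  have "A \<subseteq> LM_complexes n" using assms by blast
  then show ?thesis
    using assms finite_subset[OF assms(4) finite_LM_complexes]
    by (simp add: measure_LM sum_mono2)
qed

lemma measure_LM_UN_le:
  assumes q: "0 < q" "q < 1" and "finite I" "\<And>i. i \<in> I \<Longrightarrow> B i \<subseteq> LM_complexes n"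
  shows "measure (LM_measure n q) (\<Union>i\<in>I. B i) \<le> (\<Sum>i\<in>I. measure (LM_measure n q) (B i))"
proof -
  have "sets (LM_measure n q) = Pow (LM_complexes n)" by (simp add: LM_measure_def sets_point_measure)
  moreover have "emeasure (LM_measure n q) (B i) \<noteq> \<infinity>" if "i \<in> I" for i
    unfolding LM_measure_def emeasure_point_measure_finite[OF finite_LM_complexes assms(4)[OF that]]
    using q by (subst sum_ennreal) simp_all
  ultimately show ?thesis
    using assms(3,4) by (intro measure_UNION_le) (simp_all add: fmeasurable_def less_top)
qed

text \<open>A union bound over configurations. The vertices of each lie in a set \<open>V\<close> of
  exactly \<open>v\<close> points, available because \<open>v \<le> n\<close>. There are at most
  \<open>n ^ v\<close> such \<open>V\<close>, and the triangles form one of the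
  \<open>2 ^ 2 ^ v\<close> families of subsets of \<open>V\<close>, a factor that does not depend on
  \<open>n\<close>.\<close>

lemma measure_contains_dense:
  assumes q: "0 < q" "q < 1" and "v \<le> n"
  shows "measure (LM_measure n q) {Y \<in> LM_complexes n. contains_dense (triangles Y) t v}
    \<le> 2 ^ 2 ^ v * (real n ^ v * q ^ t)"
proof -
  define F where "F = {S \<in> Pow (all_triangles n). card S = t \<and> card (\<Union>S) \<le> v}"
  have finF: "finite F" unfolding F_def using finite_all_triangles by simp
  have "F \<subseteq> (\<Union>V\<in>{V. V \<subseteq> {1..n} \<and> card V = v}. Pow (Pow V))"
  proof
    fix S assume S: "S \<in> F"
    then have sub: "\<Union>S \<subseteq> {1..n}" by (auto simp: F_def all_triangles_def)
    obtain V where "\<Union>S \<subseteq> V" "V \<subseteq> {1..n}" "card V = v"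
      using exists_subset_between[of "\<Union>S" v "{1..n}"] S sub \<open>v \<le> n\<close> by (auto simp: F_def)
    then show "S \<in> (\<Union>V\<in>{V. V \<subseteq> {1..n} \<and> card V = v}. Pow (Pow V))" by blast
  qed
  then have "card F \<le> card (\<Union>V\<in>{V. V \<subseteq> {1..n} \<and> card V = v}. Pow (Pow V))"
    by (rule card_mono[rotated]) (auto intro: finite_subset)
  also have "\<dots> \<le> (\<Sum>V\<in>{V. V \<subseteq> {1..n} \<and> card V = v}. card (Pow (Pow V)))"
    by (rule card_UN_le) simp
  also have "\<dots> = (\<Sum>V\<in>{V. V \<subseteq> {1..n} \<and> card V = v}. 2 ^ 2 ^ v)"
    by (intro sum.cong refl) (auto simp: card_Pow finite_subset)
  also have "\<dots> = (n choose v) * 2 ^ 2 ^ v" using n_subsets[of "{1..n}" v] by simp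
  also have "\<dots> \<le> n ^ v * 2 ^ 2 ^ v" using binomial_le_pow[OF \<open>v \<le> n\<close>] by simp
  finally have cardF: "card F \<le> n ^ v * 2 ^ 2 ^ v" .
  have "{Y \<in> LM_complexes n. contains_dense (triangles Y) t v} \<subseteq> (\<Union>S\<in>F. {Y \<in> LM_complexes n. S \<subseteq> triangles Y})"
  proof
    fix Y assume "Y \<in> {Y \<in> LM_complexes n. contains_dense (triangles Y) t v}"
    then obtain R where "Y \<in> LM_complexes n" "R \<subseteq> triangles Y" "card R = t" "card (\<Union>R) \<le> v"
      by (auto simp: contains_dense_def)
    then show "Y \<in> (\<Union>S\<in>F. {Y \<in> LM_complexes n. S \<subseteq> triangles Y})"
      using LM_complexesD(2)[of Y n] by (auto simp: F_def)
  qed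
  then have "measure (LM_measure n q) {Y \<in> LM_complexes n. contains_dense (triangles Y) t v}
    \<le> measure (LM_measure n q) (\<Union>S\<in>F. {Y \<in> LM_complexes n. S \<subseteq> triangles Y})"
    by (intro measure_LM_mono[OF q]) auto
  also have "\<dots> \<le> (\<Sum>S\<in>F. measure (LM_measure n q) {Y \<in> LM_complexes n. S \<subseteq> triangles Y})"
    by (rule measure_LM_UN_le[OF q finF]) auto
  also have "\<dots> = (\<Sum>S\<in>F. q ^ t)"
    using measure_LM_superset[OF q] by (intro sum.cong refl) (auto simp: F_def)
  also have "\<dots> = real (card F) * q ^ t" by simp
  also have "\<dots> \<le> real (n ^ v * 2 ^ 2 ^ v) * q ^ t"
    using cardF q by (intro mult_right_mono) (simp_all only: of_nat_le_iff zero_le_power less_imp_le)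
  finally show ?thesis by (simp add: mult_ac)
qed

section \<open>From sparse complexes to the limit\<close>

lemma contains_dense_mono: "contains_dense S t v \<Longrightarrow> S \<subseteq> S' \<Longrightarrow> contains_dense S' t v"
  unfolding contains_dense_def by (elim exE conjE, intro exI conjI) (rule subset_trans)

lemma LM_free_fundamental_group_and_trivial_homology:
  assumes Y: "Y \<in> LM_complexes n"
    and sparse: "\<not> contains_dense (triangles Y) (k + 1) (k + 3)"
      "\<And>t. t \<in> {1..k} \<Longrightarrow> \<not> contains_dense (triangles Y) t t"
  shows "(\<forall>x\<in>realization Y. free_group (fundamental_group (realization Y) x)) \<and>
    trivial_group (homology_group 2 (top_of_set (realization Y)))"
proof (rule free_fundamental_group_and_trivial_homology)
  note Y' = LM_complexesD[OF Y]
  show "abstract_complex Y" by (rule Y'(1))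
  show "card \<sigma> \<le> 3" if "\<sigma> \<in> Y" for \<sigma> by (rule Y'(4)[OF that])
  show "finite (triangles Y)" by (rule finite_subset[OF Y'(2) finite_all_triangles])
  show "(a, b) \<in> {(a, b). {a, b} \<in> Y}\<^sup>*" if "{a} \<in> Y" "{b} \<in> Y" for a b
  proof -
    have sk: "simplex_skeleton n 1 \<subseteq> Y" "Y \<subseteq> simplex_skeleton n 2"
      using Y by (simp_all add: LM_complexes_def)
    have "{a} \<in> simplex_skeleton n 2" "{b} \<in> simplex_skeleton n 2"
      using that sk(2) by (auto simp only: subset_iff)
    then have "a \<in> {1..n}" "b \<in> {1..n}" by (simp_all add: simplex_skeleton_def)
    \<comment> \<open>The 1-skeleton is complete, so a single step joins any two vertices; for
      \<open>a = b\<close> the set is a vertex.\<close>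
    then have "{a, b} \<in> simplex_skeleton n 1"
      using card_insert_le_m1[of 2 "{b}" a] by (simp add: simplex_skeleton_def card_insert_if)
    then have "{a, b} \<in> Y" using sk(1) by (rule subsetD[rotated])
    then show ?thesis by (intro r_into_rtrancl) simp
  qed
  show "has_free_edge S" if S: "S \<subseteq> triangles Y" "S \<noteq> {}" for S
  proof (rule ccontr)
    assume "\<not> has_free_edge S"
    moreover have "finite \<sigma> \<and> card \<sigma> = 3" if "\<sigma> \<in> S" for \<sigma>
      using subsetD[OF S(1) that] by (simp add: triangles_def card_ge_0_finite)
    ultimately have "contains_dense S (k + 1) (k + 3) \<or> (\<exists>t\<in>{1..k}. contains_dense S t t)"
      using S(2) by (intro no_free_edge_dense)
    then show False
      using sparse contains_dense_mono[OF _ S(1)] by blast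
  qed
qed

text \<open>Freeness is asserted at every base point at once, so the event involves no choice.
  \<open>homology_group\<close> is singular homology with integer coefficients.\<close>

theorem corollary2:
  fixes p :: "nat \<Rightarrow> real" and k :: nat
  assumes "\<And>n. 0 < p n \<and> p n < 1"
    and "k \<ge> 1"
    and "(\<lambda>n. p n / real n powr (- 1 - 2 / (real k + 1))) \<longlonglongrightarrow> 0"
  shows "(\<lambda>n. measure (LM_measure n (p n))
           {Y \<in> LM_complexes n.
              (\<forall>x \<in> realization Y. free_group (fundamental_group (realization Y) x)) \<and>
              trivial_group (homology_group 2 (top_of_set (realization Y)))}) \<longlonglongrightarrow> 1"
proof -
  \<comment> \<open>The ratio assumed to tend to 0; each error probability will be at most a
    constant times a power of it.\<close>
  define a where "a = (\<lambda>n. p n / real n powr (- 1 - 2 / (real k + 1)))"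
  \<comment> \<open>Index 0 encodes the configuration \<open>(k + 1, k + 3)\<close> and an index
    \<open>i \<ge> 1\<close> the configuration \<open>(i, i)\<close>, so one sum over
    \<open>{0..k}\<close> covers all that is to be excluded.\<close>
  define t where "t = (\<lambda>i. if i = 0 then k + 1 else i)"
  define v where "v = (\<lambda>i. if i = 0 then k + 3 else i)"
  define G where "G = (\<lambda>n. {Y \<in> LM_complexes n.
              (\<forall>x \<in> realization Y. free_group (fundamental_group (realization Y) x)) \<and>
              trivial_group (homology_group 2 (top_of_set (realization Y)))})"
  define B where "B = (\<lambda>n i. {Y \<in> LM_complexes n. contains_dense (triangles Y) (t i) (v i)})"
  have p: "0 < p n" "p n < 1" for n using assms(1) by simp_all
  \<comment> \<open>Good and bad complexes form one union indexed by booleans, so the union bound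
    itself yields the lower estimate for the good ones.\<close>
  have cover: "LM_complexes n \<subseteq> (\<Union>b\<in>{True, False}. if b then G n else (\<Union>i\<in>{0..k}. B n i))" for n
  proof
    fix Y assume Y: "Y \<in> LM_complexes n"
    show "Y \<in> (\<Union>b\<in>{True, False}. if b then G n else (\<Union>i\<in>{0..k}. B n i))"
    proof (cases "\<exists>i\<in>{0..k}. Y \<in> B n i")
      case False
      then have sparse: "\<not> contains_dense (triangles Y) (t i) (v i)" if "i \<le> k" for i
        using that Y by (simp add: B_def)
      have "Y \<in> G n"
        using LM_free_fundamental_group_and_trivial_homology[OF Y, of k] sparse[of 0] sparse Y
        unfolding G_def t_def v_def by fastforce
      then show ?thesis by simp
    qed auto
  qed
  \<comment> \<open>From \<open>k + 3 \<le> n\<close> on, every \<open>v i\<close> is at most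
    \<open>n\<close>, as counting the configurations requires.\<close>
  have lower: "1 - (\<Sum>i=0..k. 2 ^ 2 ^ v i * (real n ^ v i * p n ^ t i)) \<le> measure (LM_measure n (p n)) (G n)"
    if "k + 3 \<le> n" for n
  proof -
    let ?M = "measure (LM_measure n (p n))"
    have sub: "(if b then G n else (\<Union>i\<in>{0..k}. B n i)) \<subseteq> LM_complexes n" for b
      by (auto simp: G_def B_def)
    have "1 = ?M (LM_complexes n)" using measure_LM_space p by simp
    also have "\<dots> \<le> ?M (\<Union>b\<in>{True, False}. if b then G n else (\<Union>i\<in>{0..k}. B n i))"
      using cover sub by (intro measure_LM_mono p UN_least)
    also have "\<dots> \<le> (\<Sum>b\<in>{True, False}. ?M (if b then G n else (\<Union>i\<in>{0..k}. B n i)))"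
      using sub by (intro measure_LM_UN_le p) simp_all
    also have "\<dots> = ?M (G n) + ?M (\<Union>i\<in>{0..k}. B n i)" by simp
    also have "?M (\<Union>i\<in>{0..k}. B n i) \<le> (\<Sum>i=0..k. ?M (B n i))"
      by (intro measure_LM_UN_le p) (auto simp: B_def)
    also have "(\<Sum>i=0..k. ?M (B n i)) \<le> (\<Sum>i=0..k. 2 ^ 2 ^ v i * (real n ^ v i * p n ^ t i))"
      unfolding B_def using that by (intro sum_mono measure_contains_dense p) (auto simp: v_def)
    finally show ?thesis by simp
  qed
  \<comment> \<open>For \<open>i = 0\<close> this is an equality, since
    \<open>1 + 2 / (k + 1)\<close> times \<open>k + 1\<close> is \<open>k + 3\<close>. For
    \<open>i \<ge> 1\<close> it follows from \<open>n * p n \<le> a n\<close>, as the exponent of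
    \<open>n\<close> in \<open>a n\<close> is at least 1.\<close>
  have bound: "real n ^ v i * p n ^ t i \<le> a n ^ t i" if "n \<ge> 1" for n i
  proof (cases "i = 0")
    case True
    have "(real n powr (- 1 - 2 / (real k + 1))) ^ (k + 1) = real n powr (- real (k + 3))"
    proof -
      have "(- 1 - 2 / (real k + 1)) * real (k + 1) = - real (k + 3)" by (simp add: field_simps)
      moreover have "(real n powr (- 1 - 2 / (real k + 1))) ^ (k + 1)
          = real n powr ((- 1 - 2 / (real k + 1)) * real (k + 1))"
        using that by (subst powr_power) (simp_all add: mult.commute)
      ultimately show ?thesis by simp
    qed
    also have "\<dots> = 1 / real n ^ (k + 3)"
      using that powr_realpow[of "real n" "k + 3"] by (simp only: powr_minus_divide)
    finally have "a n ^ (k + 1) = p n ^ (k + 1) * real n ^ (k + 3)"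
      unfolding a_def power_divide by simp
    then show ?thesis using True by (simp add: t_def v_def mult.commute)
  next
    case False
    have "real n = real n powr 1" using that by simp
    also have "\<dots> \<le> real n powr (1 + 2 / (real k + 1))"
      using that by (intro powr_mono) auto
    finally have "p n * real n \<le> p n * real n powr (1 + 2 / (real k + 1))"
      using p[of n] by (intro mult_left_mono) auto
    also have "\<dots> = a n"
      using powr_minus_divide[of "real n" "- 1 - 2 / (real k + 1)"] by (simp add: a_def add.commute)
    finally have "(real n * p n) ^ i \<le> a n ^ i"
      using p[of n] by (intro power_mono) (simp_all add: mult.commute)
    then show ?thesis using False by (simp add: t_def v_def power_mult_distrib)
  qed
  have lim: "(\<lambda>n. 1 - (\<Sum>i=0..k. 2 ^ 2 ^ v i * a n ^ t i)) \<longlonglongrightarrow> 1 - (\<Sum>i=0..k. 2 ^ 2 ^ v i * 0 ^ t i)"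
    using assms(3) unfolding a_def[symmetric]
    by (intro tendsto_diff tendsto_const tendsto_sum tendsto_mult tendsto_power)
  \<comment> \<open>Every \<open>t i\<close> is positive, so each \<open>0 ^ t i\<close> is 0 and
    not 1.\<close>
  have "(\<Sum>i=0..k. 2 ^ 2 ^ v i * 0 ^ t i) = (0::real)"
    by (intro sum.neutral) (auto simp: t_def)
  with lim have lim': "(\<lambda>n. 1 - (\<Sum>i=0..k. 2 ^ 2 ^ v i * a n ^ t i)) \<longlonglongrightarrow> 1" by simp
  have "(\<lambda>n. measure (LM_measure n (p n)) (G n)) \<longlonglongrightarrow> 1"
  proof (rule tendsto_sandwich[OF _ _ lim' tendsto_const])
    show "\<forall>\<^sub>F n in sequentially. 1 - (\<Sum>i=0..k. 2 ^ 2 ^ v i * a n ^ t i) \<le> measure (LM_measure n (p n)) (G n)"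
      unfolding eventually_sequentially
    proof (intro exI[of _ "k + 3"] allI impI)
      fix n assume n: "k + 3 \<le> n"
      have "(\<Sum>i=0..k. 2 ^ 2 ^ v i * (real n ^ v i * p n ^ t i)) \<le> (\<Sum>i=0..k. 2 ^ 2 ^ v i * a n ^ t i)"
        using n by (intro sum_mono mult_left_mono bound) simp_all
      then show "1 - (\<Sum>i=0..k. 2 ^ 2 ^ v i * a n ^ t i) \<le> measure (LM_measure n (p n)) (G n)"
        using lower[OF n] by linarith
    qed
    have "measure (LM_measure n (p n)) (G n) \<le> 1" for n
      using measure_LM_mono[OF p, of "G n" "LM_complexes n" n] measure_LM_space[OF p, of n] by (auto simp: G_def)
    then show "\<forall>\<^sub>F n in sequentially. measure (LM_measure n (p n)) (G n) \<le> 1" by simp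
  qed
  then show ?thesis unfolding G_def .
qed

end
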